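(* Let $(M^8,\Phi)$ be a manifold with a $\mathrm{Spin}(7)$-structure, with torsion endomorphism $T\in\Gamma(T^*M\otimes W_7(M))$ and $3$-fold cross product $P$, and let $H_{\pi_7([P,P]^{FN})}\in\Gamma(T^*M\otimes W_7(M))$ be the section associated with $\pi_7([P,P]^{FN})$. Decompose $T^*M\otimes W_7(M)=W_8(M)\oplus W_{48}(M)$ with projections $pr_8$, $pr_{48}$. Then for each $k\in\{8,48\}$ the $W_k(M)$-component of $T$ vanishes if and only if the $W_k(M)$-component of $H_{\pi_7([P,P]^{FN})}$ vanishes. Consequently, the $4$ Fernández classes of $\mathrm{Spin}(7)$-structures (the class attached to a sub-sum of $W_8(M)\oplus W_{48}(M)$ consists of those $\Phi$ for which $T$ is a section of that sub-sum) are characterized as follows: for each choice of $A\in\{T,\,H_{\pi_7([P,P]^{FN})}\}$, the $\mathrm{Spin}(7)$-structure belongs to the given class if and only if $A$ satisfies the stated relation: - $W_8\oplus W_{48}$: no relation; - $W_{48}$: $pr_8(A)=0$; - $W_8$: $pr_{48}(A)=0$; - $\{0\}$: $A=0$.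
   Context: All objects are smooth; $\Omega^k(M,TM)$ denotes $TM$-valued $k$-forms. Greek indices run over $0,\dots,7$, Latin ones over $1,\dots,7$. $\mathrm{Spin}(7)$-structure: on an oriented $8$-manifold $M$, a $4$-form $\Phi$ such that at each $p$ there is a positively oriented basis $(e_\mu)_{\mu=0}^7$ of $T_pM$ with dual basis $(e^\mu)$ (a $\mathrm{Spin}(7)$-frame) with $\Phi_p=e^0\wedge\varphi+\ast_7\varphi$, where $\varphi=e^{123}+e^{145}+e^{167}+e^{246}-e^{257}-e^{347}-e^{356}$ and $\ast_7\varphi=e^{4567}+e^{2367}+e^{2345}+e^{1357}-e^{1346}-e^{1256}-e^{1247}$. There is a unique Riemannian metric $g=g_\Phi$ for which every $\mathrm{Spin}(7)$-frame is orthonormal; $\nabla$ is its Levi-Civita connection. $\mathrm{Spin}(7)$ acts on $W_8\cong T_pM$ as the stabilizer of $\Phi_p$. Let $W_7$ be the $7$-dimensional irreducible $\mathrm{Spin}(7)$-module (given by the double cover $\mathrm{Spin}(7)\to SO(7)$) and $W_7(M)$ the rank-$7$ bundle associated with the principal bundle of $\mathrm{Spin}(7)$-frames. In a $\mathrm{Spin}(7)$-frame at $p$, $W_7(M)_p$ is identified with $V_7:=e_0^\perp=\mathrm{span}(e_1,\dots,e_7)$ (inner product restricted from $g$), and in this identification there are $\mathrm{Spin}(7)$-equivariant embeddings $\lambda^2(v)=e^0\wedge v^\flat+\imath_v\varphi\in\Lambda^2$ and $\lambda^4(v)=e^0\wedge(\imath_v\ast_7\varphi)-v^\flat\wedge\varphi\in\Lambda^4$,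 which yield bundle maps $\lambda^k:W_7(M)\to\Lambda^kT^*M$. Torsion endomorphism: the section $T\in\Omega^1(M,W_7(M))=\Gamma(T^*M\otimes W_7(M))$ with $\nabla_v\Phi=\lambda^4(T(v))$ for all $v\in TM$ (it exists and is unique). Cross product: $P:=-\delta_g(\Phi)\in\Omega^3(M,TM)$ where $\delta_g(\Psi)=\sum_\mu(\imath_{e_\mu}\Psi)\otimes(e^\mu)^\#$, i.e. $g(P(x,y,z),w)=\Phi(x,y,z,w)$. Frölicher–Nijenhuis bracket: the $\mathbb{R}$-bilinear bracket on $\Omega^*(M,TM)$ with $[\alpha\otimes X_1,\beta\otimes X_2]^{FN}=\alpha\wedge\beta\otimes[X_1,X_2]+\alpha\wedge\mathcal{L}_{X_1}\beta\otimes X_2-\mathcal{L}_{X_2}\alpha\wedge\beta\otimes X_1+(-1)^k(d\alpha\wedge(\imath_{X_1}\beta)\otimes X_2+(\imath_{X_2}\alpha)\wedge d\beta\otimes X_1)$ for $\alpha\in\Omega^k(M)$, $\beta\in\Omega^l(M)$ and vector fields $X_1,X_2$. Decomposition of $6$-forms: $\Lambda^6T^*M=\Lambda^6_7\oplus\Lambda^6_{21}$ with $\Lambda^6_7=\{\Phi\wedge\lambda^2(a)\mid a\in W_7(M)\}$ and $\Lambda^6_{21}=\{\alpha\mid\alpha\wedge\lambda^2(a)=0\ \forall a\in W_7(M)\}$; $\pi_7$ is the projection of $\Lambda^6T^*M\otimes TM$ onto $\Lambda^6_7T^*M\otimes TM$ along $\Lambda^6_{21}T^*M\otimes TM$. $H:\Lambda^6_7T^*M\otimes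 TM\to T^*M\otimes W_7(M)$ is the isomorphism $(\Phi\wedge\lambda^2(a))\otimes v\mapsto v^\flat\otimes a$, and $H_{\pi_7([P,P]^{FN})}$ is the image of $\pi_7([P,P]^{FN})$ under $H$. Decomposition of $T^*M\otimes W_7(M)$: it is the sum of two irreducible pieces; the $W_8(M)$-summand is $\{\sum_i(\imath_a\lambda^2(e_i))\otimes e_i\mid a\in TM\}$, where $(e_i)$ is an orthonormal basis of $W_7(M)_p\cong V_7$, and the $W_{48}(M)$-summand is its orthogonal complement. $pr_8$, $pr_{48}$ are the projections. *)

theory Defs
  imports "HOL-Analysis.Analysis"
begin

section \<open>Smooth functions and oriented smooth manifolds\<close>

primrec Ck_on :: "nat \<Rightarrow> 'v::real_normed_vector set \<Rightarrow> ('v \<Rightarrow> 'b::real_normed_vector) \<Rightarrow> bool" where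
  "Ck_on 0 S f \<longleftrightarrow> continuous_on S f"
| "Ck_on (Suc k) S f \<longleftrightarrow>
     (\<forall>x\<in>S. f differentiable (at x)) \<and> (\<forall>v. Ck_on k S (\<lambda>x. frechet_derivative f (at x) v))"

definition smooth_on :: "'v::real_normed_vector set \<Rightarrow> ('v \<Rightarrow> 'b::real_normed_vector) \<Rightarrow> bool" where
  "smooth_on S f \<longleftrightarrow> (\<forall>k. Ck_on k S f)"

text \<open>A chart is a pair of its domain and its coordinate map (which is irrelevant off the domain).\<close>

type_synonym ('a, 'n) chart = "'a set \<times> ('a \<Rightarrow> real^'n)"

definition chart_image :: "('a, 'n) chart \<Rightarrow> (real^'n) set" where
  "chart_image c = snd c ` fst c"

definition overlap :: "('a, 'n) chart \<Rightarrow> ('a, 'n) chart \<Rightarrow> (real^'n) set" where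
  "overlap c d = snd c ` (fst c \<inter> fst d)"

definition transition :: "('a, 'n) chart \<Rightarrow> ('a, 'n) chart \<Rightarrow> real^'n \<Rightarrow> real^'n" where
  "transition c d = snd d \<circ> inv_into (fst c) (snd c)"

definition transition_deriv ::
  "('a, 'n::finite) chart \<Rightarrow> ('a, 'n) chart \<Rightarrow> real^'n \<Rightarrow> real^'n \<Rightarrow> real^'n" where
  "transition_deriv c d x = frechet_derivative (transition c d) (at x)"

text \<open>The orientation is the one for which all charts of the atlas are positively oriented.\<close>

definition oriented_manifold :: "'a topology \<Rightarrow> ('a, 'n::finite) chart set \<Rightarrow> bool" where
  "oriented_manifold M A \<longleftrightarrow>
     Hausdorff_space M \<and> second_countable M \<and> (\<Union>c\<in>A. fst c) = topspace M \<and>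
     (\<forall>c\<in>A. openin M (fst c) \<and> open (chart_image c) \<and>
        homeomorphic_map (subtopology M (fst c)) (top_of_set (chart_image c)) (snd c)) \<and>
     (\<forall>c\<in>A. \<forall>d\<in>A. smooth_on (overlap c d) (transition c d) \<and>
        (\<forall>x\<in>overlap c d. det (matrix (transition_deriv c d x)) > 0))"

section \<open>Exterior algebra\<close>

text \<open>
  A \<open>k\<close>-form on \<open>real^'n\<close> is a function of a sequence of vectors that depends only on the first
  \<open>k\<close> entries. On a manifold, a tensor field is represented by the family of its local
  expressions in the charts of the atlas: \<open>\<omega> c x\<close> is the value at the point with coordinates \<open>x\<close>
  in the chart \<open>c\<close>, the tangent space being identified with \<open>real^'n\<close> by the coordinate basis.
\<close>

type_synonym 'n form = "(nat \<Rightarrow> real^'n) \<Rightarrow> real"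
type_synonym 'n vform = "(nat \<Rightarrow> real^'n) \<Rightarrow> real^'n"

definition is_form :: "nat \<Rightarrow> 'n::finite form \<Rightarrow> bool" where
  "is_form k \<alpha> \<longleftrightarrow>
     (\<forall>v w. (\<forall>i<k. v i = w i) \<longrightarrow> \<alpha> v = \<alpha> w) \<and>
     (\<forall>v. \<forall>i<k. linear (\<lambda>y. \<alpha> (v(i := y)))) \<and>
     (\<forall>v. \<forall>i<k. \<forall>j<k. i \<noteq> j \<and> v i = v j \<longrightarrow> \<alpha> v = 0)"

definition wedge :: "nat \<Rightarrow> nat \<Rightarrow> 'n form \<Rightarrow> 'n form \<Rightarrow> 'n form" where
  "wedge k l \<alpha> \<beta> v =
     (\<Sum>\<sigma> | \<sigma> permutes {..<k + l}.
        of_int (sign \<sigma>) * \<alpha> (\<lambda>i. v (\<sigma> i)) * \<beta> (\<lambda>i. v (\<sigma> (k + i)))) / (fact k * fact l)"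

definition interior :: "nat \<Rightarrow> real^'n \<Rightarrow> 'n form \<Rightarrow> 'n form" where
  "interior k x \<alpha> v = (if k = 0 then 0 else \<alpha> (case_nat x v))"

text \<open>\<open>coform [i, j, \<dots>]\<close> is \<open>e\<^sup>i \<and> e\<^sup>j \<and> \<dots>\<close> for the standard dual basis.\<close>

definition coform :: "'n::finite list \<Rightarrow> 'n form" where
  "coform is v =
     (\<Sum>\<sigma> | \<sigma> permutes {..<length is}. of_int (sign \<sigma>) * (\<Prod>j<length is. v (\<sigma> j) $ (is ! j)))"

definition form_field ::
  "nat \<Rightarrow> ('a, 'n::finite) chart set \<Rightarrow> (('a, 'n) chart \<Rightarrow> real^'n \<Rightarrow> 'n form) \<Rightarrow> bool" where
  "form_field k A \<omega> \<longleftrightarrow>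
     (\<forall>c\<in>A. (\<forall>x\<in>chart_image c. is_form k (\<omega> c x)) \<and>
        (\<forall>v. smooth_on (chart_image c) (\<lambda>x. \<omega> c x v))) \<and>
     (\<forall>c\<in>A. \<forall>d\<in>A. \<forall>x\<in>overlap c d. \<forall>v.
        \<omega> c x v = \<omega> d (transition c d x) (\<lambda>i. transition_deriv c d x (v i)))"

definition riemannian_metric ::
  "('a, 'n::finite) chart set \<Rightarrow> (('a, 'n) chart \<Rightarrow> real^'n \<Rightarrow> real^'n \<Rightarrow> real^'n \<Rightarrow> real) \<Rightarrow> bool" where
  "riemannian_metric A g \<longleftrightarrow>
     (\<forall>c\<in>A. (\<forall>x\<in>chart_image c. bilinear (g c x) \<and> (\<forall>v w. g c x v w = g c x w v) \<and>
          (\<forall>v. v \<noteq> 0 \<longrightarrow> g c x v v > 0)) \<and>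
        (\<forall>v w. smooth_on (chart_image c) (\<lambda>x. g c x v w))) \<and>
     (\<forall>c\<in>A. \<forall>d\<in>A. \<forall>x\<in>overlap c d. \<forall>v w.
        g c x v w = g d (transition c d x) (transition_deriv c d x v) (transition_deriv c d x w))"

text \<open>The vector dual to the covector \<open>\<theta>\<close> with respect to the inner product \<open>g\<close>.\<close>

definition sharp :: "(real^'n \<Rightarrow> real^'n \<Rightarrow> real) \<Rightarrow> (real^'n \<Rightarrow> real) \<Rightarrow> real^'n" where
  "sharp g \<theta> = (THE z. \<forall>w. g z w = \<theta> w)"

section \<open>Calculus on an open subset of \<open>real^'n\<close>\<close>

definition ext_deriv :: "nat \<Rightarrow> (real^'n::finite \<Rightarrow> 'n form) \<Rightarrow> real^'n \<Rightarrow> 'n form" where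
  "ext_deriv k \<alpha> x v =
     (\<Sum>i\<le>k. (-1) ^ i *
        frechet_derivative (\<lambda>y. \<alpha> y (\<lambda>j. if j < i then v j else v (Suc j))) (at x) (v i))"

definition lie_bracket ::
  "(real^'n::finite \<Rightarrow> real^'n) \<Rightarrow> (real^'n \<Rightarrow> real^'n) \<Rightarrow> real^'n \<Rightarrow> real^'n" where
  "lie_bracket X Y x =
     frechet_derivative Y (at x) (X x) - frechet_derivative X (at x) (Y x)"

text \<open>
  This is \<open>X(\<alpha>(v)) - (\<Sum>i. \<alpha>(\<dots>, [X, v\<^sub>i], \<dots>))\<close> for constant fields \<open>v\<^sub>i\<close>.
\<close>

definition lie_deriv ::
  "nat \<Rightarrow> (real^'n::finite \<Rightarrow> real^'n) \<Rightarrow> (real^'n \<Rightarrow> 'n form) \<Rightarrow> real^'n \<Rightarrow> 'n form" where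
  "lie_deriv k X \<alpha> x v =
     frechet_derivative (\<lambda>y. \<alpha> y v) (at x) (X x) +
     (\<Sum>i<k. \<alpha> x (v(i := frechet_derivative X (at x) (v i))))"

text \<open>The Froelicher-Nijenhuis bracket of \<open>\<alpha> \<otimes> X\<close> and \<open>\<beta> \<otimes> Y\<close>.\<close>

definition fn_decomposable ::
  "nat \<Rightarrow> nat \<Rightarrow> (real^'n::finite \<Rightarrow> 'n form) \<Rightarrow> (real^'n \<Rightarrow> real^'n) \<Rightarrow>
     (real^'n \<Rightarrow> 'n form) \<Rightarrow> (real^'n \<Rightarrow> real^'n) \<Rightarrow> real^'n \<Rightarrow> 'n vform" where
  "fn_decomposable k l \<alpha> X \<beta> Y x v =
     wedge k l (\<alpha> x) (\<beta> x) v *\<^sub>R lie_bracket X Y x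
     + wedge k l (\<alpha> x) (lie_deriv l X \<beta> x) v *\<^sub>R Y x
     - wedge k l (lie_deriv k Y \<alpha> x) (\<beta> x) v *\<^sub>R X x
     + (-1) ^ k *\<^sub>R
        (wedge (k + 1) (l - 1) (ext_deriv k \<alpha> x) (interior l (X x) (\<beta> x)) v *\<^sub>R Y x
         + wedge (k - 1) (l + 1) (interior k (Y x) (\<alpha> x)) (ext_deriv l \<beta> x) v *\<^sub>R X x)"

text \<open>
  In a chart every vector-valued form is \<open>K = (\<Sum>\<mu>. K\<^sup>\<mu> \<otimes> \<partial>\<^sub>\<mu>)\<close>, so bilinearity determines the
  bracket from its values on decomposable forms. The result does not depend on the chart.
\<close>

definition fn_bracket ::
  "nat \<Rightarrow> nat \<Rightarrow> (real^'n::finite \<Rightarrow> 'n vform) \<Rightarrow> (real^'n \<Rightarrow> 'n vform) \<Rightarrow> real^'n \<Rightarrow> 'n vform" where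
  "fn_bracket k l K L x v =
     (\<Sum>\<mu>\<in>UNIV. \<Sum>\<nu>\<in>UNIV.
        fn_decomposable k l (\<lambda>y w. K y w $ \<mu>) (\<lambda>_. axis \<mu> 1)
          (\<lambda>y w. L y w $ \<nu>) (\<lambda>_. axis \<nu> 1) x v)"

text \<open>
  \<open>christoffel g x a b\<close> is \<open>\<nabla>\<^sub>a b\<close> for constant fields \<open>a\<close>, \<open>b\<close> and the Levi-Civita connection of
  \<open>g\<close>, by the Koszul formula.
\<close>

definition christoffel ::
  "(real^'n::finite \<Rightarrow> real^'n \<Rightarrow> real^'n \<Rightarrow> real) \<Rightarrow> real^'n \<Rightarrow> real^'n \<Rightarrow> real^'n \<Rightarrow> real^'n" where
  "christoffel g x a b = sharp (g x) (\<lambda>w.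
     (frechet_derivative (\<lambda>y. g y b w) (at x) a
      + frechet_derivative (\<lambda>y. g y a w) (at x) b
      - frechet_derivative (\<lambda>y. g y a b) (at x) w) / 2)"

definition cov_deriv ::
  "(real^'n::finite \<Rightarrow> real^'n \<Rightarrow> real^'n \<Rightarrow> real) \<Rightarrow> nat \<Rightarrow> (real^'n \<Rightarrow> 'n form) \<Rightarrow>
     real^'n \<Rightarrow> real^'n \<Rightarrow> 'n form" where
  "cov_deriv g k \<alpha> x a v =
     frechet_derivative (\<lambda>y. \<alpha> y v) (at x) a
     - (\<Sum>i<k. \<alpha> x (v(i := christoffel g x a (v i))))"

section \<open>The model \<open>Spin(7)\<close>-structure\<close>

definition phi0 :: "8 form" where
  "phi0 v = coform [1,2,3] v + coform [1,4,5] v + coform [1,6,7] v + coform [2,4,6] v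
     - coform [2,5,7] v - coform [3,4,7] v - coform [3,5,6] v"

definition star_phi0 :: "8 form" where
  "star_phi0 v = coform [4,5,6,7] v + coform [2,3,6,7] v + coform [2,3,4,5] v + coform [1,3,5,7] v
     - coform [1,3,4,6] v - coform [1,2,5,6] v - coform [1,2,4,7] v"

definition Phi0 :: "8 form" where
  "Phi0 v = wedge 1 3 (coform [0]) phi0 v + star_phi0 v"

definition flat0 :: "real^8 \<Rightarrow> 8 form" where
  "flat0 a v = a \<bullet> v 0"

definition V7 :: "(real^8) set" where
  "V7 = {a. a $ 0 = 0}"

definition lam2_0 :: "real^8 \<Rightarrow> 8 form" where
  "lam2_0 a v = wedge 1 1 (coform [0]) (flat0 a) v + interior 3 a phi0 v"

definition lam4_0 :: "real^8 \<Rightarrow> 8 form" where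
  "lam4_0 a v = wedge 1 3 (coform [0]) (interior 4 a star_phi0) v - wedge 1 3 (flat0 a) phi0 v"

text \<open>
  A basis \<open>(e\<^sub>\<mu>)\<close> of a tangent space is given by the invertible matrix \<open>U\<close> whose \<open>\<mu>\<close>-th column is
  \<open>e\<^sub>\<mu>\<close>. A form on the model space, written in terms of the standard dual basis, becomes the form
  given by the same expression in terms of the dual basis \<open>(e\<^sup>\<mu>)\<close>.
\<close>

definition in_frame :: "real^'n^'n::finite \<Rightarrow> 'n form \<Rightarrow> 'n form" where
  "in_frame U \<alpha> v = \<alpha> (\<lambda>i. matrix_inv U *v v i)"

definition spin7_frame :: "8 form \<Rightarrow> real^8^8 \<Rightarrow> bool" where
  "spin7_frame \<Psi> U \<longleftrightarrow> det U > 0 \<and> \<Psi> = in_frame U Phi0"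

definition spin7_group :: "(real^8^8) set" where
  "spin7_group = {G. spin7_frame Phi0 G}"

text \<open>
  The action of \<open>Spin(7)\<close> on \<open>V7\<close> through \<open>Spin(7) \<rightarrow> SO(7)\<close>: it is the action for which \<open>lam2_0\<close>
  (and also \<open>lam4_0\<close>) is equivariant.
\<close>

definition rho7 :: "real^8^8 \<Rightarrow> real^8 \<Rightarrow> real^8" where
  "rho7 G a = (THE b. b \<in> V7 \<and> lam2_0 b = in_frame G (lam2_0 a))"

section \<open>The bundle \<open>W\<^sub>7(M)\<close>\<close>

text \<open>
  \<open>\<Psi>\<close> is the value at a point of the \<open>4\<close>-form. An element of the fibre of the associated bundle is
  encoded as the equivariant map sending each \<open>Spin(7)\<close>-frame \<open>U\<close> at the point to the
  representative in \<open>V7\<close> with respect to \<open>U\<close> (and, to make the encoding unique, all other matrices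
  to \<open>0\<close>). The vector space operations are pointwise.
\<close>

type_synonym w7 = "real^8^8 \<Rightarrow> real^8"

definition W7 :: "8 form \<Rightarrow> w7 set" where
  "W7 \<Psi> = {w. (\<forall>U. \<not> spin7_frame \<Psi> U \<longrightarrow> w U = 0) \<and>
     (\<forall>U. spin7_frame \<Psi> U \<longrightarrow> w U \<in> V7 \<and> (\<forall>G\<in>spin7_group. w U = rho7 G (w (U ** G))))}"

definition some_frame :: "8 form \<Rightarrow> real^8^8" where
  "some_frame \<Psi> = (SOME U. spin7_frame \<Psi> U)"

text \<open>By equivariance the following notions do not depend on the choice of the frame.\<close>

definition lam2 :: "8 form \<Rightarrow> w7 \<Rightarrow> 8 form" where
  "lam2 \<Psi> w = in_frame (some_frame \<Psi>) (lam2_0 (w (some_frame \<Psi>)))"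

definition lam4 :: "8 form \<Rightarrow> w7 \<Rightarrow> 8 form" where
  "lam4 \<Psi> w = in_frame (some_frame \<Psi>) (lam4_0 (w (some_frame \<Psi>)))"

text \<open>The fibre of \<open>T\<^sup>*M \<otimes> W\<^sub>7(M)\<close>, as linear maps from the tangent space to \<open>W7 \<Psi>\<close>.\<close>

definition cotW7 :: "8 form \<Rightarrow> (real^8 \<Rightarrow> w7) set" where
  "cotW7 \<Psi> = {\<tau>. (\<forall>v. \<tau> v \<in> W7 \<Psi>) \<and> (\<forall>U. linear (\<lambda>v. \<tau> v U))}"

definition cotW7_inner :: "8 form \<Rightarrow> (real^8 \<Rightarrow> w7) \<Rightarrow> (real^8 \<Rightarrow> w7) \<Rightarrow> real" where
  "cotW7_inner \<Psi> \<sigma> \<tau> =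
     (let U = some_frame \<Psi> in \<Sum>\<mu>\<in>UNIV. \<sigma> (column \<mu> U) U \<bullet> \<tau> (column \<mu> U) U)"

definition W8 :: "8 form \<Rightarrow> (real^8 \<Rightarrow> w7) set" where
  "W8 \<Psi> = {\<tau> \<in> cotW7 \<Psi>. \<exists>a. \<forall>U. spin7_frame \<Psi> U \<longrightarrow>
     (\<forall>v. \<tau> v U = (\<Sum>i\<in>UNIV - {0}.
        interior 2 a (in_frame U (lam2_0 (axis i 1))) (\<lambda>_. v) *\<^sub>R axis i 1))}"

definition W48 :: "8 form \<Rightarrow> (real^8 \<Rightarrow> w7) set" where
  "W48 \<Psi> = {\<tau> \<in> cotW7 \<Psi>. \<forall>\<sigma>\<in>W8 \<Psi>. cotW7_inner \<Psi> \<sigma> \<tau> = 0}"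

definition W8_plus_W48 :: "8 form \<Rightarrow> (real^8 \<Rightarrow> w7) set" where
  "W8_plus_W48 \<Psi> = {\<lambda>v U. \<sigma> v U + \<tau> v U | \<sigma> \<tau>. \<sigma> \<in> W8 \<Psi> \<and> \<tau> \<in> W48 \<Psi>}"

definition W_zero :: "8 form \<Rightarrow> (real^8 \<Rightarrow> w7) set" where
  "W_zero \<Psi> = {\<lambda>_ _. 0}"

definition proj_along :: "'b::minus set \<Rightarrow> 'b set \<Rightarrow> 'b \<Rightarrow> 'b" where
  "proj_along E F y = (THE z. z \<in> E \<and> y - z \<in> F)"

definition pr8 :: "8 form \<Rightarrow> (real^8 \<Rightarrow> w7) \<Rightarrow> (real^8 \<Rightarrow> w7)" where
  "pr8 \<Psi> = proj_along (W8 \<Psi>) (W48 \<Psi>)"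

definition pr48 :: "8 form \<Rightarrow> (real^8 \<Rightarrow> w7) \<Rightarrow> (real^8 \<Rightarrow> w7)" where
  "pr48 \<Psi> = proj_along (W48 \<Psi>) (W8 \<Psi>)"

section \<open>\<open>Spin(7)\<close>-structures, metric and torsion\<close>

definition spin7_structure ::
  "('a, 8) chart set \<Rightarrow> (('a, 8) chart \<Rightarrow> real^8 \<Rightarrow> 8 form) \<Rightarrow> bool" where
  "spin7_structure A \<Phi> \<longleftrightarrow>
     form_field 4 A \<Phi> \<and> (\<forall>c\<in>A. \<forall>x\<in>chart_image c. \<exists>U. spin7_frame (\<Phi> c x) U)"

definition spin7_metric ::
  "('a, 8) chart set \<Rightarrow> (('a, 8) chart \<Rightarrow> real^8 \<Rightarrow> 8 form) \<Rightarrow>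
     (('a, 8) chart \<Rightarrow> real^8 \<Rightarrow> real^8 \<Rightarrow> real^8 \<Rightarrow> real) \<Rightarrow> bool" where
  "spin7_metric A \<Phi> g \<longleftrightarrow>
     riemannian_metric A g \<and>
     (\<forall>c\<in>A. \<forall>x\<in>chart_image c. \<forall>U. spin7_frame (\<Phi> c x) U \<longrightarrow>
        (\<forall>\<mu> \<nu>. g c x (column \<mu> U) (column \<nu> U) = (if \<mu> = \<nu> then 1 else 0)))"

type_synonym 'a cotW7_field = "('a, 8) chart \<Rightarrow> real^8 \<Rightarrow> real^8 \<Rightarrow> w7"

text \<open>
  Smooth sections of \<open>T\<^sup>*M \<otimes> W\<^sub>7(M)\<close>. Smoothness is expressed through the bundle embedding
  \<open>\<lambda>\<^sup>2\<close>; under a change of chart with differential \<open>D\<close> the frame \<open>U\<close> becomes \<open>D U\<close>.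
\<close>

definition cotW7_section ::
  "('a, 8) chart set \<Rightarrow> (('a, 8) chart \<Rightarrow> real^8 \<Rightarrow> 8 form) \<Rightarrow> 'a cotW7_field \<Rightarrow> bool" where
  "cotW7_section A \<Phi> T \<longleftrightarrow>
     (\<forall>c\<in>A. (\<forall>x\<in>chart_image c. T c x \<in> cotW7 (\<Phi> c x)) \<and>
        (\<forall>v w. smooth_on (chart_image c) (\<lambda>x. lam2 (\<Phi> c x) (T c x v) w))) \<and>
     (\<forall>c\<in>A. \<forall>d\<in>A. \<forall>x\<in>overlap c d. \<forall>v U.
        T c x v U = T d (transition c d x) (transition_deriv c d x v)
          (matrix (transition_deriv c d x) ** U))"

definition torsion_endomorphism ::
  "('a, 8) chart set \<Rightarrow> (('a, 8) chart \<Rightarrow> real^8 \<Rightarrow> 8 form) \<Rightarrow>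
     (('a, 8) chart \<Rightarrow> real^8 \<Rightarrow> real^8 \<Rightarrow> real^8 \<Rightarrow> real) \<Rightarrow> 'a cotW7_field \<Rightarrow> bool" where
  "torsion_endomorphism A \<Phi> g T \<longleftrightarrow>
     cotW7_section A \<Phi> T \<and>
     (\<forall>c\<in>A. \<forall>x\<in>chart_image c. \<forall>v.
        cov_deriv (g c) 4 (\<Phi> c) x v = lam4 (\<Phi> c x) (T c x v))"

text \<open>
  The Fernandez class attached to a sub-bundle \<open>S\<close>. The metric and the torsion endomorphism of a
  \<open>Spin(7)\<close>-structure exist and are unique.
\<close>

definition fernandez_class ::
  "('a, 8) chart set \<Rightarrow> (8 form \<Rightarrow> (real^8 \<Rightarrow> w7) set) \<Rightarrow>
     (('a, 8) chart \<Rightarrow> real^8 \<Rightarrow> 8 form) set" where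
  "fernandez_class A S =
     {\<Phi>. spin7_structure A \<Phi> \<and>
        (\<exists>g T. spin7_metric A \<Phi> g \<and> torsion_endomorphism A \<Phi> g T \<and>
          (\<forall>c\<in>A. \<forall>x\<in>chart_image c. T c x \<in> S (\<Phi> c x)))}"

section \<open>The cross product and the section \<open>H\<close>\<close>

definition delta_op :: "(real^'n \<Rightarrow> real^'n \<Rightarrow> real) \<Rightarrow> 'n::finite form \<Rightarrow> 'n vform" where
  "delta_op g \<alpha> v = (\<Sum>\<mu>\<in>UNIV. \<alpha> (case_nat (axis \<mu> 1) v) *\<^sub>R sharp g (\<lambda>w. w $ \<mu>))"

definition cross_product ::
  "(('a, 8) chart \<Rightarrow> real^8 \<Rightarrow> 8 form) \<Rightarrow>
     (('a, 8) chart \<Rightarrow> real^8 \<Rightarrow> real^8 \<Rightarrow> real^8 \<Rightarrow> real) \<Rightarrow> ('a, 8) chart \<Rightarrow> real^8 \<Rightarrow> 8 vform" where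
  "cross_product \<Phi> g c x v = - delta_op (g c x) (\<Phi> c x) v"

definition Lambda6_7 :: "8 form \<Rightarrow> 8 form set" where
  "Lambda6_7 \<Psi> = {wedge 4 2 \<Psi> (lam2 \<Psi> a) | a. a \<in> W7 \<Psi>}"

definition Lambda6_21 :: "8 form \<Rightarrow> 8 form set" where
  "Lambda6_21 \<Psi> = {\<alpha>. is_form 6 \<alpha> \<and> (\<forall>a\<in>W7 \<Psi>. \<forall>v. wedge 6 2 \<alpha> (lam2 \<Psi> a) v = 0)}"

definition tensor_TM :: "'n::finite form set \<Rightarrow> 'n vform set" where
  "tensor_TM E = {K. \<forall>\<mu>. (\<lambda>v. K v $ \<mu>) \<in> E}"

definition pi7 :: "8 form \<Rightarrow> 8 vform \<Rightarrow> 8 vform" where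
  "pi7 \<Psi> = proj_along (tensor_TM (Lambda6_7 \<Psi>)) (tensor_TM (Lambda6_21 \<Psi>))"

text \<open>The linear map determined by \<open>(\<Psi> \<and> \<lambda>\<^sup>2(a)) \<otimes> v \<mapsto> v\<^sup>\<flat> \<otimes> a\<close>.\<close>

definition H_iso ::
  "8 form \<Rightarrow> (real^8 \<Rightarrow> real^8 \<Rightarrow> real) \<Rightarrow> 8 vform \<Rightarrow> (real^8 \<Rightarrow> w7)" where
  "H_iso \<Psi> g K =
     (THE \<tau>. \<exists>(n::nat) a v. (\<forall>i<n. a i \<in> W7 \<Psi>) \<and>
        K = (\<lambda>w. \<Sum>i<n. wedge 4 2 \<Psi> (lam2 \<Psi> (a i)) w *\<^sub>R v i) \<and>
        \<tau> = (\<lambda>y U. \<Sum>i<n. g (v i) y *\<^sub>R a i U))"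

definition H_PP ::
  "(('a, 8) chart \<Rightarrow> real^8 \<Rightarrow> 8 form) \<Rightarrow>
     (('a, 8) chart \<Rightarrow> real^8 \<Rightarrow> real^8 \<Rightarrow> real^8 \<Rightarrow> real) \<Rightarrow> 'a cotW7_field" where
  "H_PP \<Phi> g c x =
     H_iso (\<Phi> c x) (g c x)
       (pi7 (\<Phi> c x) (fn_bracket 3 3 (cross_product \<Phi> g c) (cross_product \<Phi> g c) x))"

definition vanishes :: "('a, 8) chart set \<Rightarrow> 'a cotW7_field \<Rightarrow> bool" where
  "vanishes A B \<longleftrightarrow> (\<forall>c\<in>A. \<forall>x\<in>chart_image c. B c x = (\<lambda>_ _. 0))"

end

theory Submission
  imports Defs
begin

text \<open>
  In a \<open>Spin(7)\<close>-frame at a point, \<open>T\<close> becomes a linear map \<open>t\<close> from \<open>real^8\<close> to \<open>V7\<close>. The bracket \<open>[P, P]\<close>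
  is algebraic in the first jet of \<open>P\<close>. As the Levi-Civita connection is torsion free, the coordinate
  derivatives in it may be replaced by covariant derivatives, and those are given by \<open>\<lambda>\<^sup>4(T)\<close> since the
  metric is parallel. Hence in the frame the section \<open>H\<close> is a linear function of \<open>t\<close> with constant
  coefficients. Instead of appealing to Schur's lemma, we evaluate these coefficients with the
  multiplication table of the octonions. The result is \<open>H = - 2 T - (2/3) J J\<^sup>T T\<close>, where \<open>J\<close> maps \<open>a\<close> to
  \<open>\<Sum>i. (\<iota>\<^sub>a \<lambda>\<^sup>2(e\<^sub>i)) \<otimes> e\<^sub>i\<close>. The image of \<open>J\<close> is \<open>W8\<close>, and \<open>J\<^sup>T J = 7\<close>, so \<open>H\<close> is \<open>- (20/3) T\<close> on \<open>W8\<close> and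
  \<open>- 2 T\<close> on \<open>W48\<close>.
\<close>

text \<open>The component of the bracket in \<open>Lambda6_7\<close> is found by a pairing. A form
  of top degree is determined by one number, its value on a basis, so \<alpha> \<mapsto> \<alpha>
  \<and> \<open>lam2_0 b\<close> pairs 6-forms with \<open>V7\<close>. The kernel of this pairing is
  \<open>Lambda6_21\<close>, and on \<open>Lambda6_7\<close> it is 12 times the inner product. For
  half the bracket the pairing equals -12 <t, b> - 4 <J J^T t, b>; doubling and dividing by 12 gives
  the coefficients -2 and -2/3.

  The obstacle is size: an alternating sum over 8! permutations with further contractions inside is
  too large to evaluate directly. Wedge products on basis vectors are therefore sums over shuffles,
  with signs kept as Booleans. Moreover a product of octonion basis elements is a basis element up
  to sign, whose index is an exclusive or. So every contracted index is forced by the others, and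
  each inner sum collapses to at most one signed monomial. What remains is a finite check by
  \<open>code_simp\<close>.\<close>

abbreviation (input) tr :: "nat \<Rightarrow> nat \<Rightarrow> nat \<Rightarrow> nat" where
  "tr \<equiv> Transposition.transpose"

section \<open>Antisymmetrization over permutations\<close>

definition alt :: "nat \<Rightarrow> ((nat \<Rightarrow> 'v) \<Rightarrow> 'b::real_vector) \<Rightarrow> (nat \<Rightarrow> 'v) \<Rightarrow> 'b" where
  "alt n F v = (\<Sum>\<sigma> | \<sigma> permutes {..<n}. real_of_int (sign \<sigma>) *\<^sub>R F (v \<circ> \<sigma>))"

text \<open>\<open>alt\<close> carries no normalizing factor and takes values in any real vector
  space, so that it serves both for the real-valued \<open>wedge\<close> and for the vector-valued
  bracket.\<close>

lemma wedge_eq_alt: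
  "wedge k l \<alpha> \<beta> v = alt (k + l) (\<lambda>u. \<alpha> u * \<beta> (\<lambda>i. u (k + i))) v / (fact k * fact l)"
  by (simp add: wedge_def alt_def o_def mult.assoc)

lemma permutation_if_permutes: "\<sigma> permutes {..<n::nat} \<Longrightarrow> permutation \<sigma>"
  using permutation_permutes by blast

text \<open>Here \<tau> permutes the slots of \<open>F\<close>, in \<open>alt_perm\<close> it
  permutes the vectors; the substitutions in the sum are composition with \<tau> on the right and on
  the left.\<close>

lemma alt_reindex:
  assumes "\<tau> permutes {..<n}"
  shows "alt n (\<lambda>u. F (u \<circ> \<tau>)) v = real_of_int (sign \<tau>) *\<^sub>R alt n F v"
proof -
  have "alt n F v = (\<Sum>\<sigma> | \<sigma> permutes {..<n}. real_of_int (sign (\<sigma> \<circ> \<tau>)) *\<^sub>R F (v \<circ> (\<sigma> \<circ> \<tau>)))"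
    unfolding alt_def by (rule sum_permutations_compose_right[OF assms])
  also have "\<dots> = (\<Sum>\<sigma> | \<sigma> permutes {..<n}. real_of_int (sign \<tau>) *\<^sub>R (real_of_int (sign \<sigma>) *\<^sub>R F (v \<circ> \<sigma> \<circ> \<tau>)))"
    by (rule sum.cong) (auto simp: sign_compose permutation_if_permutes[OF assms] permutation_if_permutes o_assoc mult.commute)
  also have "\<dots> = real_of_int (sign \<tau>) *\<^sub>R alt n (\<lambda>u. F (u \<circ> \<tau>)) v"
    by (simp add: alt_def scaleR_sum_right)
  finally have "alt n F v = real_of_int (sign \<tau>) *\<^sub>R alt n (\<lambda>u. F (u \<circ> \<tau>)) v" .
  then show ?thesis
    by (simp flip: of_int_mult)
qed

lemma alt_perm:
  assumes "\<tau> permutes {..<n}"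
  shows "alt n F (v \<circ> \<tau>) = real_of_int (sign \<tau>) *\<^sub>R alt n F v"
proof -
  have "alt n F v = (\<Sum>\<sigma> | \<sigma> permutes {..<n}. real_of_int (sign (\<tau> \<circ> \<sigma>)) *\<^sub>R F (v \<circ> (\<tau> \<circ> \<sigma>)))"
    unfolding alt_def by (rule setum_permutations_compose_left[OF assms])
  also have "\<dots> = (\<Sum>\<sigma> | \<sigma> permutes {..<n}. real_of_int (sign \<tau>) *\<^sub>R (real_of_int (sign \<sigma>) *\<^sub>R F (v \<circ> \<tau> \<circ> \<sigma>)))"
    by (rule sum.cong) (auto simp: sign_compose permutation_if_permutes[OF assms] permutation_if_permutes o_assoc)
  also have "\<dots> = real_of_int (sign \<tau>) *\<^sub>R alt n F (v \<circ> \<tau>)"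
    by (simp add: alt_def scaleR_sum_right)
  finally have "alt n F v = real_of_int (sign \<tau>) *\<^sub>R alt n F (v \<circ> \<tau>)" .
  then show ?thesis
    by (simp flip: of_int_mult)
qed

text \<open>Agreement is asked only on rearrangements of the given \<open>v\<close> in its first
  \<open>n\<close> slots, so later entries such as \<open>v n\<close> can be treated as
  constants.\<close>

lemma alt_cong:
  "(\<And>q. q permutes {..<n} \<Longrightarrow> F (v \<circ> q) = G (v \<circ> q)) \<Longrightarrow> alt n F v = alt n G v"
  unfolding alt_def by (rule sum.cong) auto

lemma alt_add: "alt n (\<lambda>u. F u + G u) v = alt n F v + alt n G v"
  by (simp add: alt_def scaleR_add_right sum.distrib)

lemma alt_diff: "alt n (\<lambda>u. F u - G u) v = alt n F v - alt n G v"
  by (simp add: alt_def scaleR_diff_right sum_subtractf)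

lemma alt_scale: "alt n (\<lambda>u. c *\<^sub>R F u) v = c *\<^sub>R alt n F v"
  by (simp add: alt_def scaleR_sum_right mult.commute)

lemma alt_minus: "alt n (\<lambda>u. - F u) v = - alt n F v"
  by (simp add: alt_def sum_negf)

lemma alt_sum: "alt n (\<lambda>u. \<Sum>i\<in>I. F i u) v = (\<Sum>i\<in>I. alt n (F i) v)"
  unfolding alt_def by (simp add: scaleR_sum_right) (rule sum.swap)

lemma alt_linear_image:
  assumes "linear L" shows "alt n (\<lambda>u. L (F u)) v = L (alt n F v)"
  by (simp add: alt_def linear_sum[OF assms] linear_cmul[OF assms])

lemma alt_swap:
  assumes "a < n" "b < n" "a \<noteq> b"
  shows "alt n (\<lambda>u. F (u \<circ> tr a b)) v = - alt n F v"
  using alt_reindex[of "tr a b" n F v] assms by (simp add: permutes_swap_id sign_swap_id)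

lemma real_vector_eq_minus_self: "x = - x \<longleftrightarrow> x = (0::'b::real_vector)"
proof
  assume "x = - x"
  then have "2 *\<^sub>R x = 0" by (metis add.right_inverse scaleR_2)
  then show "x = 0" by simp
qed simp

lemma alt_eq_0_if_symmetric:
  assumes "a < n" "b < n" "a \<noteq> b" "\<And>u. F (u \<circ> tr a b) = F u"
  shows "alt n F v = (0::'b::real_vector)"
  using alt_swap[OF assms(1-3), of F v] assms(4) by (simp add: real_vector_eq_minus_self)

lemma alt_eq_minus_if_swap:
  assumes "a < n" "b < n" "a \<noteq> b" "\<And>u. G u = F (u \<circ> tr a b)"
  shows "alt n G v = - alt n F v"
proof -
  have "G = (\<lambda>u. F (u \<circ> tr a b))" using assms(4) by (rule ext)
  then show ?thesis using alt_swap[OF assms(1-3)] by simp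
qed

lemma alt_mult: "alt n (\<lambda>u. c * F u) v = (c * alt n F v :: real)"
  by (simp add: alt_def sum_distrib_left mult.left_commute)

lemma alt_divide: "alt n (\<lambda>u. F u / c) v = (alt n F v / c :: real)"
  by (simp add: alt_def sum_divide_distrib)

text \<open>Splits the permutations by the slot into which the last vector goes.\<close>

lemma alt_Suc:
  "alt (Suc n) F v =
     (\<Sum>b\<le>n. (if b = n then 1 else - 1) *\<^sub>R alt n (\<lambda>u. F (u \<circ> tr n b)) v)"
proof -
  have ins: "{..<Suc n} = insert n {..<n}" by auto
  \<comment> \<open>Passing to inverses turns the decomposition \<open>tr n b \<circ> q\<close> into
    \<open>inv q \<circ> tr n b\<close>, so that the transposition acts on the slots of
    \<open>F\<close> and the rest is again an alternation over \<open>n\<close> vectors.\<close>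
  have "alt (Suc n) F v =
     (\<Sum>\<sigma> | \<sigma> permutes {..<Suc n}. real_of_int (sign (inv \<sigma>)) *\<^sub>R F (v \<circ> inv \<sigma>))"
    unfolding alt_def by (rule sum_permutations_inverse)
  also have "\<dots> = (\<Sum>b\<in>insert n {..<n}. \<Sum>q | q permutes {..<n}.
       real_of_int (sign (inv (tr n b \<circ> q))) *\<^sub>R F (v \<circ> inv (tr n b \<circ> q)))"
    unfolding ins by (rule sum_over_permutations_insert) auto
  also have "\<dots> = (\<Sum>b\<in>insert n {..<n}. \<Sum>q | q permutes {..<n}.
       (if b = n then 1 else - 1) *\<^sub>R (real_of_int (sign (inv q)) *\<^sub>R F (v \<circ> inv q \<circ> tr n b)))"
  proof (intro sum.cong refl)
    fix b q assume b: "b \<in> insert n {..<n}" and "q \<in> {q. q permutes {..<n}}"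
    then have q: "q permutes {..<n}" by simp
    have bij: "bij q" "bij (tr n b)" using q permutes_bij by auto
    have "inv (tr n b \<circ> q) = inv q \<circ> tr n b"
      using o_inv_distrib[OF bij(2,1)] by simp
    moreover have "sign (inv q \<circ> tr n b) = sign (inv q) * (if b = n then 1 else - 1)"
      using q by (subst sign_compose) (auto simp: permutation_inverse permutation_if_permutes sign_swap_id permutation_swap_id)
    ultimately show "real_of_int (sign (inv (tr n b \<circ> q))) *\<^sub>R F (v \<circ> inv (tr n b \<circ> q)) =
       (if b = n then 1 else - 1) *\<^sub>R (real_of_int (sign (inv q)) *\<^sub>R F (v \<circ> inv q \<circ> tr n b))"
      by (simp add: o_assoc)
  qed
  also have "\<dots> = (\<Sum>b\<in>insert n {..<n}. (if b = n then 1 else - 1) *\<^sub>R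
       (\<Sum>q | q permutes {..<n}. real_of_int (sign (inv q)) *\<^sub>R F (v \<circ> inv q \<circ> tr n b)))"
    by (simp add: scaleR_sum_right)
  also have "\<dots> = (\<Sum>b\<in>insert n {..<n}. (if b = n then 1 else - 1) *\<^sub>R alt n (\<lambda>u. F (u \<circ> tr n b)) v)"
    unfolding alt_def
    by (subst sum_permutations_inverse[of "\<lambda>\<sigma>. real_of_int (sign \<sigma>) *\<^sub>R F (v \<circ> \<sigma> \<circ> tr n b)" "{..<n}" for b]) (rule refl)
  also have "insert n {..<n} = {..n}" by auto
  finally show ?thesis .
qed

lemma alt_0 [simp]: "alt 0 F v = F v"
  by (simp add: alt_def sign_id)

section \<open>Forms\<close>

lemma is_form_cong:
  "is_form k \<alpha> \<Longrightarrow> (\<And>i. i < k \<Longrightarrow> v i = w i) \<Longrightarrow> \<alpha> v = \<alpha> w"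
  unfolding is_form_def by blast

lemma is_form_linear: "is_form k \<alpha> \<Longrightarrow> i < k \<Longrightarrow> linear (\<lambda>y. \<alpha> (v(i := y)))"
  unfolding is_form_def by blast

lemma is_form_eq_0: "is_form k \<alpha> \<Longrightarrow> i < k \<Longrightarrow> j < k \<Longrightarrow> i \<noteq> j \<Longrightarrow> v i = v j \<Longrightarrow> \<alpha> v = 0"
  unfolding is_form_def by blast

text \<open>Polarization: \<alpha> vanishes when \<open>v i + v j\<close> stands in both slots, and
  expanding leaves the two mixed terms.\<close>

lemma is_form_swap:
  assumes f: "is_form k \<alpha>" and ij: "i < k" "j < k" "i \<noteq> j"
  shows "\<alpha> (v \<circ> tr i j) = - \<alpha> v"
proof -
  let ?f = "\<lambda>x y. \<alpha> (v(i := x, j := y))"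
  have li: "linear (\<lambda>x. ?f x y)" for y
    using is_form_linear[OF f ij(1), of "v(j := y)"] ij(3) by (simp add: fun_upd_twist)
  have lj: "linear (\<lambda>y. ?f x y)" for x
    using is_form_linear[OF f ij(2)] by simp
  have z: "?f x x = 0" for x
    by (rule is_form_eq_0[OF f ij]) (use ij in auto)
  have "0 = ?f (v i + v j) (v i + v j)" using z by simp
  also have "\<dots> = (?f (v i) (v i) + ?f (v i) (v j)) + (?f (v j) (v i) + ?f (v j) (v j))"
    by (simp only: linear_add[OF li] linear_add[OF lj])
  also have "\<dots> = ?f (v i) (v j) + ?f (v j) (v i)"
    by (simp only: z add_0_left add_0_right)
  finally have "?f (v j) (v i) = - ?f (v i) (v j)" by linarith
  moreover have "v(i := v j, j := v i) = v \<circ> tr i j"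
    using ij by (auto simp: Transposition.transpose_def fun_eq_iff)
  moreover have "v(i := v i, j := v j) = v" by auto
  ultimately show ?thesis by simp
qed

text \<open>Moving the first vector to slot \<open>m\<close> is a product of \<open>m\<close>
  adjacent transpositions.\<close>

lemma is_form_rotate:
  assumes f: "is_form k \<alpha>" and "m < k"
  shows "\<alpha> (\<lambda>i. if i < m then w (Suc i) else if i = m then w 0 else w i) = (-1) ^ m * \<alpha> w"
  using \<open>m < k\<close>
proof (induction m)
  case 0
  have "(\<lambda>i. if i < 0 then w (Suc i) else if i = 0 then w 0 else w i) = w" by auto
  then show ?case by simp
next
  case (Suc m)
  have "(\<lambda>i. if i < Suc m then w (Suc i) else if i = Suc m then w 0 else w i) =
     (\<lambda>i. if i < m then w (Suc i) else if i = m then w 0 else w i) \<circ> tr m (Suc m)"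
    by (auto simp: fun_eq_iff Transposition.transpose_def)
  then show ?case
    using Suc is_form_swap[OF f, of m "Suc m"] by simp
qed

text \<open>Unlike \<open>interior\<close>, this fills the last slot, so the other vectors keep
  their positions and \<open>alt_Suc\<close>, which splits off the last vector, applies
  directly.\<close>

definition interior_last :: "nat \<Rightarrow> real^'n \<Rightarrow> 'n form \<Rightarrow> 'n form" where
  "interior_last k x \<alpha> v = \<alpha> (\<lambda>i. if i < k then v i else x)"

lemma wedge_0_0 [simp]: "wedge 0 0 \<alpha> \<beta> v = \<alpha> v * \<beta> v"
  by (simp add: wedge_eq_alt)

text \<open>The antiderivation property of the interior product, for insertion into the last slot.\<close>

lemma wedge_Suc:
  assumes n: "k + l = Suc n" and a: "is_form k \<alpha>" and b: "is_form l \<beta>"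
  shows "wedge k l \<alpha> \<beta> v =
     (if l > 0 then wedge k (l - 1) \<alpha> (interior_last (l - 1) (v n) \<beta>) v else 0)
     + (if k > 0 then (-1) ^ l * wedge (k - 1) l (interior_last (k - 1) (v n) \<alpha>) \<beta> v else 0)"
proof -
  define F where "F = (\<lambda>u. \<alpha> u * \<beta> (\<lambda>i. u (k + i)))"
  define A where "A c = (if c = n then 1 else - 1) *\<^sub>R alt n (\<lambda>u. F (u \<circ> tr n c)) v" for c
  have qn: "q n = n" if "q permutes {..<n}" for q using permutes_not_in[OF that] by simp
  \<comment> \<open>The last vector goes to \<beta>. All \<open>l\<close> slots contribute equally,
    because a swap inside \<beta> compensates the sign of the transposition.\<close>
  have hi: "A c = fact k * fact (l - 1) * wedge k (l - 1) \<alpha> (interior_last (l - 1) (v n) \<beta>) v"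
    if c: "k \<le> c" "c \<le> n" for c
  proof -
    have l: "l = Suc (n - k)" "k + (l - 1) = n" using n c by auto
    have "(if c = n then 1 else - 1) *\<^sub>R F (u \<circ> tr n c) = F u" for u
    proof (cases "c = n")
      case False
      have "\<alpha> (u \<circ> tr n c) = \<alpha> u"
        by (rule is_form_cong[OF a]) (use c False in \<open>auto simp: Transposition.transpose_def\<close>)
      moreover have "(\<lambda>i. (u \<circ> tr n c) (k + i)) = (\<lambda>i. u (k + i)) \<circ> tr (n - k) (c - k)"
        using c False by (auto simp: fun_eq_iff Transposition.transpose_def)
      moreover have "n - k < l" "c - k < l" "n - k \<noteq> c - k" using c False l by auto
      ultimately show ?thesis using False is_form_swap[OF b, of "n - k" "c - k" "\<lambda>i. u (k + i)"]
        by (simp add: F_def)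
    qed (simp)
    then have "A c = alt n F v"
      unfolding A_def alt_scale[symmetric] by simp
    also have "\<dots> = alt n (\<lambda>u. \<alpha> u * interior_last (l - 1) (v n) \<beta> (\<lambda>i. u (k + i))) v"
    proof (rule alt_cong)
      fix q assume q: "q permutes {..<n}"
      have "\<beta> (\<lambda>i. (v \<circ> q) (k + i)) = interior_last (l - 1) (v n) \<beta> (\<lambda>i. (v \<circ> q) (k + i))"
        unfolding interior_last_def
      proof (rule is_form_cong[OF b])
        fix i assume "i < l"
        then show "(v \<circ> q) (k + i) = (if i < l - 1 then (v \<circ> q) (k + i) else v n)"
          using qn[OF q] l c by (cases "i = l - 1") auto
      qed
      then show "F (v \<circ> q) = \<alpha> (v \<circ> q) * interior_last (l - 1) (v n) \<beta> (\<lambda>i. (v \<circ> q) (k + i))"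
        by (simp add: F_def)
    qed
    finally show ?thesis using l by (simp add: wedge_eq_alt)
  qed
  \<comment> \<open>The last vector goes to \<alpha>. Every slot \<open>c < k\<close> is first
    traded for \<open>k - 1\<close>, the last slot of \<alpha>.\<close>
  have lo: "A c = fact (k - 1) * fact l * ((-1) ^ l * wedge (k - 1) l (interior_last (k - 1) (v n) \<alpha>) \<beta> v)"
    if c: "c < k" for c
  proof -
    have kl: "k - 1 + l = n" using n c by auto
    have step1: "A c = A (k - 1)"
    proof (cases "c = k - 1")
      case False
      show ?thesis
      proof (cases "l = 0")
        case True
        \<comment> \<open>For \<open>l = 0\<close> slot \<open>n\<close> belongs to \<alpha> itself,
          and the antisymmetry of \<alpha> cancels the sign in \<open>A c\<close>.\<close>
        then have k: "k = Suc n" using n by simp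
        have F: "F u = \<alpha> u * \<beta> u" for u
          unfolding F_def using is_form_cong[OF b, of "\<lambda>i. u (k + i)" u] True by simp
        have "\<beta> (u \<circ> p) = \<beta> u" for u p using is_form_cong[OF b, of "u \<circ> p" u] True by simp
        then have "F (u \<circ> tr n c) = - F u" for u
          using is_form_swap[OF a, of n c u] False c k by (simp add: F)
        then show ?thesis using False k
          by (simp add: A_def alt_minus)
      next
        case l: False
        \<comment> \<open>Slots \<open>c\<close> and \<open>k - 1\<close> both belong to \<alpha>:
          conjugating by \<open>?t\<close> costs one sign, and reindexing the alternation by
          \<open>?t\<close> costs a second one.\<close>
        let ?t = "tr c (k - 1)"
        have cn: "c \<noteq> n" "k - 1 \<noteq> n" "c < n" "k - 1 < n" using l n c by auto
        have "F (u \<circ> tr n c) = - F (u \<circ> ?t \<circ> tr n (k - 1))" for u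
        proof -
          have e: "?t \<circ> tr n (k - 1) = tr n c \<circ> ?t"
            using cn False by (auto simp: fun_eq_iff Transposition.transpose_def)
          have "\<alpha> (u \<circ> tr n c \<circ> ?t) = - \<alpha> (u \<circ> tr n c)"
            using is_form_swap[OF a, of c "k - 1"] c False by simp
          moreover have "(\<lambda>i. (u \<circ> tr n c \<circ> ?t) (k + i)) = (\<lambda>i. (u \<circ> tr n c) (k + i))"
            using c by (auto simp: fun_eq_iff Transposition.transpose_def)
          ultimately have "F (u \<circ> tr n c \<circ> ?t) = - F (u \<circ> tr n c)"
            by (simp add: F_def)
          then show ?thesis unfolding o_assoc[symmetric] e by simp
        qed
        then have "alt n (\<lambda>u. F (u \<circ> tr n c)) v = - alt n (\<lambda>u. (\<lambda>w. F (w \<circ> tr n (k - 1))) (u \<circ> ?t)) v"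
          by (simp add: alt_minus)
        also have "\<dots> = alt n (\<lambda>u. F (u \<circ> tr n (k - 1))) v"
          by (subst alt_swap) (use cn False in auto)
        finally show ?thesis using cn by (simp add: A_def)
      qed
    qed simp
    have step2: "(if k - 1 = n then 1 else - 1) *\<^sub>R F (v \<circ> q \<circ> tr n (k - 1)) =
        (-1) ^ l *\<^sub>R (interior_last (k - 1) (v n) \<alpha> (v \<circ> q) * \<beta> (\<lambda>i. (v \<circ> q) (k - 1 + i)))"
      if q: "q permutes {..<n}" for q
    proof -
      let ?u = "v \<circ> q"
      have al: "\<alpha> (?u \<circ> tr n (k - 1)) = interior_last (k - 1) (v n) \<alpha> ?u"
        unfolding interior_last_def
        by (rule is_form_cong[OF a]) (use c kl qn[OF q] in \<open>auto simp: Transposition.transpose_def\<close>)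
      show ?thesis
      proof (cases "l = 0")
        case True
        have "\<beta> (\<lambda>i. (?u \<circ> tr n (k - 1)) (k + i)) = \<beta> (\<lambda>i. (v \<circ> q) (k - 1 + i))"
          by (rule is_form_cong[OF b]) (use True in auto)
        then show ?thesis using al True kl by (simp add: F_def)
      next
        case False
        \<comment> \<open>The transposition leaves \<beta> with its vectors rotated by one place.
          The rotation contributes the sign with exponent \<open>l - 1\<close>, and the
          transposition supplies the missing factor -1.\<close>
        let ?w = "\<lambda>i. ?u (k - 1 + i)"
        have "\<beta> (\<lambda>i. (?u \<circ> tr n (k - 1)) (k + i)) =
            \<beta> (\<lambda>i. if i < l - 1 then ?w (Suc i) else if i = l - 1 then ?w 0 else ?w i)"
          by (rule is_form_cong[OF b]) (use c kl False in \<open>auto simp: Transposition.transpose_def\<close>)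
        also have "\<dots> = (-1) ^ (l - 1) * \<beta> ?w"
          by (rule is_form_rotate[OF b, where w = ?w]) (use False in simp)
        finally have be: "\<beta> (\<lambda>i. (?u \<circ> tr n (k - 1)) (k + i)) = (-1) ^ (l - 1) * \<beta> ?w" .
        have "(-1 :: real) ^ l = - ((-1) ^ (l - 1))" using False by (cases l) auto
        then show ?thesis using False kl al be by (simp add: F_def)
      qed
    qed
    have "A (k - 1) = alt n (\<lambda>u. (-1) ^ l *\<^sub>R (interior_last (k - 1) (v n) \<alpha> u * \<beta> (\<lambda>i. u (k - 1 + i)))) v"
      unfolding A_def alt_scale[symmetric] by (rule alt_cong) (use step2 in \<open>simp add: o_assoc\<close>)
    also have "\<dots> = fact (k - 1) * fact l * ((-1) ^ l * wedge (k - 1) l (interior_last (k - 1) (v n) \<alpha>) \<beta> v)"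
      unfolding alt_scale wedge_eq_alt kl by simp
    finally show ?thesis using step1 by simp
  qed
  have "alt (Suc n) F v = (\<Sum>c\<le>n. A c)"
    unfolding A_def by (rule alt_Suc)
  also have "{..n} = {..<k} \<union> {k..n}" using n by auto
  also have "(\<Sum>c\<in>{..<k} \<union> {k..n}. A c) = (\<Sum>c<k. A c) + (\<Sum>c=k..n. A c)"
    by (rule sum.union_disjoint) auto
  also have "(\<Sum>c<k. A c) = k * (fact (k - 1) * fact l * ((-1) ^ l * wedge (k - 1) l (interior_last (k - 1) (v n) \<alpha>) \<beta> v))"
    using lo by simp
  also have "(\<Sum>c=k..n. A c) = l * (fact k * fact (l - 1) * wedge k (l - 1) \<alpha> (interior_last (l - 1) (v n) \<beta>) v)"
  proof -
    have "card {k..n} = l" using n by simp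
    then show ?thesis using hi by simp
  qed
  finally have E: "alt (Suc n) F v =
      k * (fact (k - 1) * fact l * ((-1) ^ l * wedge (k - 1) l (interior_last (k - 1) (v n) \<alpha>) \<beta> v))
      + l * (fact k * fact (l - 1) * wedge k (l - 1) \<alpha> (interior_last (l - 1) (v n) \<beta>) v)" .
  have fk: "k * (fact (k - 1) * fact l * x) = (if k > 0 then fact k * fact l * x else 0)" for x :: real
    by (cases k) (simp_all add: mult.assoc)
  have fl: "l * (fact k * fact (l - 1) * x) = (if l > 0 then fact k * fact l * x else 0)" for x :: real
    by (cases l) (simp_all add: algebra_simps)
  have W: "wedge k l \<alpha> \<beta> v = alt (Suc n) F v / (fact k * fact l)"
    unfolding wedge_eq_alt n F_def ..
  show ?thesis
    unfolding W E fk fl by (simp add: add_divide_distrib)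
qed

lemma is_form_alt:
  assumes dep: "\<And>v w. (\<And>i. i < n \<Longrightarrow> v i = w i) \<Longrightarrow> F v = F w"
    and lin: "\<And>v i. i < n \<Longrightarrow> linear (\<lambda>y. F (v(i := y)))"
  shows "is_form n (alt n F)"
  unfolding is_form_def
proof (intro conjI allI impI)
  fix v w :: "nat \<Rightarrow> real^'a" assume vw: "\<forall>i<n. v i = w i"
  show "alt n F v = alt n F w"
    unfolding alt_def
  proof (intro sum.cong refl arg_cong2[where f=scaleR] dep)
    fix \<sigma> i assume "\<sigma> \<in> {\<sigma>. \<sigma> permutes {..<n}}" "i < n"
    then show "(v \<circ> \<sigma>) i = (w \<circ> \<sigma>) i" using vw permutes_in_image[of \<sigma> "{..<n}" i] by simp
  qed
next
  fix v :: "nat \<Rightarrow> real^'a" and i assume i: "i < n"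
  show "linear (\<lambda>y. alt n F (v(i := y)))"
    unfolding alt_def
  proof (intro linear_compose_sum ballI linear_compose_scale_right)
    fix \<sigma> assume "\<sigma> \<in> {\<sigma>. \<sigma> permutes {..<n}}"
    then have s: "\<sigma> permutes {..<n}" by simp
    have eq: "v(i := y) \<circ> \<sigma> = (v \<circ> \<sigma>)(inv \<sigma> i := y)" for y
      using permutes_inverses[OF s] by (auto simp: fun_eq_iff)
    have "inv \<sigma> i < n"
      using permutes_in_image[OF permutes_inv[OF s], of i] i by simp
    then show "linear (\<lambda>y. F (v(i := y) \<circ> \<sigma>))"
      unfolding eq by (rule lin)
  qed
next
  fix v :: "nat \<Rightarrow> real^'a" and i j assume ij: "i < n" "j < n" "i \<noteq> j \<and> v i = v j"
  then have "v \<circ> tr i j = v"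
    by (auto simp: fun_eq_iff Transposition.transpose_def)
  then show "alt n F v = 0"
    using alt_perm[of "tr i j" n F v] ij by (simp add: permutes_swap_id sign_swap_id)
qed

lemma linear_scale_left: "linear f \<Longrightarrow> linear (\<lambda>x. f x * (c::real))"
  using linear_compose_scale_right[of f c] by (simp add: mult.commute)

lemma linear_scale_right: "linear f \<Longrightarrow> linear (\<lambda>x. (c::real) * f x)"
  using linear_compose_scale_right[of f c] by simp

lemma is_formI:
  assumes "\<And>v w. (\<And>i. i < k \<Longrightarrow> v i = w i) \<Longrightarrow> \<alpha> v = \<alpha> w"
    and "\<And>v i. i < k \<Longrightarrow> linear (\<lambda>y. \<alpha> (v(i := y)))"
    and "\<And>v i j. i < k \<Longrightarrow> j < k \<Longrightarrow> i \<noteq> j \<Longrightarrow> v i = v j \<Longrightarrow> \<alpha> v = 0"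
  shows "is_form k \<alpha>"
  unfolding is_form_def using assms by blast

lemma is_form_scale: "is_form k \<alpha> \<Longrightarrow> is_form k (\<lambda>v. c * \<alpha> v)"
  by (rule is_formI)
    (auto intro: is_form_cong is_form_linear linear_scale_right dest: is_form_eq_0)

lemma is_form_add:
  assumes "is_form k \<alpha>" "is_form k \<beta>" shows "is_form k (\<lambda>v. \<alpha> v + \<beta> v)"
proof (rule is_formI)
  fix v w :: "nat \<Rightarrow> real^'a" assume "\<And>i. i < k \<Longrightarrow> v i = w i"
  then show "\<alpha> v + \<beta> v = \<alpha> w + \<beta> w"
    using is_form_cong[OF assms(1), of v w] is_form_cong[OF assms(2), of v w] by simp
qed (use assms in \<open>auto intro: is_form_linear linear_compose_add simp: is_form_eq_0\<close>)

lemma is_form_diff: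
  assumes "is_form k \<alpha>" "is_form k \<beta>" shows "is_form k (\<lambda>v. \<alpha> v - \<beta> v)"
  using is_form_add[OF assms(1) is_form_scale[OF assms(2), of "-1"]] by simp

lemma is_form_0: "is_form k (\<lambda>v. 0)"
  unfolding is_form_def using linear_zero by auto

lemma is_form_sum: "(\<And>i. i \<in> I \<Longrightarrow> is_form k (\<alpha> i)) \<Longrightarrow> is_form k (\<lambda>v. \<Sum>i\<in>I. \<alpha> i v)"
  by (induction I rule: infinite_finite_induct) (auto simp: is_form_0 is_form_add)

lemma is_form_wedge:
  assumes a: "is_form k \<alpha>" and b: "is_form l \<beta>"
  shows "is_form (k + l) (wedge k l \<alpha> \<beta>)"
proof -
  have "is_form (k + l) (alt (k + l) (\<lambda>u. \<alpha> u * \<beta> (\<lambda>i. u (k + i))))"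
  proof (rule is_form_alt)
    fix v w :: "nat \<Rightarrow> real^'a" assume "\<And>i. i < k + l \<Longrightarrow> v i = w i"
    then show "\<alpha> v * \<beta> (\<lambda>i. v (k + i)) = \<alpha> w * \<beta> (\<lambda>i. w (k + i))"
      by (intro arg_cong2[where f="(*)"] is_form_cong[OF a] is_form_cong[OF b]) auto
  next
    fix v :: "nat \<Rightarrow> real^'a" and i assume i: "i < k + l"
    show "linear (\<lambda>y. \<alpha> (v(i := y)) * \<beta> (\<lambda>j. (v(i := y)) (k + j)))"
    proof (cases "i < k")
      case True
      then have "(\<lambda>j. (v(i := y)) (k + j)) = (\<lambda>j. v (k + j))" for y by auto
      then show ?thesis using is_form_linear[OF a True] by (simp only: linear_scale_left)
    next
      case False
      then have "(\<lambda>j. (v(i := y)) (k + j)) = (\<lambda>j. v (k + j))(i - k := y)" for y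
        using False by (auto simp: fun_eq_iff)
      moreover have "\<alpha> (v(i := y)) = \<alpha> v" for y
        by (rule is_form_cong[OF a]) (use False in auto)
      moreover have "i - k < l" using False i by auto
      ultimately show ?thesis using is_form_linear[OF b] by (simp only: linear_scale_right)
    qed
  qed
  from is_form_scale[OF this, of "1 / (fact k * fact l)"] show ?thesis
    by (simp add: wedge_eq_alt[abs_def])
qed

lemma wedge_sum_left: "wedge k l (\<lambda>u. \<Sum>i\<in>I. \<alpha> i u) \<beta> v = (\<Sum>i\<in>I. wedge k l (\<alpha> i) \<beta> v)"
  by (simp add: wedge_eq_alt sum_distrib_right alt_sum sum_divide_distrib)

lemma wedge_scale_left: "wedge k l (\<lambda>u. c * \<alpha> u) \<beta> v = c * wedge k l \<alpha> \<beta> v"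
  using alt_scale[of "k + l" c "\<lambda>u. \<alpha> u * \<beta> (\<lambda>i. u (k + i))" v] by (simp add: wedge_eq_alt mult.assoc)

lemma wedge_diff_left: "wedge k l (\<lambda>u. \<alpha> u - \<alpha>' u) \<beta> v = wedge k l \<alpha> \<beta> v - wedge k l \<alpha>' \<beta> v"
  by (simp add: wedge_eq_alt left_diff_distrib alt_diff diff_divide_distrib)

lemma wedge_add_right: "wedge k l \<alpha> (\<lambda>u. \<beta> u + \<beta>' u) v = wedge k l \<alpha> \<beta> v + wedge k l \<alpha> \<beta>' v"
  by (simp add: wedge_eq_alt distrib_left alt_add add_divide_distrib)

text \<open>Multilinear expansion, one slot at a time; the induction is on the number
  \<open>m\<close> of leading slots not yet known to hold basis vectors.\<close>

lemma form_eq_0_if_basis: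
  assumes f: "is_form k \<alpha>" and z: "\<And>f. \<alpha> (\<lambda>i. axis (f i) 1) = 0"
  shows "\<alpha> v = 0"
proof -
  have "m \<le> k \<Longrightarrow> (\<And>i. m \<le> i \<Longrightarrow> i < k \<Longrightarrow> \<exists>j. w i = axis j 1) \<Longrightarrow> \<alpha> w = 0" for m w
  proof (induction m arbitrary: w)
    case 0
    then have "\<exists>j. i < k \<longrightarrow> w i = axis j 1" for i by blast
    then obtain f where "\<And>i. i < k \<Longrightarrow> w i = axis (f i) 1" by metis
    then have "\<alpha> w = \<alpha> (\<lambda>i. axis (f i) 1)" by (intro is_form_cong[OF f]) auto
    then show ?case using z by simp
  next
    case (Suc m)
    note lin = is_form_linear[OF f, of m w]
    have "w m = (\<Sum>j\<in>UNIV. (w m $ j) *\<^sub>R axis j 1)"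
      using basis_expansion[of "w m"] by (simp add: scalar_mult_eq_scaleR)
    then have "\<alpha> w = \<alpha> (w(m := \<Sum>j\<in>UNIV. (w m $ j) *\<^sub>R axis j 1))" by (simp only: fun_upd_triv)
    also have "\<dots> = (\<Sum>j\<in>UNIV. (w m $ j) *\<^sub>R \<alpha> (w(m := axis j 1)))"
      using Suc.prems(1) by (simp add: linear_sum[OF lin] linear_cmul[OF lin])
    also have "\<dots> = 0"
    proof (intro sum.neutral ballI)
      fix j
      have "\<alpha> (w(m := axis j 1)) = 0"
      proof (rule Suc.IH)
        fix i assume "m \<le> i" "i < k"
        then show "\<exists>j'. (w(m := axis j 1)) i = axis j' 1"
          using Suc.prems(2)[of i] by (cases "i = m") auto
      qed (use Suc.prems in simp)
      then show "(w m $ j) *\<^sub>R \<alpha> (w(m := axis j 1)) = 0" by simp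
    qed
    finally show ?case .
  qed
  from this[of k v] show ?thesis by simp
qed

section \<open>Computation with basis vectors\<close>

text \<open>A free datatype in place of the numeral type \<open>8\<close>: it lets
  \<open>code_simp\<close> decide equality and run pattern matching by constructors. The bijection
  \<open>ix\<close> connects the two.\<close>

datatype idx = I0 | I1 | I2 | I3 | I4 | I5 | I6 | I7

definition idxs :: "idx list" where "idxs = [I0, I1, I2, I3, I4, I5, I6, I7]"

fun ix :: "idx \<Rightarrow> 8" where
  "ix I0 = 0" | "ix I1 = 1" | "ix I2 = 2" | "ix I3 = 3" | "ix I4 = 4" | "ix I5 = 5" | "ix I6 = 6" | "ix I7 = 7"

lemma set_idxs [simp]: "set idxs = UNIV"
  unfolding idxs_def using idx.exhaust by auto

lemma distinct_idxs: "distinct idxs" and length_idxs: "length idxs = 8"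
  by (simp_all add: idxs_def)

instance idx :: finite
  by standard (metis List.finite_set set_idxs)

lemma exhaust_8: fixes x :: 8 shows "x = 0 \<or> x = 1 \<or> x = 2 \<or> x = 3 \<or> x = 4 \<or> x = 5 \<or> x = 6 \<or> x = 7"
proof (induct x)
  case (of_int z)
  then have "z = 0 \<or> z = 1 \<or> z = 2 \<or> z = 3 \<or> z = 4 \<or> z = 5 \<or> z = 6 \<or> z = 7" by simp arith
  then show ?case by auto
qed

lemma inj_ix: "inj ix"
  by (rule injI) (rename_tac a b, case_tac a; case_tac b; simp)

lemma bij_ix: "bij ix"
proof -
  have "surj ix"
    unfolding surj_def
  proof
    fix y :: 8
    have "\<exists>x. ix x = y" if "ix x = y" for x using that by blast
    from this[of I0] this[of I1] this[of I2] this[of I3] this[of I4] this[of I5] this[of I6] this[of I7]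
    show "\<exists>x. y = ix x" using exhaust_8[of y] by auto
  qed
  then show ?thesis using inj_ix by (simp add: bij_def)
qed

lemma ix_eq_iff [simp]: "ix a = ix b \<longleftrightarrow> a = b"
  using inj_ix by (simp add: inj_eq)

abbreviation ax :: "idx \<Rightarrow> real^8" where "ax a \<equiv> axis (ix a) 1"

text \<open>Entries beyond the end of the list are unspecified vectors, which a form of the matching
  degree does not see.\<close>

definition bas :: "idx list \<Rightarrow> nat \<Rightarrow> real^8" where
  "bas as i = ax (as ! i)"

text \<open>The intermediate state of a shuffle expansion: the last slots already hold basis
  vectors, the first \<open>k\<close> are still open.\<close>

definition part :: "nat \<Rightarrow> idx list \<Rightarrow> 8 form \<Rightarrow> 8 form" where
  "part k as \<alpha> v = \<alpha> (\<lambda>i. if i < k then v i else bas as (i - k))"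

lemma interior_last_part:
  "interior_last k (ax x) (part (Suc k) as \<alpha>) = part k (x # as) \<alpha>"
proof
  fix v
  show "interior_last k (ax x) (part (Suc k) as \<alpha>) v = part k (x # as) \<alpha> v"
    unfolding interior_last_def part_def
  proof (rule arg_cong[where f=\<alpha>], rule ext)
    fix i
    show "(if i < Suc k then if i < k then v i else ax x else bas as (i - Suc k)) =
       (if i < k then v i else bas (x # as) (i - k))"
    proof (cases "i \<le> k")
      case False
      then have "i - k = Suc (i - Suc k)" by simp
      then show ?thesis using False by (simp add: bas_def)
    qed (auto simp: bas_def)
  qed
qed

lemma is_form_part:
  assumes f: "is_form (k + length as) \<alpha>" shows "is_form k (part k as \<alpha>)"
  unfolding is_form_def
proof (intro conjI allI impI)
  fix v w :: "nat \<Rightarrow> real^8" assume "\<forall>i<k. v i = w i"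
  then show "part k as \<alpha> v = part k as \<alpha> w"
    unfolding part_def by (intro arg_cong[where f=\<alpha>]) auto
next
  fix v :: "nat \<Rightarrow> real^8" and i assume i: "i < k"
  have "(\<lambda>y. part k as \<alpha> (v(i := y))) = (\<lambda>y. \<alpha> ((\<lambda>i. if i < k then v i else bas as (i - k))(i := y)))"
    unfolding part_def using i by (intro ext arg_cong[where f=\<alpha>]) auto
  then show "linear (\<lambda>y. part k as \<alpha> (v(i := y)))"
    using is_form_linear[OF f, of i] i by simp
next
  fix v :: "nat \<Rightarrow> real^8" and i j assume "i < k" "j < k" "i \<noteq> j \<and> v i = v j"
  then show "part k as \<alpha> v = 0"
    unfolding part_def by (intro is_form_eq_0[OF f, of i j]) auto
qed

text \<open>Signs are Booleans during evaluation, with \<open>\<noteq>\<close> as their product;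
  \<open>sg\<close> and later \<open>sgi\<close> turn them into numbers.\<close>

definition sg :: "bool \<Rightarrow> real" where "sg s = (if s then -1 else 1)"

text \<open>
  The shuffles of a reversed list into lists of lengths \<open>k\<close> and \<open>l\<close>; the Boolean tells whether the
  shuffle is odd.
\<close>

fun shuffles_rev :: "bool \<Rightarrow> nat \<Rightarrow> nat \<Rightarrow> 'x list \<Rightarrow> 'x list \<Rightarrow> 'x list \<Rightarrow> (bool \<times> 'x list \<times> 'x list) list" where
  "shuffles_rev s k l [] as bs = [(s, as, bs)]"
| "shuffles_rev s k l (x # xs) as bs =
     (if l = 0 then [] else shuffles_rev s k (l - 1) xs as (x # bs)) @
     (if k = 0 then [] else shuffles_rev (s \<noteq> odd l) (k - 1) l xs (x # as) bs)"

text \<open>The list is reversed because \<open>wedge_Suc\<close> strips the last vector. Each step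
  moves that vector to the front of one accumulator, so the factors must be generalized to forms
  whose last slots are already filled.\<close>

lemma wedge_bas_part:
  assumes "length rxs = k + l" "is_form (k + length as) \<alpha>" "is_form (l + length bs) \<beta>"
  shows "sg s * wedge k l (part k as \<alpha>) (part l bs \<beta>) (bas (rev rxs)) =
     (\<Sum>(s, as, bs)\<leftarrow>shuffles_rev s k l rxs as bs. sg s * \<alpha> (bas as) * \<beta> (bas bs))"
  using assms
proof (induction rxs arbitrary: s k l as bs)
  case Nil
  then show ?case by (simp add: part_def mult.assoc)
next
  case (Cons x xs)
  have fa: "is_form k (part k as \<alpha>)" and fb: "is_form l (part l bs \<beta>)"
    using Cons.prems by (simp_all add: is_form_part)
  have n: "k + l = Suc (length xs)" using Cons.prems by simp
  have x: "bas (rev (x # xs)) (length xs) = ax x" by (simp add: bas_def nth_append)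
  have b: "bas (rev (x # xs)) i = bas (rev xs) i" if "i < length xs" for i
    using that by (simp add: bas_def nth_append)
  have L: "sg s * wedge k (l - 1) (part k as \<alpha>) (interior_last (l - 1) (ax x) (part l bs \<beta>)) (bas (rev (x # xs))) =
       (\<Sum>(s, as, bs)\<leftarrow>shuffles_rev s k (l - 1) xs as (x # bs). sg s * \<alpha> (bas as) * \<beta> (bas bs))" if "l > 0"
  proof -
    have eq: "interior_last (l - 1) (ax x) (part l bs \<beta>) = part (l - 1) (x # bs) \<beta>"
      using interior_last_part[of "l - 1"] that by simp
    have fb': "is_form (l - 1 + length (x # bs)) \<beta>" using Cons.prems that by simp
    have len: "length xs = k + (l - 1)" using n that by simp
    have "wedge k (l - 1) (part k as \<alpha>) (part (l - 1) (x # bs) \<beta>) (bas (rev (x # xs))) =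
        wedge k (l - 1) (part k as \<alpha>) (part (l - 1) (x # bs) \<beta>) (bas (rev xs))"
      using is_form_wedge[OF fa is_form_part[OF fb']] b len by (intro is_form_cong) auto
    then show ?thesis
      unfolding eq using Cons.IH[OF len Cons.prems(2) fb', of s] by simp
  qed
  have K: "sg s * ((-1) ^ l * wedge (k - 1) l (interior_last (k - 1) (ax x) (part k as \<alpha>)) (part l bs \<beta>) (bas (rev (x # xs)))) =
       (\<Sum>(s, as, bs)\<leftarrow>shuffles_rev (s \<noteq> odd l) (k - 1) l xs (x # as) bs. sg s * \<alpha> (bas as) * \<beta> (bas bs))" if "k > 0"
  proof -
    have eq: "interior_last (k - 1) (ax x) (part k as \<alpha>) = part (k - 1) (x # as) \<alpha>"
      using interior_last_part[of "k - 1"] that by simp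
    have fa': "is_form (k - 1 + length (x # as)) \<alpha>" using Cons.prems that by simp
    have len: "length xs = (k - 1) + l" using n that by simp
    have w: "wedge (k - 1) l (part (k - 1) (x # as) \<alpha>) (part l bs \<beta>) (bas (rev (x # xs))) =
        wedge (k - 1) l (part (k - 1) (x # as) \<alpha>) (part l bs \<beta>) (bas (rev xs))"
      using is_form_wedge[OF is_form_part[OF fa'] fb] b len by (intro is_form_cong) auto
    have "sg s * (-1) ^ l = sg (s \<noteq> odd l)" by (auto simp: sg_def)
    then show ?thesis
      unfolding eq w using Cons.IH[OF len fa' Cons.prems(3), of "s \<noteq> odd l"] by (simp flip: mult.assoc)
  qed
  show ?case
    unfolding wedge_Suc[OF n fa fb] x distrib_left shuffles_rev.simps map_append sum_list_append
  proof (rule arg_cong2[where f="(+)"], goal_cases)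
    case 1
    show ?case
    proof (cases "l > 0")
      case True
      from L[OF this] True show ?thesis by (simp del: rev.simps)
    qed simp
  next
    case 2
    show ?case
    proof (cases "k > 0")
      case True
      from K[OF this] True show ?thesis by (simp del: rev.simps)
    qed simp
  qed
qed

lemma sg_wedge_bas:
  assumes f: "is_form k \<alpha>" "is_form l \<beta>" and len: "length xs = k + l"
  shows "sg s * wedge k l \<alpha> \<beta> (bas xs) =
     (\<Sum>(s, as, bs)\<leftarrow>shuffles_rev s k l (rev xs) [] []. sg s * \<alpha> (bas as) * \<beta> (bas bs))"
proof -
  have "part k [] \<alpha> = \<alpha>" unfolding part_def by (rule ext) (rule is_form_cong[OF f(1)], simp)
  moreover have "part l [] \<beta> = \<beta>" unfolding part_def by (rule ext) (rule is_form_cong[OF f(2)], simp)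
  ultimately show ?thesis
    using wedge_bas_part[of "rev xs" k l "[]" \<alpha> "[]" \<beta> s] f len by simp
qed

lemma wedge_bas:
  assumes "is_form k \<alpha>" "is_form l \<beta>" "length xs = k + l"
  shows "wedge k l \<alpha> \<beta> (bas xs) =
     (\<Sum>(s, as, bs)\<leftarrow>shuffles_rev False k l (rev xs) [] []. sg s * \<alpha> (bas as) * \<beta> (bas bs))"
  unfolding sg_wedge_bas[OF assms, symmetric] by (simp add: sg_def)

section \<open>Products of covectors and top-degree forms on basis vectors\<close>

lemma coform_eq_alt: "coform is v = alt (length is) (\<lambda>u. \<Prod>j<length is. u j $ (is ! j)) v"
  by (simp add: coform_def alt_def)

lemma is_form_coform: "is_form (length is) (coform is)"
proof -
  have "is_form (length is) (alt (length is) (\<lambda>u. \<Prod>j<length is. u j $ (is ! j)))"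
  proof (rule is_form_alt)
    fix v :: "nat \<Rightarrow> real^'a" and i assume i: "i < length is"
    have "(\<Prod>j<length is. (v(i := y)) j $ (is ! j)) = y $ (is ! i) * (\<Prod>j\<in>{..<length is} - {i}. v j $ (is ! j))" for y
      using i by (simp add: prod.remove[of _ i])
    moreover have "linear (\<lambda>y::real^'a. y $ (is ! i))"
      by (simp add: linearI)
    ultimately show "linear (\<lambda>y. \<Prod>j<length is. (v(i := y)) j $ (is ! j))"
      by (simp only: linear_scale_left)
  qed (auto intro: prod.cong)
  then show ?thesis by (simp add: coform_eq_alt[abs_def])
qed

text \<open>Laplace expansion along the last covector: if it takes the vector in slot
  \<open>b\<close>, the last vector moves into the vacated slot, at the cost of one sign.\<close>

lemma coform_snoc:
  "coform (is @ [m]) v =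
     v (length is) $ m * coform is v - (\<Sum>b<length is. v b $ m * coform is (v(b := v (length is))))"
proof -
  let ?n = "length is"
  let ?f = "\<lambda>\<sigma>. real_of_int (sign \<sigma>) * (\<Prod>j<Suc ?n. v (\<sigma> j) $ ((is @ [m]) ! j))"
  have ins: "{..<Suc ?n} = insert ?n {..<?n}" by auto
  have "coform (is @ [m]) v = (\<Sum>b\<in>insert ?n {..<?n}. \<Sum>q | q permutes {..<?n}. ?f (tr ?n b \<circ> q))"
    unfolding coform_def using sum_over_permutations_insert[of "{..<?n}" ?n ?f]
    by (simp add: lessThan_Suc)
  also have "\<dots> = (\<Sum>b\<in>insert ?n {..<?n}. (if b = ?n then 1 else -1) * (v b $ m * coform is (v(b := v ?n))))"
  proof (rule sum.cong[OF refl])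
    fix b assume b: "b \<in> insert ?n {..<?n}"
    have "?f (tr ?n b \<circ> q) =
        (if b = ?n then 1 else -1) * (v b $ m * (real_of_int (sign q) * (\<Prod>j<?n. (v(b := v ?n)) (q j) $ (is ! j))))"
      if q: "q permutes {..<?n}" for q
    proof -
      have qn: "q ?n = ?n" using permutes_not_in[OF q] by simp
      have s: "sign (tr ?n b \<circ> q) = (if b = ?n then 1 else -1) * sign q"
        using q by (subst sign_compose) (auto simp: permutation_if_permutes sign_swap_id permutation_swap_id)
      have "(\<Prod>j<?n. v (tr ?n b (q j)) $ ((is @ [m]) ! j)) =
          (\<Prod>j<?n. (v(b := v ?n)) (q j) $ (is ! j))"
      proof (rule prod.cong[OF refl])
        fix j assume j: "j \<in> {..<?n}"
        then have "q j < ?n" using permutes_in_image[OF q, of j] by simp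
        then show "v (tr ?n b (q j)) $ ((is @ [m]) ! j) = (v(b := v ?n)) (q j) $ (is ! j)"
          using j by (auto simp: Transposition.transpose_def nth_append)
      qed
      then show ?thesis by (simp add: s qn nth_append)
    qed
    then show "(\<Sum>q | q permutes {..<?n}. ?f (tr ?n b \<circ> q)) =
        (if b = ?n then 1 else -1) * (v b $ m * coform is (v(b := v ?n)))"
      unfolding coform_def sum_distrib_left by (intro sum.cong refl) auto
  qed
  also have "\<dots> = v ?n $ m * coform is v - (\<Sum>b<?n. v b $ m * coform is (v(b := v ?n)))"
    by (simp add: sum_negf)
  finally show ?thesis .
qed

lemma coform_Nil: "coform [] v = 1"
  by (simp add: coform_eq_alt)

text \<open>An executable form of \<open>coform_snoc\<close>. The covectors are listed in reverse,
  since the last one is peeled off; the vector list keeps its length, and only as many entries count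
  as covectors remain.\<close>

fun coform_val :: "idx list \<Rightarrow> idx list \<Rightarrow> int" where
  "coform_val [] as = 1"
| "coform_val (m # ms) as =
     (let n = length ms; x = as ! n in
       (if x = m then coform_val ms as else 0)
       - (\<Sum>b\<leftarrow>[0..<n]. if as ! b = m then coform_val ms (as[b := x]) else 0))"

lemma coform_bas:
  "length ms \<le> length as \<Longrightarrow> coform (map ix (rev ms)) (bas as) = of_int (coform_val ms as)"
proof (induction ms arbitrary: as)
  case (Cons m ms)
  let ?n = "length ms"
  have comp: "bas as b $ ix m = (if as ! b = m then 1 else 0)" for b
    by (auto simp: bas_def axis_def)
  have upd: "(bas as)(b := bas as ?n) = bas (as[b := as ! ?n])" if "b < ?n" for b
    using that Cons.prems by (auto simp: bas_def fun_eq_iff nth_list_update)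
  have IH: "coform (map ix (rev ms)) (bas (as[b := y])) = of_int (coform_val ms (as[b := y]))"
     "coform (map ix (rev ms)) (bas as) = of_int (coform_val ms as)" for b y
    using Cons by auto
  have "(\<Sum>b<?n. bas as b $ ix m * coform (map ix (rev ms)) ((bas as)(b := bas as ?n))) =
     (\<Sum>b<?n. real_of_int (if as ! b = m then coform_val ms (as[b := as ! ?n]) else 0))"
    by (rule sum.cong) (simp_all add: comp upd IH)
  also have "\<dots> = real_of_int (\<Sum>b\<leftarrow>[0..<?n]. if as ! b = m then coform_val ms (as[b := as ! ?n]) else 0)"
    by (simp add: interv_sum_list_conv_sum_set_nat atLeast0LessThan)
  finally have "coform (map ix (rev (m # ms))) (bas as) =
     (if as ! ?n = m then of_int (coform_val ms as) else 0)
       - real_of_int (\<Sum>b\<leftarrow>[0..<?n]. if as ! b = m then coform_val ms (as[b := as ! ?n]) else 0)"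
    using coform_snoc[of "map ix (rev ms)" "ix m" "bas as"] by (simp add: comp IH)
  then show ?case by (simp add: Let_def)
qed (simp add: coform_Nil)

text \<open>Eight basis vectors either repeat, or are a permutation of the standard ones, where the
  value changes by a sign only.\<close>

lemma top_form_eq_0:
  assumes f: "is_form 8 \<omega>" and z: "\<omega> (bas idxs) = 0"
  shows "\<omega> v = 0"
proof (rule form_eq_0_if_basis[OF f])
  fix g :: "nat \<Rightarrow> 8"
  show "\<omega> (\<lambda>i. axis (g i) 1) = 0"
  proof (cases "inj_on g {..<8}")
    case False
    then obtain i j where "i < 8" "j < 8" "i \<noteq> j" "g i = g j" by (auto simp: inj_on_def)
    then show ?thesis by (intro is_form_eq_0[OF f, of i j]) auto
  next
    case True
    define h where "h i = ix (idxs ! i)" for i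
    have bij: "bij_betw h {..<8} UNIV"
    proof -
      have "bij_betw ((!) idxs) {..<8} UNIV"
        by (rule bij_betw_nth) (simp_all add: length_idxs distinct_idxs)
      from bij_betw_trans[OF this bij_ix] show ?thesis by (simp add: h_def[abs_def] o_def)
    qed
    \<comment> \<open>The identity from 8 on, because \<open>permutes\<close> asks for the identity
      outside the set.\<close>
    define \<sigma> where "\<sigma> i = (if i < 8 then inv_into {..<8} h (g i) else i)" for i
    have "g ` {..<8} = UNIV"
      by (rule card_subset_eq) (simp_all add: card_image[OF True])
    then have "bij_betw g {..<8} UNIV"
      using True by (simp add: bij_betw_def)
    from bij_betw_trans[OF this bij_betw_inv_into[OF bij]]
    have "bij_betw \<sigma> {..<8} {..<8}"
      by (rule bij_betw_cong[THEN iffD1, rotated]) (auto simp: \<sigma>_def)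
    then have perm: "\<sigma> permutes {..<8}"
      by (rule bij_imp_permutes) (auto simp: \<sigma>_def)
    have "\<omega> (bas idxs \<circ> p) = 0" if "p permutes {..<8}" for p
      using finite_lessThan that
    proof (induction rule: permutes_rev_induct)
      case (swap a b p)
      then show ?case using is_form_swap[OF f, of a b "bas idxs \<circ> p"] by (simp add: o_def)
    qed (use z in simp)
    from this[OF perm] have "\<omega> (bas idxs \<circ> \<sigma>) = 0" .
    moreover have "\<omega> (\<lambda>i. axis (g i) 1) = \<omega> (bas idxs \<circ> \<sigma>)"
    proof (rule is_form_cong[OF f])
      fix i :: nat assume i: "i < 8"
      have "h (\<sigma> i) = g i" using i bij_betw_inv_into_right[OF bij] by (simp add: \<sigma>_def)
      then show "axis (g i) 1 = (bas idxs \<circ> \<sigma>) i" by (simp add: bas_def h_def)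
    qed
    ultimately show ?thesis by simp
  qed
qed

section \<open>The Froelicher-Nijenhuis bracket of a three-form with itself\<close>

text \<open>
  The bracket \<open>[P, P]/2\<close>, with the jet \<open>D\<close> of \<open>P\<close> at a point abstracted: \<open>D\<close> may be the derivative in
  coordinates or the covariant derivative.
\<close>

definition brk ::
  "('v \<Rightarrow> 'v \<Rightarrow> 'v \<Rightarrow> 'v::real_vector) \<Rightarrow> ('v \<Rightarrow> 'v \<Rightarrow> 'v \<Rightarrow> 'v \<Rightarrow> 'v) \<Rightarrow> (nat \<Rightarrow> 'v) \<Rightarrow> 'v" where
  "brk p D v = alt 6 (\<lambda>u. (1/36) *\<^sub>R D (p (u 0) (u 1) (u 2)) (u 3) (u 4) (u 5)
                         - (1/12) *\<^sub>R p (D (u 0) (u 1) (u 2) (u 3)) (u 4) (u 5)) v"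

lemma brk_diff:
  assumes "\<And>y z. linear (\<lambda>x. p x y z)"
  shows "brk p (\<lambda>a x y z. D a x y z - E a x y z) v = brk p D v - brk p E v"
proof -
  have lind: "p (a - b) y z = p a y z - p b y z" for a b y z
    using linear_diff[OF assms] .
  show ?thesis
    unfolding brk_def alt_diff[symmetric] lind scaleR_diff_right by (simp add: algebra_simps)
qed

text \<open>Naturality: once a frame intertwines the cross product and its derivative with those of
  the model, it intertwines the brackets.\<close>

lemma brk_image:
  assumes "linear L"
    and p: "\<And>x y z. p (L x) (L y) (L z) = L (p0 x y z)"
    and D: "\<And>a x y z. D (L a) (L x) (L y) (L z) = L (D0 a x y z)"
  shows "brk p D (\<lambda>i. L (v i)) = L (brk p0 D0 v)"
  unfolding brk_def alt_linear_image[OF assms(1), symmetric]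
  by (simp add: alt_def p D linear_diff[OF assms(1)] linear_cmul[OF assms(1)])

text \<open>Hence in \<open>brk\<close> a symmetric connection may replace the coordinate derivatives.\<close>

lemma brk_connection_eq_0:
  fixes p :: "'v \<Rightarrow> 'v \<Rightarrow> 'v \<Rightarrow> 'v::real_vector"
  assumes lin: "\<And>y z. linear (\<lambda>x. p x y z)"
    and sw1: "\<And>x y z. p y x z = - p x y z" and sw2: "\<And>x y z. p x z y = - p x y z"
    and sym: "\<And>a b. \<Gamma> a b = \<Gamma> b a"
  shows "brk p (\<lambda>a x y z. \<Gamma> a (p x y z) - p (\<Gamma> a x) y z - p x (\<Gamma> a y) z - p x y (\<Gamma> a z)) v = 0"
proof -
  note [simp] = Transposition.transpose_def
  have lind: "p (a - b) y z = p a y z - p b y z" for a b y z using linear_diff[OF lin] .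
  let ?E1 = "\<lambda>u. p (\<Gamma> (p (u 0) (u 1) (u 2)) (u 3)) (u 4) (u 5)"
  let ?E2 = "\<lambda>u. p (u 3) (\<Gamma> (p (u 0) (u 1) (u 2)) (u 4)) (u 5)"
  let ?E3 = "\<lambda>u. p (u 3) (u 4) (\<Gamma> (p (u 0) (u 1) (u 2)) (u 5))"
  \<comment> \<open>Exchanging the two blocks of three vectors is an odd permutation, yet it
    preserves the term by symmetry of \<Gamma>.\<close>
  have 1: "alt 6 (\<lambda>u. \<Gamma> (p (u 0) (u 1) (u 2)) (p (u 3) (u 4) (u 5))) v = 0"
  proof -
    let ?F = "\<lambda>u. \<Gamma> (p (u 0) (u 1) (u 2)) (p (u 3) (u 4) (u 5))"
    let ?G = "\<lambda>u. \<Gamma> (p (u 3) (u 1) (u 2)) (p (u 0) (u 4) (u 5))"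
    let ?H = "\<lambda>u. \<Gamma> (p (u 3) (u 4) (u 2)) (p (u 0) (u 1) (u 5))"
    have "alt 6 ?F v = - alt 6 ?H v"
      by (rule alt_eq_minus_if_swap[of 2 _ 5]) (simp_all add: sym)
    also have "alt 6 ?H v = - alt 6 ?G v"
      by (rule alt_eq_minus_if_swap[of 1 _ 4]) simp_all
    also have "alt 6 ?G v = - alt 6 ?F v"
      by (rule alt_eq_minus_if_swap[of 0 _ 3]) simp_all
    finally have "alt 6 ?F v = - alt 6 ?F v" unfolding minus_minus .
    then show ?thesis unfolding real_vector_eq_minus_self .
  qed
  \<comment> \<open>The antisymmetry of \<open>p\<close> offsets the sign of the transposition, so
    all positions of \<Gamma> give the same contribution.\<close>
  have 2: "alt 6 ?E2 v = alt 6 ?E1 v"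
  proof -
    have "alt 6 (\<lambda>u. - ?E2 u) v = - alt 6 ?E1 v"
      by (rule alt_eq_minus_if_swap[of 3 _ 4]) (simp_all, metis sw1 minus_minus)
    then show ?thesis by (simp add: alt_minus)
  qed
  have 3: "alt 6 ?E3 v = alt 6 ?E2 v"
  proof -
    have "alt 6 (\<lambda>u. - ?E3 u) v = - alt 6 ?E2 v"
      by (rule alt_eq_minus_if_swap[of 4 _ 5]) (simp_all, metis sw2 minus_minus)
    then show ?thesis by (simp add: alt_minus)
  qed
  have cyc: "p z x y = p x y z" for x y z
    using sw1[of z x y] sw2[of x z y] by simp
  have 4: "alt 6 (\<lambda>u. p (\<Gamma> (u 0) (p (u 1) (u 2) (u 3))) (u 4) (u 5)) v = - alt 6 ?E1 v"
    by (rule alt_eq_minus_if_swap[of 0 _ 3]) (simp_all, metis cyc sym)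
  \<comment> \<open>Here the symmetry of \<Gamma>, that is the vanishing of the torsion of the
    connection, meets the alternation over the same two vectors.\<close>
  have 5: "alt 6 (\<lambda>u. p (p (\<Gamma> (u 0) (u 1)) (u 2) (u 3)) (u 4) (u 5)) v = 0"
    by (rule alt_eq_0_if_symmetric[of 0 _ 1]) (simp_all add: sym)
  have 6: "alt 6 (\<lambda>u. p (p (u 1) (\<Gamma> (u 0) (u 2)) (u 3)) (u 4) (u 5)) v = 0"
    by (rule alt_eq_0_if_symmetric[of 0 _ 2]) (simp_all add: sym)
  have 7: "alt 6 (\<lambda>u. p (p (u 1) (u 2) (\<Gamma> (u 0) (u 3))) (u 4) (u 5)) v = 0"
    by (rule alt_eq_0_if_symmetric[of 0 _ 3]) (simp_all add: sym)
  \<comment> \<open>Three equal terms of weight 1/36 are left, against one of weight 1/12.\<close>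
  have "brk p (\<lambda>a x y z. \<Gamma> a (p x y z) - p (\<Gamma> a x) y z - p x (\<Gamma> a y) z - p x y (\<Gamma> a z)) v =
     (1/36) *\<^sub>R (0 - alt 6 ?E1 v - alt 6 ?E2 v - alt 6 ?E3 v) - (1/12) *\<^sub>R (- alt 6 ?E1 v - 0 - 0 - 0)"
    unfolding brk_def lind alt_diff alt_scale 1 4 5 6 7 ..
  also have "\<dots> = 0"
  proof -
    have "(-3::real) *\<^sub>R e = (-1 + -1 + -1 :: real) *\<^sub>R e" for e :: 'v by simp
    then have "0 - e - e - e = (-3::real) *\<^sub>R e" for e :: 'v
      unfolding scaleR_left_distrib by simp
    then show ?thesis unfolding 2 3 by simp
  qed
  finally show ?thesis .
qed

section \<open>From the coordinate formula of the bracket to its alternating form\<close>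

definition skip :: "nat \<Rightarrow> (nat \<Rightarrow> 'v) \<Rightarrow> nat \<Rightarrow> 'v" where
  "skip i v = (\<lambda>j. if j < i then v j else v (Suc j))"

text \<open>Bringing vector \<open>i\<close> to the front takes \<open>i\<close> transpositions, so
  under the alternation the four terms of an exterior derivative coincide.\<close>

lemma alt_skip:
  assumes "i \<le> 3"
  shows "alt 6 (\<lambda>u. (-1) ^ i * H (u i) (skip i u 0) (skip i u 1) (skip i u 2) (u 4) (u 5)) v =
         (alt 6 (\<lambda>u. H (u 0) (u 1) (u 2) (u 3) (u 4) (u 5)) v :: real)"
proof -
  note [simp] = Transposition.transpose_def
  let ?H0 = "\<lambda>u. H (u 0) (u 1) (u 2) (u 3) (u 4) (u 5)"
  let ?H1 = "\<lambda>u. H (u 1) (u 0) (u 2) (u 3) (u 4) (u 5)"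
  let ?H2 = "\<lambda>u. H (u 2) (u 0) (u 1) (u 3) (u 4) (u 5)"
  let ?H3 = "\<lambda>u. H (u 3) (u 0) (u 1) (u 2) (u 4) (u 5)"
  have 1: "alt 6 ?H1 v = - alt 6 ?H0 v" by (rule alt_eq_minus_if_swap[of 0 _ 1]) simp_all
  have 2: "alt 6 ?H2 v = - alt 6 ?H1 v" by (rule alt_eq_minus_if_swap[of 1 _ 2]) simp_all
  have 3: "alt 6 ?H3 v = - alt 6 ?H2 v" by (rule alt_eq_minus_if_swap[of 2 _ 3]) simp_all
  consider "i = 0" | "i = 1" | "i = 2" | "i = 3" using assms by linarith
  then show ?thesis
    by cases (simp_all add: skip_def numeral_2_eq_2[symmetric] numeral_3_eq_3[symmetric] alt_minus 1[simplified] 2[simplified] 3[simplified])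
qed

lemma vec_eq_sum_axis: "x = (\<Sum>\<mu>\<in>UNIV. (x $ \<mu>) *\<^sub>R axis \<mu> (1::real))"
  using basis_expansion[of x] by (simp add: scalar_mult_eq_scaleR)

lemma linear_axis_expansion:
  assumes "linear f" shows "f x = (\<Sum>\<mu>\<in>UNIV. (x $ \<mu>) *\<^sub>R f (axis \<mu> (1::real)))"
  by (subst vec_eq_sum_axis) (simp add: linear_sum[OF assms] linear_cmul[OF assms])

text \<open>This explains the constants in \<open>brk\<close>: 36 is 3! 3!, and 48 = 4! 2! becomes
  12 since the four terms of the exterior derivative agree. Contracting over \<mu> inserts one
  vector-valued factor into the other.\<close>

lemma brk_component:
  fixes p :: "real^'n::finite \<Rightarrow> real^'n \<Rightarrow> real^'n \<Rightarrow> real^'n"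
  assumes linp: "\<And>y z. linear (\<lambda>x. p x y z)" and linD: "\<And>x y z. linear (\<lambda>a. D a x y z)"
  shows "brk p D v $ \<nu> =
    (\<Sum>\<mu>\<in>UNIV. wedge 3 3 (\<lambda>u. p (u 0) (u 1) (u 2) $ \<mu>) (\<lambda>u. D (axis \<mu> 1) (u 0) (u 1) (u 2) $ \<nu>) v)
    - (\<Sum>\<mu>\<in>UNIV. wedge 4 2
        (\<lambda>u. \<Sum>i\<le>3. (-1) ^ i * D (u i) (skip i u 0) (skip i u 1) (skip i u 2) $ \<mu>)
        (\<lambda>u. p (axis \<mu> 1) (u 0) (u 1) $ \<nu>) v)"
proof -
  have cD: "D a x y z $ \<nu> = (\<Sum>\<mu>\<in>UNIV. a $ \<mu> * D (axis \<mu> 1) x y z $ \<nu>)" for a x y z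
    by (subst linear_axis_expansion[OF linD]) simp
  have cp: "p a y z $ \<nu> = (\<Sum>\<mu>\<in>UNIV. a $ \<mu> * p (axis \<mu> 1) y z $ \<nu>)" for a y z
    by (subst linear_axis_expansion[OF linp]) simp
  have "(\<Sum>\<mu>\<in>UNIV. wedge 3 3 (\<lambda>u. p (u 0) (u 1) (u 2) $ \<mu>) (\<lambda>u. D (axis \<mu> 1) (u 0) (u 1) (u 2) $ \<nu>) v) =
      alt 6 (\<lambda>u. \<Sum>\<mu>\<in>UNIV. p (u 0) (u 1) (u 2) $ \<mu> * D (axis \<mu> 1) (u 3) (u 4) (u 5) $ \<nu>) v / 36"
    unfolding alt_sum by (simp add: wedge_eq_alt fact_numeral sum_divide_distrib)
  also have "\<dots> = alt 6 (\<lambda>u. D (p (u 0) (u 1) (u 2)) (u 3) (u 4) (u 5) $ \<nu>) v / 36"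
    by (simp only: cD[of "p _ _ _"])
  finally have 1: "(\<Sum>\<mu>\<in>UNIV. wedge 3 3 (\<lambda>u. p (u 0) (u 1) (u 2) $ \<mu>) (\<lambda>u. D (axis \<mu> 1) (u 0) (u 1) (u 2) $ \<nu>) v) =
      alt 6 (\<lambda>u. D (p (u 0) (u 1) (u 2)) (u 3) (u 4) (u 5) $ \<nu>) v / 36" .
  let ?G = "\<lambda>u. p (D (u 0) (u 1) (u 2) (u 3)) (u 4) (u 5) $ \<nu>"
  have "(\<Sum>\<mu>\<in>UNIV. wedge 4 2
        (\<lambda>u. \<Sum>i\<le>3. (-1) ^ i * D (u i) (skip i u 0) (skip i u 1) (skip i u 2) $ \<mu>)
        (\<lambda>u. p (axis \<mu> 1) (u 0) (u 1) $ \<nu>) v) =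
     alt 6 (\<lambda>u. \<Sum>\<mu>\<in>UNIV. (\<Sum>i\<le>3. (-1) ^ i * D (u i) (skip i u 0) (skip i u 1) (skip i u 2) $ \<mu>) *
         p (axis \<mu> 1) (u 4) (u 5) $ \<nu>) v / 48"
    unfolding alt_sum by (simp add: wedge_eq_alt fact_numeral sum_divide_distrib)
  also have "\<dots> = alt 6 (\<lambda>u. \<Sum>i\<le>3. (-1) ^ i * (p (D (u i) (skip i u 0) (skip i u 1) (skip i u 2)) (u 4) (u 5) $ \<nu>)) v / 48"
    unfolding cp[of "D _ _ _ _"] sum_distrib_right sum_distrib_left by (subst sum.swap) (simp add: mult.assoc)
  also have "\<dots> = (\<Sum>i\<le>(3::nat). alt 6 ?G v) / 48"
    unfolding alt_sum by (intro arg_cong2[where f="(/)"] sum.cong refl alt_skip[where H = "\<lambda>a x y z b c. p (D a x y z) b c $ \<nu>"]) simp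
  also have "\<dots> = alt 6 ?G v / 12" by simp
  finally have 2: "(\<Sum>\<mu>\<in>UNIV. wedge 4 2
        (\<lambda>u. \<Sum>i\<le>3. (-1) ^ i * D (u i) (skip i u 0) (skip i u 1) (skip i u 2) $ \<mu>)
        (\<lambda>u. p (axis \<mu> 1) (u 0) (u 1) $ \<nu>) v) = alt 6 ?G v / 12" .
  have cmp: "alt 6 F v $ \<nu> = alt 6 (\<lambda>u. F u $ \<nu>) v" for F :: "(nat \<Rightarrow> real^'n) \<Rightarrow> real^'n"
    by (simp add: alt_def)
  have "brk p D v $ \<nu> = alt 6 (\<lambda>u. ((1/36) *\<^sub>R D (p (u 0) (u 1) (u 2)) (u 3) (u 4) (u 5)
                         - (1/12) *\<^sub>R p (D (u 0) (u 1) (u 2) (u 3)) (u 4) (u 5)) $ \<nu>) v"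
    unfolding brk_def cmp ..
  also have "\<dots> = alt 6 (\<lambda>u. D (p (u 0) (u 1) (u 2)) (u 3) (u 4) (u 5) $ \<nu>) v / 36 - alt 6 ?G v / 12"
    by (simp add: alt_diff alt_divide)
  finally show ?thesis unfolding 1 2 .
qed

text \<open>Exchanging two blocks of three is a product of three transpositions, hence odd; in
  \<open>wedge_commute_2_4\<close> the corresponding permutation needs four and is even.\<close>

lemma wedge_commute_3_3:
  assumes a: "\<And>v w. (\<And>i. i < 3 \<Longrightarrow> v i = w i) \<Longrightarrow> \<alpha> v = \<alpha> w"
    and b: "\<And>v w. (\<And>i. i < 3 \<Longrightarrow> v i = w i) \<Longrightarrow> \<beta> v = \<beta> w"
  shows "wedge 3 3 \<beta> \<alpha> v = - wedge 3 3 \<alpha> \<beta> v"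
proof -
  let ?F = "\<lambda>u. \<alpha> u * \<beta> (\<lambda>i. u (3 + i))"
  let ?t = "tr"
  have "\<beta> u * \<alpha> (\<lambda>i. u (3 + i)) = ?F (u \<circ> ?t 0 3 \<circ> ?t 1 4 \<circ> ?t 2 5)" for u
  proof -
    have "\<alpha> (\<lambda>i. u (3 + i)) = \<alpha> (u \<circ> ?t 0 3 \<circ> ?t 1 4 \<circ> ?t 2 5)"
      by (rule a) (auto simp: Transposition.transpose_def less_Suc_eq numeral_3_eq_3 numeral_eq_Suc)
    moreover have "\<beta> u = \<beta> (\<lambda>i. (u \<circ> ?t 0 3 \<circ> ?t 1 4 \<circ> ?t 2 5) (3 + i))"
      by (rule b) (auto simp: Transposition.transpose_def less_Suc_eq numeral_eq_Suc)
    ultimately show ?thesis by simp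
  qed
  then have "alt 6 (\<lambda>u. \<beta> u * \<alpha> (\<lambda>i. u (3 + i))) v = alt 6 (\<lambda>u. ?F (u \<circ> ?t 0 3 \<circ> ?t 1 4 \<circ> ?t 2 5)) v" by simp
  also have "\<dots> = - alt 6 (\<lambda>u. ?F (u \<circ> ?t 1 4 \<circ> ?t 2 5)) v" by (rule alt_swap[of 0 6 3 "\<lambda>u. ?F (u \<circ> ?t 1 4 \<circ> ?t 2 5)"]) simp_all
  also have "alt 6 (\<lambda>u. ?F (u \<circ> ?t 1 4 \<circ> ?t 2 5)) v = - alt 6 (\<lambda>u. ?F (u \<circ> ?t 2 5)) v" by (rule alt_swap[of 1 6 4 "\<lambda>u. ?F (u \<circ> ?t 2 5)"]) simp_all
  also have "alt 6 (\<lambda>u. ?F (u \<circ> ?t 2 5)) v = - alt 6 ?F v" by (rule alt_swap[of 2 6 5 ?F]) simp_all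
  finally show ?thesis by (simp add: wedge_eq_alt)
qed

lemma wedge_commute_2_4:
  assumes a: "\<And>v w. (\<And>i. i < 4 \<Longrightarrow> v i = w i) \<Longrightarrow> \<alpha> v = \<alpha> w"
    and b: "\<And>v w. (\<And>i. i < 2 \<Longrightarrow> v i = w i) \<Longrightarrow> \<beta> v = \<beta> w"
  shows "wedge 2 4 \<beta> \<alpha> v = wedge 4 2 \<alpha> \<beta> v"
proof -
  let ?F = "\<lambda>u. \<alpha> u * \<beta> (\<lambda>i. u (4 + i))"
  let ?t = "tr"
  have "\<beta> u * \<alpha> (\<lambda>i. u (2 + i)) = ?F (u \<circ> ?t 0 2 \<circ> ?t 2 4 \<circ> ?t 1 3 \<circ> ?t 3 5)" for u
  proof -
    have "\<alpha> (\<lambda>i. u (2 + i)) = \<alpha> (u \<circ> ?t 0 2 \<circ> ?t 2 4 \<circ> ?t 1 3 \<circ> ?t 3 5)"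
      by (rule a) (auto simp: Transposition.transpose_def less_Suc_eq numeral_eq_Suc)
    moreover have "\<beta> u = \<beta> (\<lambda>i. (u \<circ> ?t 0 2 \<circ> ?t 2 4 \<circ> ?t 1 3 \<circ> ?t 3 5) (4 + i))"
      by (rule b) (auto simp: Transposition.transpose_def less_Suc_eq numeral_eq_Suc)
    ultimately show ?thesis by simp
  qed
  then have "alt 6 (\<lambda>u. \<beta> u * \<alpha> (\<lambda>i. u (2 + i))) v = alt 6 (\<lambda>u. ?F (u \<circ> ?t 0 2 \<circ> ?t 2 4 \<circ> ?t 1 3 \<circ> ?t 3 5)) v" by simp
  also have "\<dots> = - alt 6 (\<lambda>u. ?F (u \<circ> ?t 2 4 \<circ> ?t 1 3 \<circ> ?t 3 5)) v" by (rule alt_swap[of 0 6 2 "\<lambda>u. ?F (u \<circ> ?t 2 4 \<circ> ?t 1 3 \<circ> ?t 3 5)"]) simp_all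
  also have "alt 6 (\<lambda>u. ?F (u \<circ> ?t 2 4 \<circ> ?t 1 3 \<circ> ?t 3 5)) v = - alt 6 (\<lambda>u. ?F (u \<circ> ?t 1 3 \<circ> ?t 3 5)) v" by (rule alt_swap[of 2 6 4 "\<lambda>u. ?F (u \<circ> ?t 1 3 \<circ> ?t 3 5)"]) simp_all
  also have "alt 6 (\<lambda>u. ?F (u \<circ> ?t 1 3 \<circ> ?t 3 5)) v = - alt 6 (\<lambda>u. ?F (u \<circ> ?t 3 5)) v" by (rule alt_swap[of 1 6 3 "\<lambda>u. ?F (u \<circ> ?t 3 5)"]) simp_all
  also have "alt 6 (\<lambda>u. ?F (u \<circ> ?t 3 5)) v = - alt 6 ?F v" by (rule alt_swap[of 3 6 5 ?F]) simp_all
  finally show ?thesis by (simp add: wedge_eq_alt)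
qed

definition seq3 :: "'v \<Rightarrow> 'v \<Rightarrow> 'v \<Rightarrow> nat \<Rightarrow> 'v" where
  "seq3 x y z i = (if i = 0 then x else if i = 1 then y else z)"

lemma seq3_self: "i < 3 \<Longrightarrow> seq3 (v 0) (v 1) (v 2) i = v i"
  by (auto simp: seq3_def less_Suc_eq numeral_eq_Suc)

lemma frechet_derivative_component:
  assumes "f differentiable (at x)"
  shows "frechet_derivative (\<lambda>y. f y $ \<mu>) (at x) a = frechet_derivative f (at x) a $ \<mu>"
proof -
  have "(f has_derivative frechet_derivative f (at x)) (at x)"
    using assms by (simp add: frechet_derivative_works)
  then have "((\<lambda>y. f y $ \<mu>) has_derivative (\<lambda>a. frechet_derivative f (at x) a $ \<mu>)) (at x)"
    by (rule bounded_linear.has_derivative[OF bounded_linear_vec_nth])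
  from frechet_derivative_at[OF this] show ?thesis by metis
qed

text \<open>The coordinate fields are constant, so their brackets vanish and their Lie derivatives
  are plain derivatives of the coefficients. The factor 2 arises because both arguments of the
  bracket are the same form of odd degree.\<close>

lemma fn_bracket_eq_brk:
  fixes K :: "real^'n::finite \<Rightarrow> 'n vform"
  assumes S: "open S" "x \<in> S"
    and form: "\<And>y \<mu>. y \<in> S \<Longrightarrow> is_form 3 (\<lambda>w. K y w $ \<mu>)"
    and diff: "\<And>w. (\<lambda>y. K y w) differentiable (at x)"
  defines "p \<equiv> \<lambda>a b c. K x (seq3 a b c)"
    and "D \<equiv> \<lambda>a b c d. frechet_derivative (\<lambda>y. K y (seq3 b c d)) (at x) a"
  shows "fn_bracket 3 3 K K x v = 2 *\<^sub>R brk p D v"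
proof -
  have dep: "K y v = K y w" if "y \<in> S" "\<And>i. i < 3 \<Longrightarrow> v i = w i" for y v w
    using is_form_cong[OF form[OF that(1)], of v w] that(2) by (simp add: vec_eq_iff)
  have Kp: "K x w = p (w 0) (w 1) (w 2)" for w
    unfolding p_def by (rule dep[OF S(2)]) (rule seq3_self[symmetric])
  \<comment> \<open>Outside \<open>S\<close> the field need not be a form; dropping the later
    entries of \<open>w\<close> under the derivative uses that \<open>S\<close> is a neighbourhood
    of \<open>x\<close>.\<close>
  have dD: "frechet_derivative (\<lambda>y. K y w) (at x) a = D a (w 0) (w 1) (w 2)" for w a
    unfolding D_def
    by (rule fun_cong[OF frechet_derivative_transform_within_open[OF diff S]])
      (rule dep, assumption, rule seq3_self[symmetric])
  have dDc: "frechet_derivative (\<lambda>y. K y w $ \<mu>) (at x) a = D a (w 0) (w 1) (w 2) $ \<mu>" for w a \<mu>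
    by (simp add: frechet_derivative_component[OF diff] dD)
  have linD: "linear (\<lambda>a. D a b c d)" for b c d
    unfolding D_def using linear_frechet_derivative[OF diff] .
  have linp: "linear (\<lambda>a. p a b c)" for b c
  proof (rule linearI)
    fix a a' and r :: real
    have lin: "linear (\<lambda>a. K x ((seq3 a b c)(0 := a)) $ \<mu>)" for \<mu>
    proof -
      have "K x ((seq3 a b c)(0 := a)) $ \<mu> = K x ((seq3 0 b c)(0 := a)) $ \<mu>" for a
        by (intro is_form_cong[OF form[OF S(2)]]) (auto simp: seq3_def)
      then show ?thesis using is_form_linear[OF form[OF S(2)], of 0] by simp
    qed
    have e: "(seq3 a b c)(0 := a) = seq3 a b c" for a by (auto simp: seq3_def fun_eq_iff)
    show "p (a + a') b c = p a b c + p a' b c" "p (r *\<^sub>R a) b c = r *\<^sub>R p a b c"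
      using linear_add[OF lin[unfolded e]] linear_cmul[OF lin[unfolded e]] by (auto simp: p_def vec_eq_iff)
  qed
  have lie: "lie_deriv 3 (\<lambda>_. axis \<mu> 1) (\<lambda>y w. K y w $ \<nu>) x w = D (axis \<mu> 1) (w 0) (w 1) (w 2) $ \<nu>" for \<mu> \<nu> w
  proof -
    have "K x (w(i := 0)) $ \<nu> = 0" if "i < 3" for i
      using linear_0[OF is_form_linear[OF form[OF S(2)] that]] .
    then show ?thesis by (simp add: lie_deriv_def dDc)
  qed
  have ext: "ext_deriv 3 (\<lambda>y w. K y w $ \<mu>) x w =
      (\<Sum>i\<le>3. (-1) ^ i * D (w i) (skip i w 0) (skip i w 1) (skip i w 2) $ \<mu>)" for \<mu> w
    unfolding ext_deriv_def dDc skip_def ..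
  have int: "interior 3 (axis \<mu> 1) (\<lambda>w. K x w $ \<kappa>) w = p (axis \<mu> 1) (w 0) (w 1) $ \<kappa>" for \<mu> \<kappa> w
    by (simp add: interior_def Kp numeral_2_eq_2 split: nat.split)
  let ?W = "\<lambda>\<mu> \<kappa>. wedge 3 3 (\<lambda>u. p (u 0) (u 1) (u 2) $ \<mu>) (\<lambda>u. D (axis \<mu> 1) (u 0) (u 1) (u 2) $ \<kappa>) v"
  let ?Z = "\<lambda>\<mu> \<kappa>. wedge 4 2 (\<lambda>u. \<Sum>i\<le>3. (-1) ^ i * D (u i) (skip i u 0) (skip i u 1) (skip i u 2) $ \<mu>)
        (\<lambda>u. p (axis \<mu> 1) (u 0) (u 1) $ \<kappa>) v"
  have c33: "wedge 3 3 (\<lambda>u. D (axis \<mu> 1) (u 0) (u 1) (u 2) $ \<kappa>) (\<lambda>u. p (u 0) (u 1) (u 2) $ \<mu>) v = - ?W \<mu> \<kappa>" for \<mu> \<kappa>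
    by (rule wedge_commute_3_3) auto
  have c24: "wedge 2 4 (\<lambda>u. p (axis \<mu> 1) (u 0) (u 1) $ \<kappa>) (\<lambda>u. \<Sum>i\<le>3. (-1) ^ i * D (u i) (skip i u 0) (skip i u 1) (skip i u 2) $ \<mu>) v = ?Z \<mu> \<kappa>" for \<mu> \<kappa>
    by (rule wedge_commute_2_4) (auto simp: skip_def intro!: sum.cong)
  have lb: "lie_bracket (\<lambda>_. axis \<mu> 1) (\<lambda>_. axis \<nu> 1) x = 0" for \<mu> \<nu> :: 'n
    by (simp add: lie_bracket_def)
  \<comment> \<open>The two orders of each wedge product are aligned by \<open>c33\<close> and
    \<open>c24\<close>. The sign of \<open>c33\<close> cancels the minus of the second Lie
    derivative term; the minus before \<open>?Z\<close> is the sign of degree 3.\<close>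
  have fd: "fn_decomposable 3 3 (\<lambda>y w. K y w $ \<mu>) (\<lambda>_. axis \<mu> 1) (\<lambda>y w. K y w $ \<nu>) (\<lambda>_. axis \<nu> 1) x v =
     ?W \<mu> \<nu> *\<^sub>R axis \<nu> 1 + ?W \<nu> \<mu> *\<^sub>R axis \<mu> 1 - (?Z \<mu> \<nu> *\<^sub>R axis \<nu> 1 + ?Z \<nu> \<mu> *\<^sub>R axis \<mu> 1)" for \<mu> \<nu>
    unfolding fn_decomposable_def lb int[abs_def]
    using c33 c24 by (simp add: lie[abs_def] ext[abs_def] Kp[abs_def])
  show ?thesis
  proof (rule vec_eq_iff[THEN iffD2, rule_format])
    fix \<kappa>
    have d1: "(\<Sum>\<mu>\<in>UNIV. \<Sum>\<nu>\<in>UNIV. h \<mu> \<nu> * axis \<nu> 1 $ \<kappa>) = (\<Sum>\<mu>\<in>UNIV. h \<mu> \<kappa>)" for h :: "'n \<Rightarrow> 'n \<Rightarrow> real"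
      by (simp add: axis_def if_distrib[of "(*) _"] cong: if_cong)
    have d2: "(\<Sum>\<mu>\<in>UNIV. \<Sum>\<nu>\<in>UNIV. h \<nu> \<mu> * axis \<mu> 1 $ \<kappa>) = (\<Sum>\<mu>\<in>UNIV. h \<mu> \<kappa>)" for h :: "'n \<Rightarrow> 'n \<Rightarrow> real"
      by (subst sum.swap) (rule d1)
    have "fn_bracket 3 3 K K x v $ \<kappa> = 2 * ((\<Sum>\<mu>\<in>UNIV. ?W \<mu> \<kappa>) - (\<Sum>\<mu>\<in>UNIV. ?Z \<mu> \<kappa>))"
      unfolding fn_bracket_def fd
      by (simp add: sum.distrib sum_subtractf d1[of ?W] d1[of ?Z] d2[of ?W] d2[of ?Z] del: One_nat_def)
    then show "fn_bracket 3 3 K K x v $ \<kappa> = (2 *\<^sub>R brk p D v) $ \<kappa>"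
      by (simp add: brk_component[OF linp linD] del: One_nat_def)
  qed
qed

section \<open>The model in terms of octonion multiplication\<close>

text \<open>
  The octonion product of basis elements is \<open>e\<^sub>a e\<^sub>b = \<plusminus> e\<^sub>c\<close>, where the index \<open>c = xr a b\<close> is the bitwise
  exclusive or of \<open>a\<close> and \<open>b\<close>, and the sign is negative iff \<open>oct_neg a b\<close>.
\<close>

fun xr :: "idx \<Rightarrow> idx \<Rightarrow> idx" where
  "xr I0 I0 = I0" | "xr I0 I1 = I1" | "xr I0 I2 = I2" | "xr I0 I3 = I3" | "xr I0 I4 = I4" | "xr I0 I5 = I5" | "xr I0 I6 = I6" | "xr I0 I7 = I7"
  | "xr I1 I0 = I1" | "xr I1 I1 = I0" | "xr I1 I2 = I3" | "xr I1 I3 = I2" | "xr I1 I4 = I5" | "xr I1 I5 = I4" | "xr I1 I6 = I7" | "xr I1 I7 = I6"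
  | "xr I2 I0 = I2" | "xr I2 I1 = I3" | "xr I2 I2 = I0" | "xr I2 I3 = I1" | "xr I2 I4 = I6" | "xr I2 I5 = I7" | "xr I2 I6 = I4" | "xr I2 I7 = I5"
  | "xr I3 I0 = I3" | "xr I3 I1 = I2" | "xr I3 I2 = I1" | "xr I3 I3 = I0" | "xr I3 I4 = I7" | "xr I3 I5 = I6" | "xr I3 I6 = I5" | "xr I3 I7 = I4"
  | "xr I4 I0 = I4" | "xr I4 I1 = I5" | "xr I4 I2 = I6" | "xr I4 I3 = I7" | "xr I4 I4 = I0" | "xr I4 I5 = I1" | "xr I4 I6 = I2" | "xr I4 I7 = I3"
  | "xr I5 I0 = I5" | "xr I5 I1 = I4" | "xr I5 I2 = I7" | "xr I5 I3 = I6" | "xr I5 I4 = I1" | "xr I5 I5 = I0" | "xr I5 I6 = I3" | "xr I5 I7 = I2"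
  | "xr I6 I0 = I6" | "xr I6 I1 = I7" | "xr I6 I2 = I4" | "xr I6 I3 = I5" | "xr I6 I4 = I2" | "xr I6 I5 = I3" | "xr I6 I6 = I0" | "xr I6 I7 = I1"
  | "xr I7 I0 = I7" | "xr I7 I1 = I6" | "xr I7 I2 = I5" | "xr I7 I3 = I4" | "xr I7 I4 = I3" | "xr I7 I5 = I2" | "xr I7 I6 = I1" | "xr I7 I7 = I0"

fun oct_neg :: "idx \<Rightarrow> idx \<Rightarrow> bool" where
  "oct_neg I0 I0 = False" | "oct_neg I0 I1 = False" | "oct_neg I0 I2 = False" | "oct_neg I0 I3 = False" | "oct_neg I0 I4 = False" | "oct_neg I0 I5 = False" | "oct_neg I0 I6 = False" | "oct_neg I0 I7 = False"
  | "oct_neg I1 I0 = False" | "oct_neg I1 I1 = True" | "oct_neg I1 I2 = False" | "oct_neg I1 I3 = True" | "oct_neg I1 I4 = False" | "oct_neg I1 I5 = True" | "oct_neg I1 I6 = False" | "oct_neg I1 I7 = True"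
  | "oct_neg I2 I0 = False" | "oct_neg I2 I1 = True" | "oct_neg I2 I2 = True" | "oct_neg I2 I3 = False" | "oct_neg I2 I4 = False" | "oct_neg I2 I5 = True" | "oct_neg I2 I6 = True" | "oct_neg I2 I7 = False"
  | "oct_neg I3 I0 = False" | "oct_neg I3 I1 = False" | "oct_neg I3 I2 = True" | "oct_neg I3 I3 = True" | "oct_neg I3 I4 = True" | "oct_neg I3 I5 = True" | "oct_neg I3 I6 = False" | "oct_neg I3 I7 = False"
  | "oct_neg I4 I0 = False" | "oct_neg I4 I1 = True" | "oct_neg I4 I2 = True" | "oct_neg I4 I3 = False" | "oct_neg I4 I4 = True" | "oct_neg I4 I5 = False" | "oct_neg I4 I6 = False" | "oct_neg I4 I7 = True"
  | "oct_neg I5 I0 = False" | "oct_neg I5 I1 = False" | "oct_neg I5 I2 = False" | "oct_neg I5 I3 = False" | "oct_neg I5 I4 = True" | "oct_neg I5 I5 = True" | "oct_neg I5 I6 = True" | "oct_neg I5 I7 = True"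
  | "oct_neg I6 I0 = False" | "oct_neg I6 I1 = True" | "oct_neg I6 I2 = False" | "oct_neg I6 I3 = True" | "oct_neg I6 I4 = True" | "oct_neg I6 I5 = False" | "oct_neg I6 I6 = True" | "oct_neg I6 I7 = False"
  | "oct_neg I7 I0 = False" | "oct_neg I7 I1 = False" | "oct_neg I7 I2 = True" | "oct_neg I7 I3 = True" | "oct_neg I7 I4 = False" | "oct_neg I7 I5 = False" | "oct_neg I7 I6 = True" | "oct_neg I7 I7 = True"

text \<open>
  With \<open>\<phi>(x, y, z) = \<langle>x y, z\<rangle>\<close> on imaginary octonions and the conjugate written as \<open>x\<^sup>*\<close>, the formulas on
  orthogonal vectors are \<open>P(x, y, z) = - (x y\<^sup>*) z\<close>, \<open>\<lambda>\<^sup>2(v)(x, y) = - \<langle>x y\<^sup>*, v\<rangle>\<close> and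
  \<open>\<lambda>\<^sup>4(v)(x, y, z, w) = - \<langle>P(y, z, w) x\<^sup>*, v\<rangle>\<close>.
\<close>

definition Phi_neg :: "idx \<Rightarrow> idx \<Rightarrow> idx \<Rightarrow> bool" where
  "Phi_neg a b c \<longleftrightarrow> ((b = I0) \<noteq> (oct_neg a b \<noteq> oct_neg (xr a b) c))"

definition lam2_neg :: "idx \<Rightarrow> idx \<Rightarrow> bool" where
  "lam2_neg a b \<longleftrightarrow> ((b = I0) \<noteq> oct_neg a b)"

definition lam4_neg :: "idx \<Rightarrow> idx \<Rightarrow> idx \<Rightarrow> idx \<Rightarrow> bool" where
  "lam4_neg a b c d \<longleftrightarrow> ((a = I0) \<noteq> (oct_neg (xr b (xr c d)) a \<noteq> Phi_neg b c d))"

text \<open>The triple product of three distinct basis octonions is plus or minus one basis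
  octonion, so the fourth index is forced to be the exclusive or of the others.\<close>

definition Phi_val :: "idx \<Rightarrow> idx \<Rightarrow> idx \<Rightarrow> idx \<Rightarrow> int" where
  "Phi_val a b c d =
     (if a = b \<or> a = c \<or> b = c \<or> d \<noteq> xr a (xr b c) then 0 else if Phi_neg a b c then -1 else 1)"

definition star_val :: "idx \<Rightarrow> idx \<Rightarrow> idx \<Rightarrow> idx \<Rightarrow> int" where
  "star_val a b c d = (if a = I0 \<or> b = I0 \<or> c = I0 \<or> d = I0 then 0 else Phi_val a b c d)"

definition distinct4 :: "idx \<Rightarrow> idx \<Rightarrow> idx \<Rightarrow> idx \<Rightarrow> bool" where
  "distinct4 a b c d \<longleftrightarrow> a \<noteq> b \<and> a \<noteq> c \<and> b \<noteq> c \<and> a \<noteq> d \<and> b \<noteq> d \<and> c \<noteq> d"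

text \<open>A quantifier that \<open>code_simp\<close> evaluates by running through
  \<open>idxs\<close>.\<close>

definition all_idx :: "(idx \<Rightarrow> bool) \<Rightarrow> bool" where
  "all_idx Q = list_all Q idxs"

lemma all_idxD: "all_idx Q \<Longrightarrow> Q a"
  unfolding all_idx_def list_all_iff by simp

section \<open>The octonion tables agree with the given forms\<close>

lemma phi_val_correct:
  "all_idx (\<lambda>a. all_idx (\<lambda>b. all_idx (\<lambda>c.
     coform_val [I3, I2, I1] [a, b, c] + coform_val [I5, I4, I1] [a, b, c] + coform_val [I7, I6, I1] [a, b, c]
     + coform_val [I6, I4, I2] [a, b, c] - coform_val [I7, I5, I2] [a, b, c]
     - coform_val [I7, I4, I3] [a, b, c] - coform_val [I6, I5, I3] [a, b, c] = Phi_val I0 a b c)))"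
  by code_simp

text \<open>Alternating forms vanish on repeated indices, so only distinct ones are checked; the
  nested guards cut off the enumeration early.\<close>

lemma star_val_correct:
  "all_idx (\<lambda>a. all_idx (\<lambda>b. a \<noteq> b \<longrightarrow> all_idx (\<lambda>c. a \<noteq> c \<longrightarrow> b \<noteq> c \<longrightarrow> all_idx (\<lambda>d. distinct4 a b c d \<longrightarrow>
     coform_val [I7, I6, I5, I4] [a, b, c, d] + coform_val [I7, I6, I3, I2] [a, b, c, d]
     + coform_val [I5, I4, I3, I2] [a, b, c, d] + coform_val [I7, I5, I3, I1] [a, b, c, d]
     - coform_val [I6, I4, I3, I1] [a, b, c, d] - coform_val [I6, I5, I2, I1] [a, b, c, d]
     - coform_val [I7, I4, I2, I1] [a, b, c, d] = star_val a b c d))))"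
  by code_simp

text \<open>The first four summands are the shuffles of the product of the covector with index 0 and
  \<phi>. The two checks below follow the same pattern, with \<open>j\<close> the basis vector to
  which the embedding is applied.\<close>

lemma Phi_val_correct:
  "all_idx (\<lambda>a. all_idx (\<lambda>b. a \<noteq> b \<longrightarrow> all_idx (\<lambda>c. a \<noteq> c \<longrightarrow> b \<noteq> c \<longrightarrow> all_idx (\<lambda>d. distinct4 a b c d \<longrightarrow>
     (if a = I0 then Phi_val I0 b c d else 0) - (if b = I0 then Phi_val I0 a c d else 0)
     + (if c = I0 then Phi_val I0 a b d else 0) - (if d = I0 then Phi_val I0 a b c else 0)
     + star_val a b c d = Phi_val a b c d))))"
  by code_simp

lemma lam2_val_correct:
  "all_idx (\<lambda>a. all_idx (\<lambda>b. a \<noteq> b \<longrightarrow> all_idx (\<lambda>j. j \<noteq> I0 \<longrightarrow>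
     (if a = I0 then if b = j then 1 else 0 else 0) - (if b = I0 then if a = j then 1 else 0 else 0)
       + Phi_val I0 j a b =
     (if j = xr a b then if lam2_neg a b then -1 else (1::int) else 0))))"
  by code_simp

lemma lam4_val_correct:
  "all_idx (\<lambda>a. all_idx (\<lambda>b. a \<noteq> b \<longrightarrow> all_idx (\<lambda>c. a \<noteq> c \<longrightarrow> b \<noteq> c \<longrightarrow> all_idx (\<lambda>d. distinct4 a b c d \<longrightarrow>
     all_idx (\<lambda>j. j \<noteq> I0 \<longrightarrow>
     (if a = I0 then star_val j b c d else 0) - (if b = I0 then star_val j a c d else 0)
     + (if c = I0 then star_val j a b d else 0) - (if d = I0 then star_val j a b c else 0)
     - ((if a = j then Phi_val I0 b c d else 0) - (if b = j then Phi_val I0 a c d else 0)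
        + (if c = j then Phi_val I0 a b d else 0) - (if d = j then Phi_val I0 a b c else 0)) =
     (if j = xr a (xr b (xr c d)) then if lam4_neg a b c d then -1 else 1 else 0))))))"
  by code_simp

text \<open>
  A list of triples \<open>(s, m, j)\<close> stands for the sum of the monomials \<open>t(e\<^sub>m)\<^sub>j\<close>, with the minus sign if \<open>s\<close> holds.
  \<open>brk_leaves \<nu> i\<close> is the expansion of the top-degree form \<open>([P, P]\<^sup>\<nu>/2) \<and> \<lambda>\<^sup>2(e\<^sub>i)\<close>, where \<open>leaf33\<close> comes from the
  summand of \<open>[P, P]\<close> with \<open>P \<and> \<nabla>P\<close> and \<open>leaf42\<close> from the one with \<open>dP\<close>.
\<close>

fun leaf33 :: "bool \<Rightarrow> idx \<Rightarrow> idx list \<Rightarrow> idx list \<Rightarrow> (bool \<times> idx \<times> idx) list" where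
  "leaf33 s \<nu> [a, b, c] [d, e, f] =
     (if a = b \<or> a = c \<or> b = c \<or> \<not> distinct4 d e f \<nu> then []
      else [(s \<noteq> (Phi_neg a b c \<noteq> lam4_neg d e f \<nu>), xr a (xr b c), xr d (xr e (xr f \<nu>)))])"
| "leaf33 s \<nu> _ _ = []"

text \<open>Component \<open>m\<close> of the covariant derivative of P in direction
  \<open>a\<close> on the vectors \<open>b\<close>, \<open>c\<close>, \<open>d\<close>; four of
  these make up one value of the exterior derivative.\<close>

definition leaf4 :: "bool \<Rightarrow> idx \<Rightarrow> idx \<Rightarrow> idx \<Rightarrow> idx \<Rightarrow> idx \<Rightarrow> (bool \<times> idx \<times> idx) list" where
  "leaf4 s a b c d m =
     (if distinct4 b c d m then [(s \<noteq> lam4_neg b c d m, a, xr b (xr c (xr d m)))] else [])"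

fun leaf42 :: "bool \<Rightarrow> idx \<Rightarrow> idx list \<Rightarrow> idx list \<Rightarrow> (bool \<times> idx \<times> idx) list" where
  "leaf42 s \<nu> [a, b, c, d] [e, f] =
     (if e = f \<or> e = \<nu> \<or> f = \<nu> then []
      else let m = xr e (xr f \<nu>); r = (s = Phi_neg m e f) in
        leaf4 r a b c d m @ leaf4 (\<not> r) b a c d m @ leaf4 r c a b d m @ leaf4 (\<not> r) d a b c m)"
| "leaf42 s \<nu> _ _ = []"

text \<open>The two-form factor with index \<open>i\<close> vanishes unless
  \<open>xr p q = i\<close>, so the inner shuffles are generated only for such pairs.\<close>

fun leaf62 :: "bool \<Rightarrow> idx \<Rightarrow> idx \<Rightarrow> idx list \<Rightarrow> idx list \<Rightarrow> (bool \<times> idx \<times> idx) list" where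
  "leaf62 s \<nu> i as [p, q] =
     (if p = q \<or> xr p q \<noteq> i then []
      else let r = (s \<noteq> lam2_neg p q) in
        concat (map (\<lambda>(s, as, bs). leaf33 s \<nu> as bs) (shuffles_rev r 3 3 (rev as) [] [])) @
        concat (map (\<lambda>(s, as, bs). leaf42 s \<nu> as bs) (shuffles_rev r 4 2 (rev as) [] [])))"
| "leaf62 s \<nu> i _ _ = []"

definition brk_leaves :: "idx \<Rightarrow> idx \<Rightarrow> (bool \<times> idx \<times> idx) list" where
  "brk_leaves \<nu> i = concat (map (\<lambda>(s, as, bs). leaf62 s \<nu> i as bs) (shuffles_rev False 6 2 (rev idxs) [] []))"

definition sgi :: "bool \<Rightarrow> int" where "sgi s = (if s then -1 else 1)"

text \<open>Only the index \<open>k\<close> is compared: the checks below show that the other index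
  is a function of it.\<close>

definition leaf_coeff :: "(bool \<times> idx \<times> idx) list \<Rightarrow> idx \<Rightarrow> int" where
  "leaf_coeff xs j = (\<Sum>(s, m, k)\<leftarrow>filter (\<lambda>(s, m, k). k = j) xs. sgi s)"

text \<open>The matrix of the map J on basis vectors; see \<open>cross2_ax\<close>.\<close>

definition X_val :: "idx \<Rightarrow> idx \<Rightarrow> idx \<Rightarrow> int" where
  "X_val a b j = (if a \<noteq> b \<and> j = xr a b then sgi (lam2_neg a b) else 0)"

text \<open>The expansion of \<Phi> \<and> \<open>lam2_0 a\<close> \<and> \<open>lam2_0 b\<close> on
  the standard basis; here a triple stands for a signed monomial in one component of
  \<open>a\<close> and one of \<open>b\<close>.\<close>

definition wedge_leaves :: "(bool \<times> idx \<times> idx) list" where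
  "wedge_leaves = concat (map (\<lambda>(s, as, qs). concat (map (\<lambda>(r, bs, ps).
     case (bs, ps, qs) of ([a, b, c, d], [e, f], [p, q]) \<Rightarrow>
       if Phi_val a b c d = 0 \<or> e = f \<or> p = q then []
       else [(s \<noteq> (r \<noteq> (Phi_neg a b c \<noteq> (lam2_neg e f \<noteq> lam2_neg p q))), xr e f, xr p q)]
     | _ \<Rightarrow> []) (shuffles_rev False 4 2 (rev as) [] []))) (shuffles_rev False 6 2 (rev idxs) [] []))"

text \<open>The origin of the constant 12: the top-degree product is diagonal in the two vectors,
  with this coefficient throughout.\<close>

lemma wedge_leaves_correct:
  "let xs = wedge_leaves in list_all (\<lambda>(s, i, j). i = j) xs \<and>
     all_idx (\<lambda>j. j \<noteq> I0 \<longrightarrow> leaf_coeff xs j = 12)"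
  by code_simp

text \<open>All tensors involved respect the exclusive or of indices, and the eight indices together
  have exclusive or 0. Hence only monomials with \<open>xr m j = xr \<nu> i\<close> occur. Their
  coefficients are those of -12 times the identity and -4 times J J^T.\<close>

lemma brk_leaves_correct:
  "all_idx (\<lambda>\<nu>. all_idx (\<lambda>i. i \<noteq> I0 \<longrightarrow> (let xs = brk_leaves \<nu> i; d = xr \<nu> i in
     list_all (\<lambda>(s, m, j). m = xr j d) xs \<and>
     all_idx (\<lambda>j. j \<noteq> I0 \<longrightarrow> leaf_coeff xs j =
       (if j = i then -12 else 0) - 4 * (X_val d \<nu> i * X_val d (xr j d) j)))))"
  by code_simp

section \<open>Sums over indices and the exclusive or\<close>

lemma sum_ix: "(\<Sum>\<mu>\<in>UNIV. f (\<mu>::8)) = (\<Sum>a\<in>UNIV. f (ix a))"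
  using sum.reindex_bij_betw[OF bij_ix, of f] by simp

lemma sum_idx_delta: "(\<Sum>m\<in>UNIV. if m = (a::idx) then f m else (0::'b::comm_monoid_add)) = f a"
  by (simp add: sum.delta)

lemma forall_8_ix: "(\<forall>\<mu>. Q (\<mu>::8)) \<longleftrightarrow> (\<forall>a. Q (ix a))"
  using bij_ix by (metis bij_pointE)

lemma xr_facts:
  "all_idx (\<lambda>a. all_idx (\<lambda>b. xr a b = xr b a \<and> xr a (xr a b) = b \<and> (xr a b = I0) = (a = b) \<and>
     all_idx (\<lambda>c. xr (xr a b) c = xr a (xr b c))))"
  by code_simp

lemma xr_commute: "xr a b = xr b a"
  and xr_cancel [simp]: "xr a (xr a b) = b"
  and xr_eq_I0 [simp]: "xr a b = I0 \<longleftrightarrow> a = b"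
  and xr_assoc: "xr (xr a b) c = xr a (xr b c)"
  using all_idxD[OF all_idxD[OF xr_facts, of a], of b] all_idxD by blast+

lemma xr_left_commute: "xr a (xr b c) = xr b (xr a c)"
  by (metis xr_assoc xr_commute)

lemma Phi_val_eq_0: "\<not> distinct4 a b c d \<Longrightarrow> Phi_val a b c d = 0"
proof (rule ccontr)
  assume n: "\<not> distinct4 a b c d" and "Phi_val a b c d \<noteq> 0"
  then have d: "a \<noteq> b" "a \<noteq> c" "b \<noteq> c" "d = xr a (xr b c)"
    by (auto simp: Phi_val_def split: if_splits)
  have absorb: "xr x z = x \<longleftrightarrow> z = I0" for x z by (metis xr_cancel xr_eq_I0)
  have "d = xr b (xr a c)" "d = xr c (xr a b)"
    using d(4) by (metis xr_assoc xr_commute)+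
  then have "d \<noteq> a" "d \<noteq> b" "d \<noteq> c"
    using d absorb xr_eq_I0 by metis+
  then show False using n d by (auto simp: distinct4_def)
qed

lemma sg_simps: "sg True = -1" "sg False = 1" "sg s * sg r = sg (s \<noteq> r)"
  by (auto simp: sg_def)

lemma of_int_sgi: "of_int (sgi s) = sg s"
  by (simp add: sgi_def sg_def)

section \<open>Components of the model forms\<close>

definition seq2 :: "'v \<Rightarrow> 'v \<Rightarrow> nat \<Rightarrow> 'v" where
  "seq2 x y i = (if i = 0 then x else y)"

definition seq4 :: "'v \<Rightarrow> 'v \<Rightarrow> 'v \<Rightarrow> 'v \<Rightarrow> nat \<Rightarrow> 'v" where
  "seq4 x y z w i = (if i = 0 then x else if i = 1 then y else if i = 2 then z else w)"

lemma form2_seq2: "is_form 2 \<alpha> \<Longrightarrow> \<alpha> v = \<alpha> (seq2 (v 0) (v 1))"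
  by (erule is_form_cong) (auto simp: seq2_def less_Suc_eq numeral_eq_Suc)

lemma form4_seq4: "is_form 4 \<alpha> \<Longrightarrow> \<alpha> v = \<alpha> (seq4 (v 0) (v 1) (v 2) (v 3))"
  by (erule is_form_cong) (auto simp: seq4_def less_Suc_eq numeral_eq_Suc)

lemma form2_bas: "is_form 2 \<alpha> \<Longrightarrow> \<alpha> (bas [a, b]) = \<alpha> (seq2 (ax a) (ax b))"
  by (subst form2_seq2) (simp_all add: bas_def)

lemma form4_bas: "is_form 4 \<alpha> \<Longrightarrow> \<alpha> (bas [a, b, c, d]) = \<alpha> (seq4 (ax a) (ax b) (ax c) (ax d))"
  by (subst form4_seq4) (simp_all add: bas_def eval_nat_numeral)

lemma form2_linear:
  assumes "is_form 2 \<alpha>"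
  shows "linear (\<lambda>x. \<alpha> (seq2 x y))" "linear (\<lambda>y. \<alpha> (seq2 x y))"
proof -
  have "(seq2 0 y)(0 := x) = seq2 x y" for x y :: "real^'a" by (simp add: seq2_def fun_eq_iff)
  then show "linear (\<lambda>x. \<alpha> (seq2 x y))" using is_form_linear[OF assms, of 0 "seq2 0 y"] by simp
  have "\<alpha> ((seq2 x 0)(1 := y)) = \<alpha> (seq2 x y)" for y
    by (rule is_form_cong[OF assms]) (auto simp: seq2_def)
  then show "linear (\<lambda>y. \<alpha> (seq2 x y))" using is_form_linear[OF assms, of 1 "seq2 x 0"] by simp
qed

lemma form4_linear:
  assumes "is_form 4 \<alpha>"
  shows "linear (\<lambda>x. \<alpha> (seq4 x y z w))" "linear (\<lambda>y. \<alpha> (seq4 x y z w))"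
    "linear (\<lambda>z. \<alpha> (seq4 x y z w))" "linear (\<lambda>w. \<alpha> (seq4 x y z w))"
proof -
  have "(seq4 0 y z w)(0 := x) = seq4 x y z w" for x by (simp add: seq4_def fun_eq_iff)
  then show "linear (\<lambda>x. \<alpha> (seq4 x y z w))" using is_form_linear[OF assms, of 0 "seq4 0 y z w"] by simp
  have "(seq4 x 0 z w)(1 := y) = seq4 x y z w" for y by (simp add: seq4_def fun_eq_iff)
  then show "linear (\<lambda>y. \<alpha> (seq4 x y z w))" using is_form_linear[OF assms, of 1 "seq4 x 0 z w"] by simp
  have "(seq4 x y 0 w)(2 := z) = seq4 x y z w" for z by (simp add: seq4_def fun_eq_iff)
  then show "linear (\<lambda>z. \<alpha> (seq4 x y z w))" using is_form_linear[OF assms, of 2 "seq4 x y 0 w"] by simp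
  have "\<alpha> ((seq4 x y z 0)(3 := w)) = \<alpha> (seq4 x y z w)" for w
    by (rule is_form_cong[OF assms]) (simp add: seq4_def)
  then show "linear (\<lambda>w. \<alpha> (seq4 x y z w))" using is_form_linear[OF assms, of 3 "seq4 x y z 0"] by simp
qed

lemma form4_eq_0:
  assumes "is_form 4 \<alpha>"
  shows "\<alpha> (seq4 x x z w) = 0" "\<alpha> (seq4 x y x w) = 0" "\<alpha> (seq4 x y z x) = 0"
    "\<alpha> (seq4 x y y w) = 0" "\<alpha> (seq4 x y z y) = 0" "\<alpha> (seq4 x y z z) = 0"
  using is_form_eq_0[OF assms, of 0 1] is_form_eq_0[OF assms, of 0 2] is_form_eq_0[OF assms, of 0 3]
    is_form_eq_0[OF assms, of 1 2] is_form_eq_0[OF assms, of 1 3] is_form_eq_0[OF assms, of 2 3]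
  by (simp_all add: seq4_def)

lemma form4_swap:
  assumes "is_form 4 \<alpha>"
  shows "\<alpha> (seq4 y x z w) = - \<alpha> (seq4 x y z w)" "\<alpha> (seq4 x z y w) = - \<alpha> (seq4 x y z w)"
    "\<alpha> (seq4 x y w z) = - \<alpha> (seq4 x y z w)"
proof -
  have "seq4 y x z w = seq4 x y z w \<circ> tr 0 1"
    by (simp add: seq4_def Transposition.transpose_def fun_eq_iff)
  then show "\<alpha> (seq4 y x z w) = - \<alpha> (seq4 x y z w)" using is_form_swap[OF assms, of 0 1] by simp
  have "seq4 x z y w = seq4 x y z w \<circ> tr 1 2"
    by (simp add: seq4_def Transposition.transpose_def fun_eq_iff)
  then show "\<alpha> (seq4 x z y w) = - \<alpha> (seq4 x y z w)" using is_form_swap[OF assms, of 1 2] by simp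
  have "\<alpha> (seq4 x y w z) = \<alpha> (seq4 x y z w \<circ> tr 2 3)"
    by (rule is_form_cong[OF assms]) (auto simp: seq4_def Transposition.transpose_def less_Suc_eq numeral_eq_Suc)
  then show "\<alpha> (seq4 x y w z) = - \<alpha> (seq4 x y z w)" using is_form_swap[OF assms, of 2 3] by simp
qed

lemma is_form_coform': "length is = n \<Longrightarrow> is_form n (coform is)"
  using is_form_coform by blast

lemma is_form_phi0: "is_form 3 phi0"
  unfolding phi0_def[abs_def] by (intro is_form_add is_form_diff is_form_coform') simp_all

lemma is_form_star_phi0: "is_form 4 star_phi0"
  unfolding star_phi0_def[abs_def] by (intro is_form_add is_form_diff is_form_coform') simp_all

lemma is_form_interior:
  assumes f: "is_form (Suc k) \<alpha>" shows "is_form k (interior (Suc k) x \<alpha>)"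
proof (rule is_formI)
  fix v w :: "nat \<Rightarrow> real^'a" assume "\<And>i. i < k \<Longrightarrow> v i = w i"
  then show "interior (Suc k) x \<alpha> v = interior (Suc k) x \<alpha> w"
    unfolding interior_def by (simp, intro is_form_cong[OF f]) (auto split: nat.split)
next
  fix v :: "nat \<Rightarrow> real^'a" and i assume "i < k"
  moreover have "case_nat x (v(i := y)) = (case_nat x v)(Suc i := y)" for y
    by (auto simp: fun_eq_iff split: nat.split)
  ultimately show "linear (\<lambda>y. interior (Suc k) x \<alpha> (v(i := y)))"
    using is_form_linear[OF f, of "Suc i" "case_nat x v"] by (simp add: interior_def)
next
  fix v :: "nat \<Rightarrow> real^'a" and i j assume "i < k" "j < k" "i \<noteq> j" "v i = v j"
  then show "interior (Suc k) x \<alpha> v = 0"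
    using is_form_eq_0[OF f, of "Suc i" "Suc j" "case_nat x v"] by (simp add: interior_def)
qed

lemma is_form_flat0: "is_form 1 (flat0 a)"
  by (rule is_formI) (auto simp: flat0_def intro!: linearI simp: inner_add_right)

lemma is_form_lam2_0: "is_form 2 (lam2_0 a)"
proof -
  have "is_form (1 + 1) (wedge 1 1 (coform [0]) (flat0 a))"
    by (intro is_form_wedge is_form_coform' is_form_flat0) simp
  moreover have "is_form 2 (interior 3 a phi0)"
    using is_form_interior[of 2 phi0 a] is_form_phi0 by (simp add: numeral_3_eq_3 numeral_2_eq_2)
  ultimately show ?thesis
    unfolding lam2_0_def[abs_def] by (intro is_form_add) (simp_all add: numeral_2_eq_2)
qed

lemma is_form_interior_star: "is_form 3 (interior 4 a star_phi0)"
  using is_form_interior[of 3 star_phi0 a] is_form_star_phi0 by simp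

lemma is_form_lam4_0: "is_form 4 (lam4_0 a)"
proof -
  have "is_form (1 + 3) (wedge 1 3 (coform [0]) (interior 4 a star_phi0))"
    by (intro is_form_wedge is_form_coform' is_form_interior_star) simp
  moreover have "is_form (1 + 3) (wedge 1 3 (flat0 a) phi0)"
    by (intro is_form_wedge is_form_flat0 is_form_phi0)
  ultimately show ?thesis
    unfolding lam4_0_def[abs_def] by (intro is_form_diff) simp_all
qed

lemma is_form_Phi0: "is_form 4 Phi0"
proof -
  have "is_form (1 + 3) (wedge 1 3 (coform [0]) phi0)"
    by (intro is_form_wedge is_form_coform' is_form_phi0) simp
  then show ?thesis
    unfolding Phi0_def[abs_def] by (intro is_form_add is_form_star_phi0) simp_all
qed

lemma phi0_bas: "phi0 (bas [a, b, c]) = of_int (Phi_val I0 a b c)"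
proof -
  note C = coform_bas[of "[_, _, _]" "[a, b, c]"]
  have "phi0 (bas [a, b, c]) = of_int (
     coform_val [I3, I2, I1] [a, b, c] + coform_val [I5, I4, I1] [a, b, c] + coform_val [I7, I6, I1] [a, b, c]
     + coform_val [I6, I4, I2] [a, b, c] - coform_val [I7, I5, I2] [a, b, c]
     - coform_val [I7, I4, I3] [a, b, c] - coform_val [I6, I5, I3] [a, b, c])"
    using C[of I3 I2 I1] C[of I5 I4 I1] C[of I7 I6 I1] C[of I6 I4 I2] C[of I7 I5 I2] C[of I7 I4 I3] C[of I6 I5 I3]
    by (simp add: phi0_def del: coform_val.simps)
  then show ?thesis
    using all_idxD[OF all_idxD[OF all_idxD[OF phi_val_correct, of a], of b], of c] by simp
qed

lemma form4_bas_eq_0: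
  assumes "is_form 4 \<alpha>" "\<not> distinct4 a b c d" shows "\<alpha> (bas [a, b, c, d]) = 0"
  using assms(2) form4_eq_0[OF assms(1)] unfolding form4_bas[OF assms(1)] distinct4_def by auto

lemma star_phi0_bas: "star_phi0 (bas [a, b, c, d]) = of_int (star_val a b c d)"
proof (cases "distinct4 a b c d")
  case True
  note C = coform_bas[of "[_, _, _, _]" "[a, b, c, d]"]
  have "star_phi0 (bas [a, b, c, d]) = of_int (
     coform_val [I7, I6, I5, I4] [a, b, c, d] + coform_val [I7, I6, I3, I2] [a, b, c, d]
     + coform_val [I5, I4, I3, I2] [a, b, c, d] + coform_val [I7, I5, I3, I1] [a, b, c, d]
     - coform_val [I6, I4, I3, I1] [a, b, c, d] - coform_val [I6, I5, I2, I1] [a, b, c, d]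
     - coform_val [I7, I4, I2, I1] [a, b, c, d])"
    using C[of I7 I6 I5 I4] C[of I7 I6 I3 I2] C[of I5 I4 I3 I2] C[of I7 I5 I3 I1] C[of I6 I4 I3 I1]
      C[of I6 I5 I2 I1] C[of I7 I4 I2 I1]
    by (simp add: star_phi0_def del: coform_val.simps)
  moreover have d: "a \<noteq> b" "a \<noteq> c" "b \<noteq> c" using True by (auto simp: distinct4_def)
  ultimately show ?thesis
    using mp[OF all_idxD[OF mp[OF mp[OF all_idxD[OF mp[OF all_idxD[OF all_idxD[OF star_val_correct]] d(1)]] d(2)] d(3)]] True]
    by simp
next
  case False
  then show ?thesis
    using form4_bas_eq_0[OF is_form_star_phi0] by (simp add: star_val_def Phi_val_eq_0)
qed

lemma coform_1_bas: "coform [ix m] (bas [x]) = (if x = m then 1 else 0)"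
  using coform_bas[of "[m]" "[x]"] by simp

lemma wedge_1_3_bas:
  assumes "is_form 1 \<alpha>" "is_form 3 \<beta>"
  shows "wedge 1 3 \<alpha> \<beta> (bas [a, b, c, d]) =
     \<alpha> (bas [a]) * \<beta> (bas [b, c, d]) - \<alpha> (bas [b]) * \<beta> (bas [a, c, d])
     + \<alpha> (bas [c]) * \<beta> (bas [a, b, d]) - \<alpha> (bas [d]) * \<beta> (bas [a, b, c])"
  using wedge_bas[OF assms, of "[a, b, c, d]"] by (simp add: sg_def)

lemma Phi0_bas: "Phi0 (bas [a, b, c, d]) = of_int (Phi_val a b c d)"
proof (cases "distinct4 a b c d")
  case True
  have "is_form 1 (coform [0])" by (rule is_form_coform') simp
  from wedge_1_3_bas[OF this is_form_phi0, of a b c d]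
  have "Phi0 (bas [a, b, c, d]) = of_int (
     (if a = I0 then Phi_val I0 b c d else 0) - (if b = I0 then Phi_val I0 a c d else 0)
     + (if c = I0 then Phi_val I0 a b d else 0) - (if d = I0 then Phi_val I0 a b c else 0)
     + star_val a b c d)"
    using coform_1_bas[of I0] by (simp add: Phi0_def phi0_bas star_phi0_bas)
  moreover have d: "a \<noteq> b" "a \<noteq> c" "b \<noteq> c" using True by (auto simp: distinct4_def)
  ultimately show ?thesis
    using mp[OF all_idxD[OF mp[OF mp[OF all_idxD[OF mp[OF all_idxD[OF all_idxD[OF Phi_val_correct]] d(1)]] d(2)] d(3)]] True]
    by simp
next
  case False
  then show ?thesis
    using form4_bas_eq_0[OF is_form_Phi0] by (simp add: Phi_val_eq_0)
qed

lemma interior_bas: "interior (Suc k) (ax j) \<alpha> (bas as) = \<alpha> (bas (j # as))"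
proof -
  have "case_nat (ax j) (bas as) = bas (j # as)" by (auto simp: bas_def fun_eq_iff split: nat.split)
  then show ?thesis by (simp add: interior_def)
qed

lemma interior_linear: "is_form (Suc k) \<alpha> \<Longrightarrow> linear (\<lambda>x. interior (Suc k) x \<alpha> v)"
proof -
  assume f: "is_form (Suc k) \<alpha>"
  have "(case_nat 0 v)(0 := x) = case_nat x v" for x by (auto simp: fun_eq_iff split: nat.split)
  then show ?thesis using is_form_linear[OF f, of 0 "case_nat 0 v"] by (simp add: interior_def)
qed

lemma wedge_linear_right:
  assumes "\<And>v. linear (\<lambda>x. \<beta> x v)" shows "linear (\<lambda>x. wedge k l \<alpha> (\<beta> x) v)"
proof (rule linearI)
  show "wedge k l \<alpha> (\<beta> (x + y)) v = wedge k l \<alpha> (\<beta> x) v + wedge k l \<alpha> (\<beta> y) v" for x y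
    unfolding wedge_add_right[symmetric] using linear_add[OF assms] by (intro arg_cong2[where f="wedge k l \<alpha>"] ext refl)
  show "wedge k l \<alpha> (\<beta> (r *\<^sub>R x)) v = r *\<^sub>R wedge k l \<alpha> (\<beta> x) v" for r x
    using linear_cmul[OF assms] by (simp add: wedge_eq_alt alt_mult mult.left_commute)
qed

lemma wedge_linear_left:
  assumes "\<And>v. linear (\<lambda>x. \<alpha> x v)" shows "linear (\<lambda>x. wedge k l (\<alpha> x) \<beta> v)"
proof (rule linearI)
  show "wedge k l (\<alpha> (x + y)) \<beta> v = wedge k l (\<alpha> x) \<beta> v + wedge k l (\<alpha> y) \<beta> v" for x y
    using linear_add[OF assms]
    by (simp add: wedge_eq_alt distrib_right alt_add add_divide_distrib)
  show "wedge k l (\<alpha> (r *\<^sub>R x)) \<beta> v = r *\<^sub>R wedge k l (\<alpha> x) \<beta> v" for r x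
    using linear_cmul[OF assms] by (simp add: wedge_eq_alt alt_mult mult.assoc)
qed

lemma flat0_linear: "linear (\<lambda>a. flat0 a v)"
  by (rule linearI) (simp_all add: flat0_def inner_add_left)

lemma lam2_0_linear: "linear (\<lambda>a. lam2_0 a v)"
  unfolding lam2_0_def
  using interior_linear[of 2 phi0] is_form_phi0
  by (intro linear_compose_add wedge_linear_right flat0_linear) simp

lemma lam4_0_linear: "linear (\<lambda>a. lam4_0 a v)"
  unfolding lam4_0_def
  using interior_linear[of 3 star_phi0] is_form_star_phi0
  by (intro linear_compose_sub wedge_linear_right wedge_linear_left flat0_linear) simp

lemma V7_component: "t \<in> V7 \<Longrightarrow> t $ 0 = 0"
  by (simp add: V7_def)

lemma ax_V7: "ax i \<in> V7 \<longleftrightarrow> i \<noteq> I0"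
  by (cases i) (simp_all add: V7_def axis_def)

lemma linear_ix_expansion:
  assumes "linear (f :: real^8 \<Rightarrow> real)" shows "f t = (\<Sum>j\<in>UNIV. t $ ix j * f (ax j))"
  using linear_axis_expansion[OF assms, of t] by (simp add: sum_ix)

text \<open>The value of \<open>f\<close> at \<open>ax I0\<close> is left open, since
  \<open>t\<close> has no component there; this is why the tables are checked for
  \<open>j \<noteq> I0\<close> only.\<close>

lemma linear_V7_expansion:
  assumes "linear (f :: real^8 \<Rightarrow> real)" "t \<in> V7"
    and "\<And>j. j \<noteq> I0 \<Longrightarrow> f (ax j) = (if j = k then c else 0)"
  shows "f t = c * t $ ix k"
proof -
  have "t $ ix j * f (ax j) = (if j = k then c * t $ ix k else 0)" for j
  proof (cases "j = I0")
    case True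
    have "t $ ix I0 = 0" using V7_component[OF assms(2)] by simp
    then show ?thesis using True by (cases "k = I0") simp_all
  next
    case False
    show ?thesis unfolding assms(3)[OF False] by simp
  qed
  then show ?thesis by (subst linear_ix_expansion[OF assms(1)]) simp
qed

lemma lam2_0_bas:
  assumes t: "t \<in> V7"
  shows "lam2_0 t (bas [a, b]) = (if a = b then 0 else sg (lam2_neg a b) * t $ ix (xr a b))"
proof (cases "a = b")
  case True
  then show ?thesis using is_form_eq_0[OF is_form_lam2_0, of 0 1 "bas [a, b]" t] by (simp add: bas_def)
next
  case False
  have f: "is_form 1 (coform [0 :: 8])" by (rule is_form_coform') simp
  have "lam2_0 (ax j) (bas [a, b]) = (if j = xr a b then sg (lam2_neg a b) else 0)" if j: "j \<noteq> I0" for j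
  proof -
    have fl: "flat0 (ax j) (bas [x]) = (if x = j then 1 else 0)" for x
      by (simp add: flat0_def bas_def inner_axis_axis)
    have "interior 3 (ax j) phi0 (bas [a, b]) = of_int (Phi_val I0 j a b)"
      using interior_bas[of 2 j phi0] phi0_bas by simp
    moreover have "wedge 1 1 (coform [0]) (flat0 (ax j)) (bas [a, b]) =
        of_int ((if a = I0 then if b = j then 1 else 0 else 0) - (if b = I0 then if a = j then 1 else 0 else 0))"
      using wedge_bas[OF f is_form_flat0, of "[a, b]" "ax j"] coform_1_bas[of I0] fl by (simp add: sg_def)
    ultimately have "lam2_0 (ax j) (bas [a, b]) = of_int ((if a = I0 then if b = j then 1 else 0 else 0) - (if b = I0 then if a = j then 1 else 0 else 0)
       + Phi_val I0 j a b)"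
      by (simp add: lam2_0_def)
    also have "\<dots> = (if j = xr a b then sg (lam2_neg a b) else 0)"
      using mp[OF all_idxD[OF mp[OF all_idxD[OF all_idxD[OF lam2_val_correct]] False]] j] by (simp add: sg_def)
    finally show ?thesis .
  qed
  from linear_V7_expansion[OF lam2_0_linear t this] False show ?thesis by simp
qed

lemma lam4_0_bas:
  assumes t: "t \<in> V7"
  shows "lam4_0 t (bas [a, b, c, d]) =
     (if distinct4 a b c d then sg (lam4_neg a b c d) * t $ ix (xr a (xr b (xr c d))) else 0)"
proof (cases "distinct4 a b c d")
  case False
  then show ?thesis using form4_bas_eq_0[OF is_form_lam4_0] by simp
next
  case True
  then have d: "a \<noteq> b" "a \<noteq> c" "b \<noteq> c" by (auto simp: distinct4_def)
  have f: "is_form 1 (coform [0 :: 8])" by (rule is_form_coform') simp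
  have "lam4_0 (ax j) (bas [a, b, c, d]) = (if j = xr a (xr b (xr c d)) then sg (lam4_neg a b c d) else 0)"
    if j: "j \<noteq> I0" for j
  proof -
    have fl: "flat0 (ax j) (bas [x]) = (if x = j then 1 else 0)" for x
      by (simp add: flat0_def bas_def inner_axis_axis)
    have st: "interior 4 (ax j) star_phi0 (bas [x, y, z]) = of_int (star_val j x y z)" for x y z
      using interior_bas[of 3 j star_phi0] star_phi0_bas by simp
    have "lam4_0 (ax j) (bas [a, b, c, d]) = of_int (
       (if a = I0 then star_val j b c d else 0) - (if b = I0 then star_val j a c d else 0)
       + (if c = I0 then star_val j a b d else 0) - (if d = I0 then star_val j a b c else 0)
       - ((if a = j then Phi_val I0 b c d else 0) - (if b = j then Phi_val I0 a c d else 0)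
        + (if c = j then Phi_val I0 a b d else 0) - (if d = j then Phi_val I0 a b c else 0)))"
      using coform_1_bas[of I0] unfolding lam4_0_def
      by (simp add: wedge_1_3_bas[OF f is_form_interior_star] wedge_1_3_bas[OF is_form_flat0 is_form_phi0] fl st phi0_bas del: One_nat_def)
    also have "\<dots> = (if j = xr a (xr b (xr c d)) then sg (lam4_neg a b c d) else 0)"
    proof -
      note C = mp[OF all_idxD[OF mp[OF mp[OF all_idxD[OF mp[OF all_idxD[OF all_idxD[OF lam4_val_correct]] d(1)]] d(2)] d(3)]] True]
      from mp[OF all_idxD[OF C] j] show ?thesis by (simp only: sg_def) simp
    qed
    finally show ?thesis .
  qed
  from linear_V7_expansion[OF lam4_0_linear t this] True show ?thesis by simp
qed

section \<open>The model brackets\<close>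

definition tsum :: "(idx \<Rightarrow> idx \<Rightarrow> real) \<Rightarrow> (bool \<times> idx \<times> idx) list \<Rightarrow> real" where
  "tsum f xs = (\<Sum>(s, m, j)\<leftarrow>xs. sg s * f m j)"

lemma tsum_simps [simp]:
  "tsum f [] = 0" "tsum f ((s, m, j) # xs) = sg s * f m j + tsum f xs" "tsum f (xs @ ys) = tsum f xs + tsum f ys"
  by (simp_all add: tsum_def)

lemma tsum_concat: "tsum f (concat xss) = (\<Sum>xs\<leftarrow>xss. tsum f xs)"
  by (induction xss) simp_all

lemma tsum_eq_leaf_coeff:
  assumes "list_all (\<lambda>(s, m, j). m = h j) xs"
  shows "tsum f xs = (\<Sum>j\<in>UNIV. of_int (leaf_coeff xs j) * f (h j) j)"
  using assms
proof (induction xs)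
  case Nil
  then show ?case by (simp add: leaf_coeff_def)
next
  case (Cons x xs)
  obtain s m k where x: "x = (s, m, k)" by (cases x)
  have "leaf_coeff (x # xs) j = (if j = k then sgi s else 0) + leaf_coeff xs j" for j
    by (auto simp: leaf_coeff_def x)
  then have "of_int (leaf_coeff (x # xs) j) * f (h j) j =
      (if j = k then sg s * f (h j) j else 0) + of_int (leaf_coeff xs j) * f (h j) j" for j
    by (simp add: of_int_sgi distrib_right)
  then show ?case
    using Cons by (simp add: x sum.distrib)
qed

lemma shuffles_rev_length:
  "(s, as, bs) \<in> set (shuffles_rev s0 k l xs as0 bs0) \<Longrightarrow> length xs = k + l \<Longrightarrow>
     length as = k + length as0 \<and> length bs = l + length bs0"
  by (induction s0 k l xs as0 bs0 arbitrary: s as bs rule: shuffles_rev.induct)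
    (fastforce split: if_splits)+

lemma length_eq_numeral_iff:
  "length xs = 2 \<longleftrightarrow> (\<exists>a b. xs = [a, b])"
  "length xs = 3 \<longleftrightarrow> (\<exists>a b c. xs = [a, b, c])"
  "length xs = 4 \<longleftrightarrow> (\<exists>a b c d. xs = [a, b, c, d])"
  by (auto simp: length_Suc_conv eval_nat_numeral)

text \<open>The model of P, with the last index of \<open>Phi0\<close> raised by the standard inner
  product; \<open>q0\<close> does the same to \<lambda>^4 and models the covariant derivative of
  P.\<close>

definition p0 :: "real^8 \<Rightarrow> real^8 \<Rightarrow> real^8 \<Rightarrow> real^8" where
  "p0 x y z = (\<chi> \<mu>. Phi0 (seq4 x y z (axis \<mu> 1)))"

definition q0 :: "(real^8 \<Rightarrow> real^8) \<Rightarrow> real^8 \<Rightarrow> real^8 \<Rightarrow> real^8 \<Rightarrow> real^8 \<Rightarrow> real^8" where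
  "q0 t a x y z = (\<chi> \<mu>. lam4_0 (t a) (seq4 x y z (axis \<mu> 1)))"

lemma linear_if_components:
  fixes f :: "'a::real_vector \<Rightarrow> real^'n"
  assumes "\<And>\<mu>. linear (\<lambda>x. f x $ \<mu>)" shows "linear f"
  by (rule linearI) (simp_all add: vec_eq_iff linear_add[OF assms] linear_cmul[OF assms])

lemma p0_linear: "linear (\<lambda>x. p0 x y z)"
  by (rule linear_if_components) (simp add: p0_def form4_linear(1)[OF is_form_Phi0])

lemma q0_linear:
  assumes "linear t" shows "linear (\<lambda>a. q0 t a x y z)"
proof -
  have "linear (\<lambda>a. lam4_0 (t a) v)" for v
    using linear_compose[OF assms lam4_0_linear] by (simp add: o_def)
  then show ?thesis
    by (intro linear_if_components) (simp add: q0_def)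
qed

lemma is_form_slot4:
  assumes "is_form 4 \<alpha>" shows "is_form 3 (\<lambda>u. \<alpha> (seq4 (u 0) (u 1) (u 2) w))"
proof (rule is_formI)
  fix v :: "nat \<Rightarrow> real^'a" and i :: nat assume "i < 3"
  then consider "i = 0" | "i = 1" | "i = 2" by linarith
  then show "linear (\<lambda>y. \<alpha> (seq4 ((v(i := y)) 0) ((v(i := y)) 1) ((v(i := y)) 2) w))"
    by cases (simp_all add: form4_linear[OF assms])
next
  fix v :: "nat \<Rightarrow> real^'a" and i j :: nat assume ij: "i < 3" "j < 3" "i \<noteq> j" "v i = v j"
  have "i = 0 \<and> j = 1 \<or> i = 0 \<and> j = 2 \<or> i = 1 \<and> j = 2 \<or> i = 1 \<and> j = 0 \<or> i = 2 \<and> j = 0 \<or> i = 2 \<and> j = 1"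
    using ij(1-3) by (auto simp: less_Suc_eq numeral_eq_Suc)
  then show "\<alpha> (seq4 (v 0) (v 1) (v 2) w) = 0"
    using ij(4) by (elim disjE conjE) (simp_all add: form4_eq_0[OF assms])
qed (simp)

lemma is_form_slots14:
  assumes "is_form 4 \<alpha>" shows "is_form 2 (\<lambda>u. \<alpha> (seq4 x (u 0) (u 1) w))"
proof (rule is_formI)
  fix v :: "nat \<Rightarrow> real^'a" and i :: nat assume "i < 2"
  then consider "i = 0" | "i = 1" by linarith
  then show "linear (\<lambda>y. \<alpha> (seq4 x ((v(i := y)) 0) ((v(i := y)) 1) w))"
    by cases (simp_all add: form4_linear[OF assms])
next
  fix v :: "nat \<Rightarrow> real^'a" and i j :: nat assume ij: "i < 2" "j < 2" "i \<noteq> j" "v i = v j"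
  have "i = 0 \<and> j = 1 \<or> i = 1 \<and> j = 0" using ij(1-3) by (auto simp: less_Suc_eq numeral_eq_Suc)
  then show "\<alpha> (seq4 x (v 0) (v 1) w) = 0"
    using ij(4) by (elim disjE conjE) (simp_all add: form4_eq_0[OF assms])
qed (simp)

lemma sum_atMost_3: "(\<Sum>i\<le>(3::nat). f i) = f 0 + f 1 + f 2 + (f 3 :: 'b::comm_monoid_add)"
  by (simp add: eval_nat_numeral)

lemma skip_simps:
  "skip 0 u 0 = u 1" "skip 0 u 1 = u 2" "skip 0 u 2 = u 3"
  "skip 1 u 0 = u 0" "skip 1 u 1 = u 2" "skip 1 u 2 = u 3"
  "skip 2 u 0 = u 0" "skip 2 u 1 = u 1" "skip 2 u 2 = u 3"
  "skip 3 u 0 = u 0" "skip 3 u 1 = u 1" "skip 3 u 2 = u 2"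
  by (simp_all add: skip_def eval_nat_numeral)

text \<open>The direction of differentiation becomes a fourth alternating argument. If two vectors
  coincide, the terms with one of them in front cancel each other and the other two vanish. The
  fixed last vector \<open>w\<close> selects a component.\<close>

lemma is_form_alternate_skip:
  assumes lin: "\<And>x y z. linear (\<lambda>a. H a x y z)" and form: "\<And>a. is_form 4 (\<alpha> a)"
    and H: "\<And>a x y z. H a x y z = \<alpha> a (seq4 x y z w)"
  shows "is_form 4 (\<lambda>u. \<Sum>i\<le>3. (-1) ^ i * H (u i) (skip i u 0) (skip i u 1) (skip i u 2))"
proof -
  have l: "linear (\<lambda>a. H a x y z)" "linear (\<lambda>x. H a x y z)" "linear (\<lambda>y. H a x y z)" "linear (\<lambda>z. H a x y z)" for a x y z
    using lin form4_linear[OF form] by (simp_all add: H)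
  have z: "H a x x z = 0" "H a x y x = 0" "H a x y y = 0" for a x y z
    using form4_eq_0[OF form] by (simp_all add: H)
  have s: "H a y x z = - H a x y z" "H a x z y = - H a x y z" for a x y z
    unfolding H by (rule form4_swap(1)[OF form], rule form4_swap(2)[OF form])
  have eq: "(\<lambda>u. \<Sum>i\<le>3. (-1) ^ i * H (u i) (skip i u 0) (skip i u 1) (skip i u 2)) =
      (\<lambda>u. H (u 0) (u 1) (u 2) (u 3) - H (u 1) (u 0) (u 2) (u 3) + H (u 2) (u 0) (u 1) (u 3) - H (u 3) (u 0) (u 1) (u 2))"
    unfolding sum_atMost_3 skip_simps by (simp add: fun_eq_iff)
  show ?thesis
    unfolding eq
  proof (rule is_formI)
    fix v :: "nat \<Rightarrow> real^'a" and i :: nat assume "i < 4"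
    then consider "i = 0" | "i = 1" | "i = 2" | "i = 3" by linarith
    then show "linear (\<lambda>y. H ((v(i := y)) 0) ((v(i := y)) 1) ((v(i := y)) 2) ((v(i := y)) 3)
       - H ((v(i := y)) 1) ((v(i := y)) 0) ((v(i := y)) 2) ((v(i := y)) 3)
       + H ((v(i := y)) 2) ((v(i := y)) 0) ((v(i := y)) 1) ((v(i := y)) 3)
       - H ((v(i := y)) 3) ((v(i := y)) 0) ((v(i := y)) 1) ((v(i := y)) 2))"
      by cases (simp_all del: One_nat_def, (intro linear_compose_add linear_compose_sub l)+)
  next
    fix v :: "nat \<Rightarrow> real^'a" and i j :: nat assume ij: "i < 4" "j < 4" "i \<noteq> j" "v i = v j"
    let ?E = "H (v 0) (v 1) (v 2) (v 3) - H (v 1) (v 0) (v 2) (v 3) + H (v 2) (v 0) (v 1) (v 3) - H (v 3) (v 0) (v 1) (v 2)"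
    have *: "?E = 0" if "v i = v j" "i < j" "j < 4" for i j
    proof -
      have "i = 0 \<and> j = 1 \<or> i = 0 \<and> j = 2 \<or> i = 0 \<and> j = 3 \<or> i = 1 \<and> j = 2 \<or> i = 1 \<and> j = 3 \<or> i = 2 \<and> j = 3"
        using that(2,3) by (auto simp: less_Suc_eq numeral_eq_Suc)
      then consider "i = 0" "j = 1" | "i = 0" "j = 2" | "i = 0" "j = 3" | "i = 1" "j = 2" | "i = 1" "j = 3" | "i = 2" "j = 3"
        by blast
      then show ?thesis
      proof cases
        case 1 then show ?thesis using that(1) z by simp
      next
        case 2 then show ?thesis using that(1) z s(1)[of "v 0" "v 0" "v 1" "v 3"] by simp
      next
        case 3
        have "H (v 0) (v 0) (v 1) (v 2) = H (v 0) (v 1) (v 2) (v 0)"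
          using s(1)[of "v 0" "v 1" "v 0" "v 2"] s(2)[of "v 0" "v 1" "v 0" "v 2"] by simp
        then show ?thesis using 3 that(1) z by simp
      next
        case 4 then show ?thesis using that(1) z by simp
      next
        case 5 then show ?thesis using that(1) z s(2)[of "v 1" "v 0" "v 1" "v 2"] by simp
      next
        case 6 then show ?thesis using that(1) z by simp
      qed
    qed
    show "?E = 0" using *[of i j] *[of j i] ij by (cases "i < j") auto
  qed simp
qed

text \<open>In the summand with the exterior derivative the contracted index is the first one, so
  the index condition is solved for \<open>m\<close> and the sum over \<open>m\<close> reduces to
  one term.\<close>

lemma Phi_val_swapped:
  "Phi_val m e f n = (if m = xr e (xr f n) then if e = f \<or> e = n \<or> f = n then 0 else sgi (Phi_neg m e f) else 0)"
proof (cases "m = xr e (xr f n)")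
  case True
  then have n: "n = xr m (xr e f)" by (metis xr_assoc xr_cancel xr_commute)
  show ?thesis
  proof (cases "e = f \<or> e = n \<or> f = n")
    case e: True
    then have "\<not> distinct4 m e f n" by (auto simp: distinct4_def)
    then show ?thesis unfolding if_P[OF True] if_P[OF e] by (rule Phi_val_eq_0)
  next
    case False
    then have "m \<noteq> e" "m \<noteq> f"
      using True by (metis xr_cancel xr_commute xr_left_commute xr_eq_I0)+
    then have "\<not> (m = e \<or> m = f \<or> e = f \<or> n \<noteq> xr m (xr e f))" using False n by blast
    then show ?thesis unfolding if_P[OF True] if_not_P[OF False] Phi_val_def sgi_def by (rule if_not_P)
  qed
next
  case False
  then have "n \<noteq> xr m (xr e f)" by (metis xr_assoc xr_cancel xr_commute)
  then show ?thesis using False by (simp add: Phi_val_def)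
qed

lemma sg_eq: "sg (s = r) = - (sg s * sg r)" and sg_neg: "sg (\<not> r) = - sg r"
  by (auto simp: sg_def)

lemma ax_component: "ax i $ ix k = (if k = i then 1 else 0)"
  by (auto simp: axis_def)

text \<open>The map J is \<open>\<lambda>a. cross2 a\<close>: component \<kappa> is the value of the
  two-form \<lambda>^2 of the basis vector \<kappa>. Component 0 is set to 0 so that the values lie
  in \<open>V7\<close>.\<close>

definition cross2 :: "real^8 \<Rightarrow> real^8 \<Rightarrow> real^8" where
  "cross2 x y = (\<chi> \<kappa>. if \<kappa> = 0 then 0 else lam2_0 (axis \<kappa> 1) (seq2 x y))"

text \<open>The transpose of J with respect to the inner products; \<open>contr_inner\<close> is the
  adjointness.\<close>

definition contr :: "(real^8 \<Rightarrow> real^8) \<Rightarrow> real^8" where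
  "contr \<tau> = (\<chi> \<kappa>. \<Sum>\<mu>\<in>UNIV. cross2 (axis \<kappa> 1) (axis \<mu> 1) \<bullet> \<tau> (axis \<mu> 1))"

lemma cross2_linear: "linear (\<lambda>x. cross2 x y)" "linear (\<lambda>y. cross2 x y)"
proof -
  have "linear (\<lambda>x. cross2 x y $ \<kappa>)" "linear (\<lambda>y. cross2 x y $ \<kappa>)" for x y \<kappa>
    by (cases "\<kappa> = 0"; simp add: cross2_def form2_linear[OF is_form_lam2_0] linear_zero)+
  then show "linear (\<lambda>x. cross2 x y)" "linear (\<lambda>y. cross2 x y)"
    by (blast intro: linear_if_components)+
qed

lemma cross2_ax: "cross2 (ax a) (ax b) $ ix j = of_int (X_val a b j)"
proof (cases "j = I0")
  case True
  have "X_val a b I0 = 0" unfolding X_val_def using xr_eq_I0[of a b] by metis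
  then show ?thesis using True by (simp add: cross2_def)
next
  case False
  have "ix j \<noteq> 0" using False by (cases j) simp_all
  then show ?thesis
    using lam2_0_bas[of "ax j" a b] False form2_bas[OF is_form_lam2_0, of "ax j" a b]
    by (auto simp: cross2_def X_val_def ax_V7 ax_component of_int_sgi)
qed

lemma inner_ix: "x \<bullet> y = (\<Sum>j\<in>UNIV. x $ ix j * y $ ix j)"
  by (simp add: inner_vec_def sum_ix)

lemma X_val_eq_0: "k \<noteq> xr n i \<Longrightarrow> X_val k n i = 0" "m \<noteq> xr j d \<Longrightarrow> X_val d m j = 0"
  using xr_cancel xr_commute unfolding X_val_def by metis+

lemma cross2_contr_ix: "cross2 x (ax n) $ ix i = x $ ix (xr n i) * of_int (X_val (xr n i) n i)"
proof -
  have "linear (\<lambda>x. cross2 x (ax n) $ ix i)"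
    using linear_compose[OF cross2_linear(1) bounded_linear.linear[OF bounded_linear_vec_nth]] by (simp add: o_def)
  from linear_ix_expansion[OF this, of x]
  have "cross2 x (ax n) $ ix i = (\<Sum>k\<in>UNIV. x $ ix k * of_int (X_val k n i))"
    by (simp add: cross2_ax)
  also have "\<dots> = (\<Sum>k\<in>UNIV. if k = xr n i then x $ ix k * of_int (X_val k n i) else 0)"
    by (intro sum.cong refl) (simp add: X_val_eq_0)
  finally show ?thesis by (simp only: sum_idx_delta)
qed

lemma cross2_V7: "cross2 x y \<in> V7"
  by (simp add: cross2_def V7_def)

section \<open>The model bracket paired with a two-form\<close>

context
  fixes t :: "real^8 \<Rightarrow> real^8"
  assumes lint: "linear t" and tV7: "\<And>a. t a \<in> V7"
begin

text \<open>The factor \<open>p0\<close> on basis vectors has a single nonzero component, so the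
  contraction over \<mu> has one term, the one recorded in the list.\<close>

lemma leaf33_sum:
  assumes "length as = 3" "length bs = 3"
  shows "sg s * (\<Sum>\<mu>\<in>UNIV. p0 (bas as 0) (bas as 1) (bas as 2) $ \<mu> *
            q0 t (axis \<mu> 1) (bas bs 0) (bas bs 1) (bas bs 2) $ ix \<nu>) =
     tsum (\<lambda>m j. t (ax m) $ ix j) (leaf33 s \<nu> as bs)"
proof -
  from assms obtain a b c d e f where [simp]: "as = [a, b, c]" "bs = [d, e, f]"
    by (auto simp: length_eq_numeral_iff)
  have P: "p0 (bas as 0) (bas as 1) (bas as 2) $ ix m =
      (if m = xr a (xr b c) then if a = b \<or> a = c \<or> b = c then 0 else sg (Phi_neg a b c) else 0)" for m
    using Phi0_bas[of a b c m] form4_bas[OF is_form_Phi0, of a b c m]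
    by (simp add: p0_def bas_def Phi_val_def sg_def)
  have Q: "q0 t (ax m) (bas bs 0) (bas bs 1) (bas bs 2) $ ix \<nu> =
      (if distinct4 d e f \<nu> then sg (lam4_neg d e f \<nu>) * t (ax m) $ ix (xr d (xr e (xr f \<nu>))) else 0)" for m
    using lam4_0_bas[OF tV7, of "ax m" d e f \<nu>] form4_bas[OF is_form_lam4_0, of "t (ax m)" d e f \<nu>]
    by (simp add: q0_def bas_def)
  have "p0 (bas as 0) (bas as 1) (bas as 2) $ ix m * q0 t (ax m) (bas bs 0) (bas bs 1) (bas bs 2) $ ix \<nu> =
      (if m = xr a (xr b c) then (if a = b \<or> a = c \<or> b = c then 0 else sg (Phi_neg a b c)) *
         (if distinct4 d e f \<nu> then sg (lam4_neg d e f \<nu>) * t (ax m) $ ix (xr d (xr e (xr f \<nu>))) else 0) else 0)" for m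
    unfolding P Q by simp
  then show ?thesis
    unfolding sum_ix by (simp only: sum_idx_delta) (simp add: sg_eq)
qed

lemma leaf4_sum:
  "tsum (\<lambda>m j. t (ax m) $ ix j) (leaf4 s a b c d m) = sg s * q0 t (ax a) (ax b) (ax c) (ax d) $ ix m"
  using lam4_0_bas[OF tV7, of "ax a" b c d m] form4_bas[OF is_form_lam4_0, of "t (ax a)" b c d m]
  by (simp add: q0_def leaf4_def sg_simps flip: mult.assoc)

text \<open>The minus sign is that of the exterior derivative term in the bracket;
  \<open>leaf42\<close> records it by \<open>s = Phi_neg m e f\<close>, the negation of the usual
  product of signs.\<close>

lemma leaf42_sum:
  assumes "length as = 4" "length bs = 2"
  shows "- sg s * (\<Sum>\<mu>\<in>UNIV. (\<Sum>i\<le>3. (-1) ^ i * q0 t (bas as i) (skip i (bas as) 0) (skip i (bas as) 1) (skip i (bas as) 2) $ \<mu>) *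
            p0 (axis \<mu> 1) (bas bs 0) (bas bs 1) $ ix \<nu>) =
     tsum (\<lambda>m j. t (ax m) $ ix j) (leaf42 s \<nu> as bs)"
proof -
  from assms obtain a b c d e f where ab: "as = [a, b, c, d]" "bs = [e, f]"
    by (auto simp: length_eq_numeral_iff)
  have P: "p0 (ax m) (bas bs 0) (bas bs 1) $ ix \<nu> =
      (if m = xr e (xr f \<nu>) then if e = f \<or> e = \<nu> \<or> f = \<nu> then 0 else sg (Phi_neg m e f) else 0)" for m
  proof -
    have "p0 (ax m) (bas bs 0) (bas bs 1) $ ix \<nu> = of_int (Phi_val m e f \<nu>)"
      using Phi0_bas[of m e f \<nu>] form4_bas[OF is_form_Phi0, of m e f \<nu>] by (simp add: p0_def ab bas_def)
    then show ?thesis unfolding Phi_val_swapped by (simp add: of_int_sgi)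
  qed
  have B: "bas as 0 = ax a" "bas as 1 = ax b" "bas as 2 = ax c" "bas as 3 = ax d"
    by (simp_all add: ab bas_def eval_nat_numeral)
  have "(\<Sum>i\<le>3. (-1) ^ i * q0 t (bas as i) (skip i (bas as) 0) (skip i (bas as) 1) (skip i (bas as) 2) $ \<mu>) =
      q0 t (ax a) (ax b) (ax c) (ax d) $ \<mu> - q0 t (ax b) (ax a) (ax c) (ax d) $ \<mu>
      + q0 t (ax c) (ax a) (ax b) (ax d) $ \<mu> - q0 t (ax d) (ax a) (ax b) (ax c) $ \<mu>" for \<mu>
    unfolding sum_atMost_3 skip_simps B by simp
  note S = this
  show ?thesis
    unfolding sum_ix S P if_distrib[of "(*) _"] mult_zero_right sum_idx_delta
    by (simp add: ab leaf4_sum Let_def sg_eq sg_neg algebra_simps del: One_nat_def)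
qed

lemma brk_bas_sum:
  assumes len: "length as = 6"
  shows "sg s * brk p0 (q0 t) (bas as) $ ix \<nu> =
     tsum (\<lambda>m j. t (ax m) $ ix j)
       (concat (map (\<lambda>(s, as, bs). leaf33 s \<nu> as bs) (shuffles_rev s 3 3 (rev as) [] [])) @
        concat (map (\<lambda>(s, as, bs). leaf42 s \<nu> as bs) (shuffles_rev s 4 2 (rev as) [] [])))"
proof -
  let ?f = "\<lambda>m j. t (ax m) $ ix j"
  let ?P3 = "\<lambda>\<mu> u. p0 (u 0) (u 1) (u 2) $ \<mu>" and ?Q3 = "\<lambda>\<mu> u. q0 t (axis \<mu> 1) (u 0) (u 1) (u 2) $ ix \<nu>"
  let ?Q4 = "\<lambda>\<mu> u. \<Sum>i\<le>3. (-1) ^ i * q0 t (u i) (skip i u 0) (skip i u 1) (skip i u 2) $ \<mu>"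
  let ?P2 = "\<lambda>\<mu> u. p0 (axis \<mu> 1) (u 0) (u 1) $ ix \<nu>"
  have F: "is_form 3 (?P3 \<mu>)" "is_form 3 (?Q3 \<mu>)" "is_form 2 (?P2 \<mu>)" for \<mu>
    using is_form_slot4[OF is_form_Phi0] is_form_slot4[OF is_form_lam4_0] is_form_slots14[OF is_form_Phi0]
    by (simp_all add: p0_def q0_def)
  have F4: "is_form 4 (?Q4 \<mu>)" for \<mu>
  proof (rule is_form_alternate_skip[where \<alpha> = "\<lambda>a. lam4_0 (t a)" and w = "axis \<mu> 1"])
    show "linear (\<lambda>a. q0 t a x y z $ \<mu>)" for x y z
      using linear_compose[OF lint lam4_0_linear] by (simp add: q0_def o_def)
  qed (simp_all add: q0_def is_form_lam4_0)
  have len': "length as = 3 + 3" "length as = 4 + 2" using len by simp_all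
  have sw: "(\<Sum>\<mu>\<in>UNIV. \<Sum>x\<leftarrow>xs. h \<mu> x) = (\<Sum>x\<leftarrow>xs. \<Sum>\<mu>\<in>UNIV. h \<mu> x)" for h :: "8 \<Rightarrow> 'x \<Rightarrow> real" and xs
    by (induction xs) (simp_all add: sum.distrib)
  have A: "sg s * (\<Sum>\<mu>\<in>UNIV. wedge 3 3 (?P3 \<mu>) (?Q3 \<mu>) (bas as)) =
     tsum ?f (concat (map (\<lambda>(s, as, bs). leaf33 s \<nu> as bs) (shuffles_rev s 3 3 (rev as) [] [])))"
  proof -
    have "sg s * (\<Sum>\<mu>\<in>UNIV. wedge 3 3 (?P3 \<mu>) (?Q3 \<mu>) (bas as)) =
       (\<Sum>x\<leftarrow>shuffles_rev s 3 3 (rev as) [] []. \<Sum>\<mu>\<in>UNIV. case x of (s, as, bs) \<Rightarrow> sg s * ?P3 \<mu> (bas as) * ?Q3 \<mu> (bas bs))"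
      unfolding sum_distrib_left[of "sg s" _ UNIV] sg_wedge_bas[OF F(1,2) len'(1)] sw ..
    also have "\<dots> = (\<Sum>x\<leftarrow>shuffles_rev s 3 3 (rev as) [] []. tsum ?f (case x of (s, as, bs) \<Rightarrow> leaf33 s \<nu> as bs))"
    proof (rule arg_cong[where f=sum_list], rule map_cong[OF refl])
      fix x assume x: "x \<in> set (shuffles_rev s 3 3 (rev as) [] [])"
      obtain r cs ds where [simp]: "x = (r, cs, ds)" by (cases x)
      have "length cs = 3" "length ds = 3" using shuffles_rev_length[of r cs ds] x len by auto
      from leaf33_sum[OF this, of r \<nu>]
      show "(\<Sum>\<mu>\<in>UNIV. case x of (s, as, bs) \<Rightarrow> sg s * ?P3 \<mu> (bas as) * ?Q3 \<mu> (bas bs)) =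
         tsum ?f (case x of (s, as, bs) \<Rightarrow> leaf33 s \<nu> as bs)"
        by (simp add: sum_distrib_left mult.assoc)
    qed
    finally show ?thesis by (simp add: tsum_concat o_def)
  qed
  have B: "- sg s * (\<Sum>\<mu>\<in>UNIV. wedge 4 2 (?Q4 \<mu>) (?P2 \<mu>) (bas as)) =
     tsum ?f (concat (map (\<lambda>(s, as, bs). leaf42 s \<nu> as bs) (shuffles_rev s 4 2 (rev as) [] [])))"
  proof -
    have "- sg s * (\<Sum>\<mu>\<in>UNIV. wedge 4 2 (?Q4 \<mu>) (?P2 \<mu>) (bas as)) =
       - (\<Sum>x\<leftarrow>shuffles_rev s 4 2 (rev as) [] []. \<Sum>\<mu>\<in>UNIV. case x of (s, as, bs) \<Rightarrow> sg s * ?Q4 \<mu> (bas as) * ?P2 \<mu> (bas bs))"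
      unfolding mult_minus_left sum_distrib_left[of "sg s" "\<lambda>\<mu>. wedge 4 2 (?Q4 \<mu>) (?P2 \<mu>) (bas as)"] sg_wedge_bas[OF F4 F(3) len'(2)] sw ..
    also have "\<dots> = (\<Sum>x\<leftarrow>shuffles_rev s 4 2 (rev as) [] []. - (\<Sum>\<mu>\<in>UNIV. case x of (s, as, bs) \<Rightarrow> sg s * ?Q4 \<mu> (bas as) * ?P2 \<mu> (bas bs)))"
      by (simp add: uminus_sum_list_map o_def)
    also have "\<dots> = (\<Sum>x\<leftarrow>shuffles_rev s 4 2 (rev as) [] []. tsum ?f (case x of (s, as, bs) \<Rightarrow> leaf42 s \<nu> as bs))"
    proof (rule arg_cong[where f=sum_list], rule map_cong[OF refl])
      fix x assume x: "x \<in> set (shuffles_rev s 4 2 (rev as) [] [])"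
      obtain r cs ds where [simp]: "x = (r, cs, ds)" by (cases x)
      have "length cs = 4" "length ds = 2" using shuffles_rev_length[of r cs ds] x len by auto
      from leaf42_sum[OF this, of r \<nu>]
      show "- (\<Sum>\<mu>\<in>UNIV. case x of (s, as, bs) \<Rightarrow> sg s * ?Q4 \<mu> (bas as) * ?P2 \<mu> (bas bs)) =
         tsum ?f (case x of (s, as, bs) \<Rightarrow> leaf42 s \<nu> as bs)"
        unfolding \<open>x = (r, cs, ds)\<close> prod.case mult_minus_left sum_distrib_left[of "sg r" _ UNIV] mult.assoc .
    qed
    finally show ?thesis by (simp add: tsum_concat o_def)
  qed
  show ?thesis
    unfolding brk_component[OF p0_linear q0_linear[OF lint]] right_diff_distrib tsum_simps A[symmetric] B[symmetric]
    by simp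
qed

lemma is_form_brk: "is_form 6 (\<lambda>v. brk p0 (q0 t) v $ \<nu>)"
proof -
  have F: "is_form 3 (\<lambda>u. p0 (u 0) (u 1) (u 2) $ \<mu>)" "is_form 3 (\<lambda>u. q0 t (axis \<mu> 1) (u 0) (u 1) (u 2) $ \<nu>)"
      "is_form 2 (\<lambda>u. p0 (axis \<mu> 1) (u 0) (u 1) $ \<nu>)" for \<mu>
    using is_form_slot4[OF is_form_Phi0] is_form_slot4[OF is_form_lam4_0] is_form_slots14[OF is_form_Phi0]
    by (simp_all add: p0_def q0_def)
  have F4: "is_form 4 (\<lambda>u. \<Sum>i\<le>3. (-1) ^ i * q0 t (u i) (skip i u 0) (skip i u 1) (skip i u 2) $ \<mu>)" for \<mu>
  proof (rule is_form_alternate_skip[where \<alpha> = "\<lambda>a. lam4_0 (t a)" and w = "axis \<mu> 1"])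
    show "linear (\<lambda>a. q0 t a x y z $ \<mu>)" for x y z
      using linear_compose[OF lint lam4_0_linear] by (simp add: q0_def o_def)
  qed (simp_all add: q0_def is_form_lam4_0)
  have "is_form 6 (wedge 3 3 (\<lambda>u. p0 (u 0) (u 1) (u 2) $ \<mu>) (\<lambda>u. q0 t (axis \<mu> 1) (u 0) (u 1) (u 2) $ \<nu>))"
    "is_form 6 (wedge 4 2 (\<lambda>u. \<Sum>i\<le>3. (-1) ^ i * q0 t (u i) (skip i u 0) (skip i u 1) (skip i u 2) $ \<mu>)
        (\<lambda>u. p0 (axis \<mu> 1) (u 0) (u 1) $ \<nu>))" for \<mu>
    using is_form_wedge[OF F(1,2), of \<mu> \<mu>] is_form_wedge[OF F4 F(3), of \<mu> \<mu>] by simp_all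
  then show ?thesis
    unfolding brk_component[OF p0_linear q0_linear[OF lint]] by (intro is_form_diff is_form_sum)
qed

lemma wedge_brk_eq_tsum:
  assumes i: "i \<noteq> I0"
  shows "wedge 6 2 (\<lambda>v. brk p0 (q0 t) v $ ix \<nu>) (lam2_0 (ax i)) (bas idxs) =
     tsum (\<lambda>m j. t (ax m) $ ix j) (brk_leaves \<nu> i)"
proof -
  let ?f = "\<lambda>m j. t (ax m) $ ix j"
  have "wedge 6 2 (\<lambda>v. brk p0 (q0 t) v $ ix \<nu>) (lam2_0 (ax i)) (bas idxs) =
     (\<Sum>(s, as, bs)\<leftarrow>shuffles_rev False 6 2 (rev idxs) [] []. sg s * brk p0 (q0 t) (bas as) $ ix \<nu> * lam2_0 (ax i) (bas bs))"
    by (rule wedge_bas[OF is_form_brk is_form_lam2_0]) (simp add: length_idxs)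
  also have "\<dots> = (\<Sum>x\<leftarrow>shuffles_rev False 6 2 (rev idxs) [] []. tsum ?f (case x of (s, as, bs) \<Rightarrow> leaf62 s \<nu> i as bs))"
  proof (rule arg_cong[where f=sum_list], rule map_cong[OF refl])
    fix x assume x: "x \<in> set (shuffles_rev False 6 2 (rev idxs) [] [])"
    obtain s as bs where [simp]: "x = (s, as, bs)" by (cases x)
    have len: "length as = 6" "length bs = 2" using shuffles_rev_length[of s as bs] x by (auto simp: length_idxs)
    then obtain p q where bs: "bs = [p, q]" by (auto simp: length_eq_numeral_iff)
    have l2: "lam2_0 (ax i) (bas bs) = (if p = q \<or> xr p q \<noteq> i then 0 else sg (lam2_neg p q))"
      using lam2_0_bas[of "ax i" p q] i by (simp add: ax_V7 bs ax_component)
    show "(case x of (s, as, bs) \<Rightarrow> sg s * brk p0 (q0 t) (bas as) $ ix \<nu> * lam2_0 (ax i) (bas bs)) =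
        tsum ?f (case x of (s, as, bs) \<Rightarrow> leaf62 s \<nu> i as bs)"
    proof (cases "p = q \<or> xr p q \<noteq> i")
      case True
      then show ?thesis using l2 by (simp add: bs)
    next
      case False
      have "sg s * brk p0 (q0 t) (bas as) $ ix \<nu> * lam2_0 (ax i) (bas bs) =
          sg (s \<noteq> lam2_neg p q) * brk p0 (q0 t) (bas as) $ ix \<nu>"
        unfolding l2 if_not_P[OF False] sg_simps(3)[symmetric] by simp
      also have "\<dots> = tsum ?f (leaf62 s \<nu> i as bs)"
        unfolding brk_bas_sum[OF len(1)] bs leaf62.simps if_not_P[OF False] Let_def ..
      finally show ?thesis by simp
    qed
  qed
  finally show ?thesis by (simp add: brk_leaves_def tsum_concat o_def)
qed

lemma contr_ix: "contr t $ ix d = (\<Sum>j\<in>UNIV. of_int (X_val d (xr j d) j) * t (ax (xr j d)) $ ix j)"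
proof -
  have "contr t $ ix d = (\<Sum>m\<in>UNIV. \<Sum>j\<in>UNIV. of_int (X_val d m j) * t (ax m) $ ix j)"
    by (simp add: contr_def sum_ix inner_ix cross2_ax)
  also have "\<dots> = (\<Sum>j\<in>UNIV. \<Sum>m\<in>UNIV. if m = xr j d then of_int (X_val d m j) * t (ax m) $ ix j else 0)"
    by (subst sum.swap) (intro sum.cong refl, simp add: X_val_eq_0)
  finally show ?thesis by (simp only: sum_idx_delta)
qed

lemma wedge_brk_ax:
  assumes i: "i \<noteq> I0"
  shows "wedge 6 2 (\<lambda>v. brk p0 (q0 t) v $ ix n) (lam2_0 (ax i)) (bas idxs) =
     -12 * t (ax n) $ ix i - 4 * cross2 (contr t) (ax n) $ ix i"
proof -
  let ?d = "xr n i"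
  note C = mp[OF all_idxD[OF all_idxD[OF brk_leaves_correct, of n], of i] i, unfolded Let_def]
  have co: "of_int (leaf_coeff (brk_leaves n i) j) * t (ax (xr j ?d)) $ ix j =
      (if j = i then -12 * t (ax (xr i ?d)) $ ix i else 0)
      - 4 * (of_int (X_val ?d n i) * (of_int (X_val ?d (xr j ?d) j) * t (ax (xr j ?d)) $ ix j))" for j
  \<comment> \<open>The coefficients with \<open>j = I0\<close> were not checked; they multiply a
    component of \<open>t\<close> that is 0.\<close>
  proof (cases "j = I0")
    case True
    then have "t (ax (xr j ?d)) $ ix j = 0" using V7_component[OF tV7] by simp
    then show ?thesis using True i by simp
  next
    case False
    have lc: "leaf_coeff (brk_leaves n i) j = (if j = i then -12 else 0) - 4 * (X_val ?d n i * X_val ?d (xr j ?d) j)"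
      using mp[OF all_idxD[OF conjunct2[OF C], of j] False] .
    show ?thesis unfolding lc by (cases "j = i") (simp_all add: algebra_simps)
  qed
  have "wedge 6 2 (\<lambda>v. brk p0 (q0 t) v $ ix n) (lam2_0 (ax i)) (bas idxs) =
      (\<Sum>j\<in>UNIV. of_int (leaf_coeff (brk_leaves n i) j) * t (ax (xr j ?d)) $ ix j)"
    unfolding wedge_brk_eq_tsum[OF i] by (rule tsum_eq_leaf_coeff[OF conjunct1[OF C]])
  also have "\<dots> = -12 * t (ax (xr i ?d)) $ ix i - 4 * (of_int (X_val ?d n i) * contr t $ ix ?d)"
    unfolding co contr_ix sum_subtractf sum_idx_delta sum_distrib_left ..
  also have "xr i ?d = n" by (metis xr_cancel xr_commute)
  finally show ?thesis by (simp add: cross2_contr_ix)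
qed

text \<open>Compared with the pairing in \<open>wedge_wedge_lam2_0\<close>, half the bracket has the
  \<open>V7\<close>-component \<open>- t - (1/3) *\<^sub>R cross2 (contr t)\<close> in each
  direction.\<close>

lemma wedge_brk_lam2_0:
  assumes b: "b \<in> V7"
  shows "wedge 6 2 (\<lambda>v. brk p0 (q0 t) v $ \<nu>) (lam2_0 b) (bas idxs) =
     -12 * (t (axis \<nu> 1) \<bullet> b) - 4 * (cross2 (contr t) (axis \<nu> 1) \<bullet> b)"
proof -
  obtain n where n: "\<nu> = ix n" using bij_ix by (metis bij_pointE)
  let ?W = "\<lambda>b. wedge 6 2 (\<lambda>v. brk p0 (q0 t) v $ \<nu>) (lam2_0 b) (bas idxs)"
  have "linear ?W" by (rule wedge_linear_right) (rule lam2_0_linear)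
  then have "?W b = (\<Sum>j\<in>UNIV. b $ ix j * ?W (ax j))" by (rule linear_ix_expansion)
  also have "\<dots> = (\<Sum>j\<in>UNIV. -12 * (t (ax n) $ ix j * b $ ix j) - 4 * (cross2 (contr t) (ax n) $ ix j * b $ ix j))"
  proof (rule sum.cong[OF refl])
    fix j
    show "b $ ix j * ?W (ax j) = -12 * (t (ax n) $ ix j * b $ ix j) - 4 * (cross2 (contr t) (ax n) $ ix j * b $ ix j)"
    proof (cases "j = I0")
      case True
      then have "b $ ix j = 0" using V7_component[OF b] by simp
      then show ?thesis by simp
    next
      case False
      show ?thesis unfolding n wedge_brk_ax[OF False] by (simp add: algebra_simps)
    qed
  qed
  also have "\<dots> = -12 * (t (ax n) \<bullet> b) - 4 * (cross2 (contr t) (ax n) \<bullet> b)"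
    unfolding inner_ix sum_subtractf sum_distrib_left ..
  finally show ?thesis by (simp add: n)
qed

end

text \<open>The pairing restricted to the 7-dimensional summand is a multiple of the inner product.
  It is thus nondegenerate there, so a component in that summand can be recovered from its
  pairings.\<close>

lemma wedge_wedge_lam2_0:
  assumes a: "a \<in> V7" and b: "b \<in> V7"
  shows "wedge 6 2 (wedge 4 2 Phi0 (lam2_0 a)) (lam2_0 b) (bas idxs) = 12 * (a \<bullet> b)"
proof -
  let ?f = "\<lambda>i j. a $ ix i * b $ ix j"
  let ?g = "\<lambda>s as qs. \<lambda>(r, bs, ps). case (bs, ps, qs) of ([a, b, c, d], [e, f], [p, q]) \<Rightarrow>
       if Phi_val a b c d = 0 \<or> e = f \<or> p = q then []
       else [(s \<noteq> (r \<noteq> (Phi_neg a b c \<noteq> (lam2_neg e f \<noteq> lam2_neg p q))), xr e f, xr p q)]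
     | _ \<Rightarrow> []"
  have F: "is_form 6 (wedge 4 2 Phi0 (lam2_0 a))"
    using is_form_wedge[OF is_form_Phi0 is_form_lam2_0] by simp
  have "wedge 6 2 (wedge 4 2 Phi0 (lam2_0 a)) (lam2_0 b) (bas idxs) =
     (\<Sum>(s, as, qs)\<leftarrow>shuffles_rev False 6 2 (rev idxs) [] []. sg s * wedge 4 2 Phi0 (lam2_0 a) (bas as) * lam2_0 b (bas qs))"
    by (rule wedge_bas[OF F is_form_lam2_0]) (simp add: length_idxs)
  also have "\<dots> = (\<Sum>x\<leftarrow>shuffles_rev False 6 2 (rev idxs) [] []. tsum ?f (case x of (s, as, qs) \<Rightarrow>
      concat (map (?g s as qs) (shuffles_rev False 4 2 (rev as) [] []))))"
  proof (rule arg_cong[where f=sum_list], rule map_cong[OF refl])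
    fix x assume x: "x \<in> set (shuffles_rev False 6 2 (rev idxs) [] [])"
    obtain s as qs where X: "x = (s, as, qs)" by (cases x)
    have len: "length as = 6" "length qs = 2" using shuffles_rev_length[of s as qs] x X by (auto simp: length_idxs)
    have "wedge 4 2 Phi0 (lam2_0 a) (bas as) =
      (\<Sum>(r, bs, ps)\<leftarrow>shuffles_rev False 4 2 (rev as) [] []. sg r * Phi0 (bas bs) * lam2_0 a (bas ps))"
      by (rule wedge_bas[OF is_form_Phi0 is_form_lam2_0]) (simp add: len)
    then have "sg s * wedge 4 2 Phi0 (lam2_0 a) (bas as) * lam2_0 b (bas qs) =
      (\<Sum>y\<leftarrow>shuffles_rev False 4 2 (rev as) [] []. sg s * (case y of (r, bs, ps) \<Rightarrow> sg r * Phi0 (bas bs) * lam2_0 a (bas ps)) * lam2_0 b (bas qs))"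
      by (simp only: sum_list_const_mult sum_list_mult_const)
    also have "\<dots> = (\<Sum>y\<leftarrow>shuffles_rev False 4 2 (rev as) [] []. tsum ?f (?g s as qs y))"
    proof (rule arg_cong[where f=sum_list], rule map_cong[OF refl])
      fix y assume y: "y \<in> set (shuffles_rev False 4 2 (rev as) [] [])"
      obtain r bs ps where Y: "y = (r, bs, ps)" by (cases y)
      have "length bs = 4" "length ps = 2" using shuffles_rev_length[of r bs ps] y Y len by auto
      then obtain a' b' c d e f p q where l: "bs = [a', b', c, d]" "ps = [e, f]" "qs = [p, q]"
        using len(2) unfolding length_eq_numeral_iff by blast
      have P: "Phi0 (bas bs) = (if Phi_val a' b' c d = 0 then 0 else sg (Phi_neg a' b' c))"
        unfolding l Phi0_bas by (auto simp: Phi_val_def sg_def)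
      show "sg s * (case y of (r, bs, ps) \<Rightarrow> sg r * Phi0 (bas bs) * lam2_0 a (bas ps)) * lam2_0 b (bas qs) = tsum ?f (?g s as qs y)"
        unfolding Y prod.case P unfolding l lam2_0_bas[OF a] lam2_0_bas[OF b]
        by (simp add: sg_eq sg_neg)
    qed
    finally show "(case x of (s, as, qs) \<Rightarrow> sg s * wedge 4 2 Phi0 (lam2_0 a) (bas as) * lam2_0 b (bas qs)) =
       tsum ?f (case x of (s, as, qs) \<Rightarrow> concat (map (?g s as qs) (shuffles_rev False 4 2 (rev as) [] [])))"
      by (simp add: X tsum_concat o_def)
  qed
  also have "\<dots> = tsum ?f wedge_leaves"
    unfolding wedge_leaves_def by (simp add: tsum_concat o_def)
  also have "\<dots> = (\<Sum>j\<in>UNIV. of_int (leaf_coeff wedge_leaves j) * ?f j j)"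
    using wedge_leaves_correct by (intro tsum_eq_leaf_coeff) (simp add: Let_def)
  also have "\<dots> = (\<Sum>j\<in>UNIV. 12 * (a $ ix j * b $ ix j))"
  proof (rule sum.cong[OF refl])
    fix j
    show "of_int (leaf_coeff wedge_leaves j) * ?f j j = 12 * (a $ ix j * b $ ix j)"
    proof (cases "j = I0")
      case True
      then have "a $ ix j = 0" using V7_component[OF a] by simp
      then show ?thesis by simp
    next
      case False
      then have "leaf_coeff wedge_leaves j = 12"
        using wedge_leaves_correct all_idxD[of "\<lambda>j. j \<noteq> I0 \<longrightarrow> leaf_coeff wedge_leaves j = 12" j] by (simp add: Let_def)
      then show ?thesis by simp
    qed
  qed
  finally show ?thesis unfolding inner_ix sum_distrib_left .
qed

section \<open>Change of frame\<close>

lemma frame_inverse: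
  fixes U :: "real^'n^'n"
  assumes "det U \<noteq> 0"
  shows "U ** matrix_inv U = mat 1" "matrix_inv U ** U = mat 1"
    "U *v (matrix_inv U *v x) = x" "matrix_inv U *v (U *v x) = x"
proof -
  have "invertible U" using assms by (simp add: invertible_det_nz)
  then have "U ** matrix_inv U = mat 1 \<and> matrix_inv U ** U = mat 1"
    unfolding invertible_def matrix_inv_def by (rule someI_ex)
  then show *: "U ** matrix_inv U = mat 1" "matrix_inv U ** U = mat 1" by auto
  show "U *v (matrix_inv U *v x) = x" "matrix_inv U *v (U *v x) = x"
    by (simp_all add: matrix_vector_mul_assoc *)
qed

lemma matrix_vector_linear: "linear (\<lambda>x. (M :: real^'n^'m) *v x)"
  by (rule matrix_vector_mul_linear)

lemma wedge_in_frame: "wedge k l (in_frame U \<alpha>) (in_frame U \<beta>) = in_frame U (wedge k l \<alpha> \<beta>)"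
  by (rule ext) (simp add: wedge_def in_frame_def)

lemma is_form_linear_image:
  assumes f: "is_form k \<alpha>" and L: "linear L"
  shows "is_form k (\<lambda>v. \<alpha> (\<lambda>i. L (v i)))"
proof (rule is_formI)
  fix v w :: "nat \<Rightarrow> real^'b" assume "\<And>i. i < k \<Longrightarrow> v i = w i"
  then show "\<alpha> (\<lambda>i. L (v i)) = \<alpha> (\<lambda>i. L (w i))" by (intro is_form_cong[OF f]) simp
next
  fix v :: "nat \<Rightarrow> real^'b" and i assume i: "i < k"
  have "(\<lambda>j. L ((v(i := y)) j)) = (\<lambda>j. L (v j))(i := L y)" for y by auto
  then show "linear (\<lambda>y. \<alpha> (\<lambda>j. L ((v(i := y)) j)))"
    using linear_compose[OF L is_form_linear[OF f i]] by (simp add: o_def)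
next
  fix v :: "nat \<Rightarrow> real^'b" and i j assume "i < k" "j < k" "i \<noteq> j" "v i = v j"
  then show "\<alpha> (\<lambda>i. L (v i)) = 0" by (intro is_form_eq_0[OF f, of i j]) auto
qed

lemma is_form_in_frame: "is_form k \<alpha> \<Longrightarrow> is_form k (in_frame U \<alpha>)"
  unfolding in_frame_def[abs_def] by (rule is_form_linear_image) (simp_all add: matrix_vector_linear)

lemma in_frame_apply: "det U \<noteq> 0 \<Longrightarrow> in_frame U \<alpha> (\<lambda>i. U *v v i) = \<alpha> v"
  by (simp add: in_frame_def frame_inverse)

lemma in_frame_inject:
  assumes "det U \<noteq> 0" "in_frame U \<alpha> = in_frame U \<beta>" shows "\<alpha> = \<beta>"
  using in_frame_apply[OF assms(1), of \<alpha>] in_frame_apply[OF assms(1), of \<beta>] assms(2) by (intro ext) simp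

lemma matrix_inv_mult:
  fixes U G :: "real^'n^'n"
  assumes "det U \<noteq> 0" "det G \<noteq> 0" shows "matrix_inv (U ** G) = matrix_inv G ** matrix_inv U"
proof -
  have d: "det (U ** G) \<noteq> 0" using assms by (simp add: det_mul)
  have "(matrix_inv G ** matrix_inv U) ** (U ** G) = matrix_inv G ** (matrix_inv U ** U) ** G"
    by (simp add: matrix_mul_assoc)
  then have "(matrix_inv G ** matrix_inv U) ** (U ** G) = mat 1"
    using assms by (simp add: frame_inverse)
  then have "(matrix_inv G ** matrix_inv U) ** ((U ** G) ** matrix_inv (U ** G)) = matrix_inv (U ** G)"
    by (simp add: matrix_mul_assoc)
  then show ?thesis using frame_inverse(1)[OF d] by simp
qed

lemma in_frame_mult:
  assumes "det U \<noteq> 0" "det G \<noteq> 0" shows "in_frame (U ** G) \<alpha> = in_frame U (in_frame G \<alpha>)"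
  by (rule ext) (simp add: in_frame_def matrix_inv_mult[OF assms] matrix_vector_mul_assoc)

lemma det_matrix_inv_pos:
  fixes U :: "real^'n^'n"
  assumes "det U > 0" shows "det (matrix_inv U) > 0"
proof -
  have "det U * det (matrix_inv U) = 1"
    using assms frame_inverse(1)[of U] det_mul[of U "matrix_inv U"] by simp
  then show ?thesis using assms by (metis zero_less_mult_pos zero_less_one)
qed

section \<open>The two-fold cross product with values in \<open>V7\<close>\<close>

lemma cross2_basis_identity:
  "all_idx (\<lambda>a. all_idx (\<lambda>b. all_idx (\<lambda>c. all_idx (\<lambda>d.
     (if a \<noteq> b \<and> c \<noteq> d \<and> xr a b = xr c d then if lam2_neg a b = lam2_neg c d then 1 else -1 else 0) =
     (if a = c \<and> b = d then 1 else 0) - (if a = d \<and> b = c then 1 else 0) + Phi_val a b c d))))"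
  by code_simp

lemma linear_eq_if_eq_on_axis:
  fixes f g :: "real^8 \<Rightarrow> real"
  assumes "linear f" "linear g" "\<And>a. f (ax a) = g (ax a)" shows "f x = g x"
  using linear_ix_expansion[OF assms(1), of x] linear_ix_expansion[OF assms(2), of x] assms(3) by simp

lemma linear_inner_left: "linear f \<Longrightarrow> linear (\<lambda>x. f x \<bullet> (y::'b::real_inner))"
  by (rule linearI) (simp_all add: linear_add linear_cmul inner_add_left)

lemma linear_inner_right: "linear f \<Longrightarrow> linear (\<lambda>x. (y::'b::real_inner) \<bullet> f x)"
  by (rule linearI) (simp_all add: linear_add linear_cmul inner_add_right)

text \<open>The key identity: inner products of cross products are expressed by the metric and
  \<Phi> alone. An orthogonal map that preserves \<Phi> therefore preserves them, which yields its
  action on \<open>V7\<close> without a description of the group.\<close>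

lemma cross2_inner:
  "cross2 x y \<bullet> cross2 z w = (x \<bullet> z) * (y \<bullet> w) - (x \<bullet> w) * (y \<bullet> z) + Phi0 (seq4 x y z w)"
proof -
  note L = form4_linear[OF is_form_Phi0]
  let ?R = "\<lambda>x y z w. (x \<bullet> z) * (y \<bullet> w) - (x \<bullet> w) * (y \<bullet> z) + Phi0 (seq4 x y z w)"
  have R: "linear (\<lambda>x. ?R x y z w)" "linear (\<lambda>y. ?R x y z w)" "linear (\<lambda>z. ?R x y z w)" "linear (\<lambda>w. ?R x y z w)" for x y z w
    by (rule linearI; simp add: inner_add_left inner_add_right linear_add[OF L(1)] linear_add[OF L(2)]
        linear_add[OF L(3)] linear_add[OF L(4)] linear_cmul[OF L(1)] linear_cmul[OF L(2)] linear_cmul[OF L(3)]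
        linear_cmul[OF L(4)] algebra_simps)+
  have "cross2 (ax a) (ax b) \<bullet> cross2 (ax c) (ax d) =
      (ax a \<bullet> ax c) * (ax b \<bullet> ax d) - (ax a \<bullet> ax d) * (ax b \<bullet> ax c) + Phi0 (seq4 (ax a) (ax b) (ax c) (ax d))" for a b c d
  proof -
    have "cross2 (ax a) (ax b) \<bullet> cross2 (ax c) (ax d) =
       (\<Sum>j\<in>UNIV. if j = xr a b then (if a \<noteq> b \<and> c \<noteq> d \<and> xr a b = xr c d then sg (lam2_neg a b) * sg (lam2_neg c d) else 0) else 0)"
      unfolding inner_ix cross2_ax by (rule sum.cong) (auto simp: X_val_def of_int_sgi)
    also have "\<dots> = of_int (if a \<noteq> b \<and> c \<noteq> d \<and> xr a b = xr c d then if lam2_neg a b = lam2_neg c d then 1 else -1 else 0)"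
      unfolding sum_idx_delta by (simp add: sg_def)
    also have "\<dots> = of_int ((if a = c \<and> b = d then 1 else 0) - (if a = d \<and> b = c then 1 else 0) + Phi_val a b c d)"
      using all_idxD[OF all_idxD[OF all_idxD[OF all_idxD[OF cross2_basis_identity, of a], of b], of c], of d] by simp
    finally show ?thesis
      unfolding form4_bas[OF is_form_Phi0, symmetric] Phi0_bas by (simp add: inner_axis_axis)
  qed
  then have "cross2 (ax a) (ax b) \<bullet> cross2 (ax c) w = ?R (ax a) (ax b) (ax c) w" for a b c w
    by (rule linear_eq_if_eq_on_axis[OF linear_inner_right[OF cross2_linear(2)] R(4)])
  then have "cross2 (ax a) (ax b) \<bullet> cross2 z w = ?R (ax a) (ax b) z w" for a b z w
    by (rule linear_eq_if_eq_on_axis[OF linear_inner_right[OF cross2_linear(1)] R(3)])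
  then have "cross2 (ax a) y \<bullet> cross2 z w = ?R (ax a) y z w" for a y z w
    by (rule linear_eq_if_eq_on_axis[OF linear_inner_left[OF cross2_linear(2)] R(2)])
  then show ?thesis
    by (rule linear_eq_if_eq_on_axis[OF linear_inner_left[OF cross2_linear(1)] R(1)])
qed

lemma lam2_0_eq_cross2:
  assumes b: "b \<in> V7" shows "lam2_0 b v = cross2 (v 0) (v 1) \<bullet> b"
proof -
  have "lam2_0 b v = lam2_0 b (seq2 (v 0) (v 1))" by (rule form2_seq2) (rule is_form_lam2_0)
  also have "\<dots> = (\<Sum>\<kappa>\<in>UNIV. b $ \<kappa> * lam2_0 (axis \<kappa> 1) (seq2 (v 0) (v 1)))"
    by (subst linear_axis_expansion[OF lam2_0_linear]) simp
  also have "\<dots> = cross2 (v 0) (v 1) \<bullet> b"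
    unfolding inner_vec_def using V7_component[OF b] by (intro sum.cong) (auto simp: cross2_def)
  finally show ?thesis .
qed

text \<open>Every vector of \<open>V7\<close> is thereby a cross product, so statements on cross
  products cover all of \<open>V7\<close>.\<close>

lemma cross2_e0: assumes b: "b \<in> V7" shows "cross2 (axis 0 1) b = b"
proof -
  have "cross2 (axis 0 1) b $ ix j = b $ ix j" for j
  proof -
    have lin: "linear (\<lambda>b. cross2 (ax I0) b $ ix j)"
      using linear_compose[OF cross2_linear(2) bounded_linear.linear[OF bounded_linear_vec_nth]] by (simp add: o_def)
    have X: "X_val I0 b j = (if b \<noteq> I0 \<and> j = b then 1 else 0)" for b
      by (cases b) (auto simp: X_val_def lam2_neg_def sgi_def)
    have "cross2 (ax I0) b $ ix j = (\<Sum>k\<in>UNIV. if k = j then b $ ix j else 0)"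
      unfolding linear_ix_expansion[OF lin, of b] cross2_ax X
    proof (rule sum.cong[OF refl])
      fix k
      have "b $ ix I0 = 0" using V7_component[OF b] by simp
      then show "b $ ix k * of_int (if k \<noteq> I0 \<and> j = k then 1 else 0) = (if k = j then b $ ix j else 0)"
        by (cases "k = I0") auto
    qed
    then show ?thesis by (simp add: sum_idx_delta)
  qed
  then show ?thesis using forall_8_ix[of "\<lambda>\<mu>. cross2 (axis 0 1) b $ \<mu> = b $ \<mu>"] by (simp add: vec_eq_iff)
qed

lemma V7_diff: "a \<in> V7 \<Longrightarrow> b \<in> V7 \<Longrightarrow> a - b \<in> V7"
  and V7_add: "a \<in> V7 \<Longrightarrow> b \<in> V7 \<Longrightarrow> a + b \<in> V7"
  and V7_scale: "a \<in> V7 \<Longrightarrow> r *\<^sub>R a \<in> V7"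
  and V7_0: "0 \<in> V7"
  by (simp_all add: V7_def)

lemma V7_sum: "(\<And>i. i \<in> I \<Longrightarrow> f i \<in> V7) \<Longrightarrow> sum f I \<in> V7"
  by (induction I rule: infinite_finite_induct) (auto simp: V7_0 V7_add)

lemma V7_eqI:
  assumes "a \<in> V7" "b \<in> V7" "\<And>c. c \<in> V7 \<Longrightarrow> a \<bullet> c = b \<bullet> c" shows "a = b"
proof -
  have "(a - b) \<bullet> (a - b) = 0" using assms(3)[OF V7_diff[OF assms(1,2)]] by (simp add: inner_diff_left)
  then show ?thesis by simp
qed

lemma lam2_0_inject:
  assumes "a \<in> V7" "b \<in> V7" "lam2_0 a = lam2_0 b" shows "a = b"
proof (rule V7_eqI[OF assms(1,2)])
  fix c assume c: "c \<in> V7"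
  have "lam2_0 a (seq2 (axis 0 1) c) = lam2_0 b (seq2 (axis 0 1) c)" by (simp add: assms(3))
  then show "a \<bullet> c = b \<bullet> c"
    using lam2_0_eq_cross2[OF assms(1), of "seq2 (axis 0 1) c"] lam2_0_eq_cross2[OF assms(2), of "seq2 (axis 0 1) c"]
    by (simp add: seq2_def cross2_e0[OF c] inner_commute)
qed

lemma Phi0_seq4_eq_0: "Phi0 (seq4 x y z y) = 0"
  by (rule form4_eq_0[OF is_form_Phi0])

lemma sum_inner_axis: "(\<Sum>\<mu>\<in>UNIV. (a \<bullet> axis \<mu> 1) * (b \<bullet> axis \<mu> 1)) = a \<bullet> (b :: real^'n)"
  by (simp add: inner_axis inner_vec_def[of a b])

text \<open>J^T J = 7: in the trace of \<open>cross2_inner\<close> the term with \<Phi> drops out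
  for its repeated argument, and the others leave 8 - 1.\<close>

lemma sum_cross2_inner: "(\<Sum>\<mu>\<in>UNIV. cross2 a (axis \<mu> 1) \<bullet> cross2 b (axis \<mu> 1)) = 7 * (a \<bullet> b)"
proof -
  have "(\<Sum>\<mu>\<in>UNIV. cross2 a (axis \<mu> 1) \<bullet> cross2 b (axis \<mu> 1)) =
      (\<Sum>\<mu>\<in>UNIV. (a \<bullet> b) - (a \<bullet> axis \<mu> 1) * (b \<bullet> axis \<mu> (1::real)))"
    unfolding cross2_inner Phi0_seq4_eq_0 by (rule sum.cong) (simp_all add: inner_axis_axis inner_commute)
  also have "\<dots> = 8 * (a \<bullet> b) - a \<bullet> b"
    unfolding sum_subtractf sum_inner_axis by simp
  finally show ?thesis by simp
qed

lemma contr_inner: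
  "contr \<tau> \<bullet> a = (\<Sum>\<mu>\<in>UNIV. cross2 a (axis \<mu> 1) \<bullet> \<tau> (axis \<mu> 1))"
proof -
  have lin: "linear (\<lambda>a. \<Sum>\<mu>\<in>UNIV. cross2 a (axis \<mu> 1) \<bullet> \<tau> (axis \<mu> 1))"
    by (intro linear_compose_sum ballI linear_inner_left cross2_linear)
  show ?thesis
    unfolding linear_axis_expansion[OF lin, of a] by (simp add: contr_def inner_vec_def mult.commute)
qed

lemma contr_cross2: "contr (cross2 a) = 7 *\<^sub>R a"
proof -
  have "contr (cross2 a) \<bullet> b = (7 *\<^sub>R a) \<bullet> b" for b
    unfolding contr_inner sum_cross2_inner by (simp add: inner_commute)
  then show ?thesis by (metis vector_eq_rdot)
qed

lemma contr_diff: "contr (\<lambda>y. \<sigma> y - \<tau> y) = contr \<sigma> - contr \<tau>"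
  and contr_scale: "contr (\<lambda>y. r *\<^sub>R \<sigma> y) = r *\<^sub>R contr \<sigma>"
  by (simp_all add: contr_def vec_eq_iff inner_diff_right sum_subtractf sum_distrib_left)

text \<open>The action made explicit: \<open>a\<close> is the cross product of the basis vector 0
  with \<open>a\<close>, and \<open>G\<close> is applied to both factors.\<close>

definition rot7 :: "real^8^8 \<Rightarrow> real^8 \<Rightarrow> real^8" where
  "rot7 G a = cross2 (G *v axis 0 1) (G *v a)"

lemma rot7_V7: "rot7 G a \<in> V7"
  by (simp add: rot7_def cross2_V7)

lemma rot7_linear: "linear (rot7 G)"
  using linear_compose[OF matrix_vector_linear cross2_linear(2)] by (simp add: rot7_def[abs_def] o_def)

text \<open>
  Orthogonality of the stabilizer of \<open>Phi0\<close> is not proved in the model: it follows from the existence of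
  a metric for which all \<open>Spin(7)\<close>-frames are orthonormal.
\<close>

context
  fixes G :: "real^8^8"
  assumes inv: "\<And>x y z w. Phi0 (seq4 (G *v x) (G *v y) (G *v z) (G *v w)) = Phi0 (seq4 x y z w)"
    and orth: "\<And>x y. (G *v x) \<bullet> (G *v y) = x \<bullet> y"
begin

lemma cross2_inner_invariant:
  "cross2 (G *v x) (G *v y) \<bullet> cross2 (G *v z) (G *v w) = cross2 x y \<bullet> cross2 z w"
  unfolding cross2_inner inv orth ..

text \<open>The difference of the two sides has square norm 0, since the three inner products in its
  expansion all equal the square norm of \<open>cross2 x y\<close>.\<close>

lemma cross2_equivariant: "cross2 (G *v x) (G *v y) = rot7 G (cross2 x y)"
proof -
  let ?z = "cross2 x y"
  let ?A = "cross2 (G *v x) (G *v y)" and ?B = "cross2 (G *v axis 0 1) (G *v ?z)"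
  have "(?A - ?B) \<bullet> (?A - ?B) = ?A \<bullet> ?A - 2 * (?A \<bullet> ?B) + ?B \<bullet> ?B"
    by (simp add: inner_diff_left inner_diff_right inner_commute)
  also have "\<dots> = 0"
    unfolding cross2_inner_invariant cross2_e0[OF cross2_V7] by simp
  finally show ?thesis by (simp add: rot7_def)
qed

lemma rot7_inner:
  assumes "a \<in> V7" "b \<in> V7" shows "rot7 G a \<bullet> rot7 G b = a \<bullet> b"
  unfolding rot7_def cross2_inner_invariant cross2_e0[OF assms(1)] cross2_e0[OF assms(2)] ..

lemma in_frame_lam2_0:
  assumes a: "a \<in> V7" and G: "det G \<noteq> 0"
  shows "in_frame G (lam2_0 a) = lam2_0 (rot7 G a)"
proof
  fix v :: "nat \<Rightarrow> real^8"
  let ?x = "matrix_inv G *v v 0" and ?y = "matrix_inv G *v v 1"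
  have "in_frame G (lam2_0 a) v = cross2 ?x ?y \<bullet> a"
    unfolding in_frame_def lam2_0_eq_cross2[OF a] ..
  also have "\<dots> = rot7 G (cross2 ?x ?y) \<bullet> rot7 G a" by (simp add: rot7_inner[OF cross2_V7 a])
  also have "rot7 G (cross2 ?x ?y) = cross2 (v 0) (v 1)"
    unfolding cross2_equivariant[symmetric] by (simp add: frame_inverse[OF G])
  finally show "in_frame G (lam2_0 a) v = lam2_0 (rot7 G a) v"
    unfolding lam2_0_eq_cross2[OF rot7_V7] .
qed

lemma rho7_eq_rot7:
  assumes a: "a \<in> V7" and G: "det G \<noteq> 0"
  shows "rho7 G a = rot7 G a"
  unfolding rho7_def
proof (rule the_equality)
  show "rot7 G a \<in> V7 \<and> lam2_0 (rot7 G a) = in_frame G (lam2_0 a)"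
    by (simp add: rot7_V7 in_frame_lam2_0[OF assms])
  show "b = rot7 G a" if "b \<in> V7 \<and> lam2_0 b = in_frame G (lam2_0 a)" for b
    using that in_frame_lam2_0[OF assms] lam2_0_inject rot7_V7 by metis
qed

lemma rot7_mult: "rot7 (G ** K) a = rot7 G (rot7 K a)"
proof -
  have "rot7 (G ** K) a = cross2 (G *v (K *v axis 0 1)) (G *v (K *v a))"
    by (simp add: rot7_def matrix_vector_mul_assoc)
  then show ?thesis unfolding cross2_equivariant by (simp add: rot7_def)
qed

end

lemma rot7_id: "a \<in> V7 \<Longrightarrow> rot7 (mat 1) a = a"
  by (simp add: rot7_def cross2_e0)

section \<open>The bundles at a point\<close>

lemma linear_fun_eq_on_axes:
  fixes f g :: "real^'n \<Rightarrow> 'b::real_vector"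
  assumes "linear f" "linear g" "\<And>\<mu>. f (axis \<mu> 1) = g (axis \<mu> 1)" shows "f x = g x"
  using linear_axis_expansion[OF assms(1), of x] linear_axis_expansion[OF assms(2), of x] assms(3) by simp

lemma sum_less_8_idxs: "(\<Sum>i<8. f (idxs ! i)) = (\<Sum>a\<in>UNIV. f a)"
proof -
  have "bij_betw ((!) idxs) {..<8} UNIV"
    by (rule bij_betw_nth) (simp_all add: length_idxs distinct_idxs)
  then show ?thesis by (rule sum.reindex_bij_betw)
qed

lemma spin7_frame_det: "spin7_frame \<Psi> U \<Longrightarrow> det U > 0" "spin7_frame \<Psi> U \<Longrightarrow> det U \<noteq> 0"
  by (auto simp: spin7_frame_def)

context
  fixes \<Psi> :: "8 form" and h :: "real^8 \<Rightarrow> real^8 \<Rightarrow> real"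
  assumes frames: "\<exists>U. spin7_frame \<Psi> U" and bil: "bilinear h"
    and orthonormal: "\<forall>U. spin7_frame \<Psi> U \<longrightarrow> (\<forall>\<mu> \<nu>. h (column \<mu> U) (column \<nu> U) = (if \<mu> = \<nu> then 1 else 0))"
begin

abbreviation (input) U0 :: "real^8^8" where "U0 \<equiv> some_frame \<Psi>"

section \<open>Frames at a point and their structure group\<close>

lemma U0: "spin7_frame \<Psi> U0"
  unfolding some_frame_def using frames by (rule someI_ex)

lemma U0_inverse: "U0 *v (matrix_inv U0 *v x) = x" "matrix_inv U0 *v (U0 *v x) = x"
  using frame_inverse[of U0] spin7_frame_det(2)[OF U0] by simp_all

lemma h_linear: "linear (h x)" "linear (\<lambda>x. h x y)"
  using bil by (auto simp: bilinear_def)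

lemma frame_isometry:
  assumes "spin7_frame \<Psi> U" shows "h (U *v x) (U *v y) = x \<bullet> y"
proof -
  have l1: "linear (\<lambda>x. h (U *v x) z)" and l2: "linear (\<lambda>y. h z (U *v y))" for z
    using linear_compose[OF matrix_vector_linear h_linear(2)] linear_compose[OF matrix_vector_linear h_linear(1)]
    by (simp_all add: o_def)
  have i1: "linear (\<lambda>x. x \<bullet> (z::real^8))" and i2: "linear (\<lambda>x. (z::real^8) \<bullet> x)" for z
    by (simp_all add: linearI inner_add_left inner_add_right)
  have "h (U *v axis \<mu> 1) (U *v axis \<nu> 1) = axis \<mu> 1 \<bullet> axis \<nu> (1::real)" for \<mu> \<nu>
    using orthonormal assms by (simp add: matrix_vector_mult_basis inner_axis_axis)
  then have "h (U *v axis \<mu> 1) (U *v y) = axis \<mu> 1 \<bullet> y" for \<mu>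
    by (rule linear_fun_eq_on_axes[OF l2 i2])
  then show ?thesis
    by (rule linear_fun_eq_on_axes[OF l1 i1])
qed

lemma group_D:
  assumes "G \<in> spin7_group"
  shows "det G > 0" "det G \<noteq> 0" "Phi0 = in_frame G Phi0"
    "Phi0 (seq4 (G *v x) (G *v y) (G *v z) (G *v w)) = Phi0 (seq4 x y z w)"
proof -
  show "det G > 0" "Phi0 = in_frame G Phi0" using assms by (auto simp: spin7_group_def spin7_frame_def)
  then show d: "det G \<noteq> 0" by simp
  have "seq4 (G *v x) (G *v y) (G *v z) (G *v w) = (\<lambda>i. G *v seq4 x y z w i)"
    by (auto simp: seq4_def)
  then show "Phi0 (seq4 (G *v x) (G *v y) (G *v z) (G *v w)) = Phi0 (seq4 x y z w)"
    using in_frame_apply[OF d, of Phi0 "seq4 x y z w"] \<open>Phi0 = in_frame G Phi0\<close> by simp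
qed

lemma frame_mult_group:
  assumes U: "spin7_frame \<Psi> U" and G: "G \<in> spin7_group" shows "spin7_frame \<Psi> (U ** G)"
proof -
  have "in_frame (U ** G) Phi0 = in_frame U Phi0"
    using in_frame_mult[OF spin7_frame_det(2)[OF U] group_D(2)[OF G], of Phi0] group_D(3)[OF G] by simp
  then show ?thesis using U group_D(1)[OF G] by (simp add: spin7_frame_def det_mul)
qed

lemma frame_quotient:
  assumes U: "spin7_frame \<Psi> U" and V: "spin7_frame \<Psi> V"
  shows "matrix_inv U ** V \<in> spin7_group" "U ** (matrix_inv U ** V) = V"
proof -
  note dU = spin7_frame_det[OF U]
  show e: "U ** (matrix_inv U ** V) = V"
    by (simp add: matrix_mul_assoc frame_inverse(1)[OF dU(2)])
  have d: "det (matrix_inv U ** V) > 0"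
    using det_matrix_inv_pos[OF dU(1)] spin7_frame_det(1)[OF V] by (simp add: det_mul)
  have "in_frame U (in_frame (matrix_inv U ** V) Phi0) = in_frame U Phi0"
    using in_frame_mult[OF dU(2), of "matrix_inv U ** V" Phi0] d U V by (simp add: e spin7_frame_def)
  from in_frame_inject[OF dU(2) this] d show "matrix_inv U ** V \<in> spin7_group"
    by (simp add: spin7_group_def spin7_frame_def)
qed

text \<open>Both \<open>U0\<close> and \<open>U0 ** G\<close> are frames, hence isometries from the
  standard inner product to \<open>h\<close>, and \<open>G\<close> is their quotient.\<close>

lemma group_orthogonal:
  assumes G: "G \<in> spin7_group" shows "(G *v x) \<bullet> (G *v y) = x \<bullet> y"
  using frame_isometry[OF U0, of "G *v x" "G *v y"] frame_isometry[OF frame_mult_group[OF U0 G], of x y]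
  by (simp add: matrix_vector_mul_assoc)

lemmas group_rot7 = cross2_equivariant[OF group_D(4) group_orthogonal]
  rho7_eq_rot7[OF group_D(4) group_orthogonal _ group_D(2)] rot7_mult[OF group_D(4) group_orthogonal]

section \<open>The fibre of the bundle with fibre \<open>V7\<close>\<close>

lemma W7_D:
  assumes "w \<in> W7 \<Psi>"
  shows "\<not> spin7_frame \<Psi> U \<Longrightarrow> w U = 0" "spin7_frame \<Psi> U \<Longrightarrow> w U \<in> V7"
    "spin7_frame \<Psi> U \<Longrightarrow> G \<in> spin7_group \<Longrightarrow> w U = rot7 G (w (U ** G))"
proof -
  show "\<not> spin7_frame \<Psi> U \<Longrightarrow> w U = 0" and V: "spin7_frame \<Psi> U \<Longrightarrow> w U \<in> V7" for U
    using assms by (auto simp: W7_def)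
  assume U: "spin7_frame \<Psi> U" and G: "G \<in> spin7_group"
  then have "w U = rho7 G (w (U ** G))" using assms by (auto simp: W7_def)
  also have "\<dots> = rot7 G (w (U ** G))"
    by (rule group_rot7(2)[OF G G V[OF frame_mult_group[OF U G]] G])
  finally show "w U = rot7 G (w (U ** G))" .
qed

lemma W7_I:
  assumes "\<And>U. \<not> spin7_frame \<Psi> U \<Longrightarrow> w U = 0" "\<And>U. spin7_frame \<Psi> U \<Longrightarrow> w U \<in> V7"
    "\<And>U G. spin7_frame \<Psi> U \<Longrightarrow> G \<in> spin7_group \<Longrightarrow> w U = rot7 G (w (U ** G))"
  shows "w \<in> W7 \<Psi>"
proof -
  have "w U = rho7 G (w (U ** G))" if U: "spin7_frame \<Psi> U" and G: "G \<in> spin7_group" for U G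
    using assms(3)[OF U G] group_rot7(2)[OF G G assms(2)[OF frame_mult_group[OF U G]] G] by simp
  then show ?thesis using assms(1,2) by (auto simp: W7_def)
qed

text \<open>The frames at the point form one orbit of the group, so an equivariant map is determined
  by its value at one of them.\<close>

lemma W7_eqI:
  assumes "w \<in> W7 \<Psi>" "w' \<in> W7 \<Psi>" "w U0 = w' U0" shows "w = w'"
proof
  fix U
  show "w U = w' U"
  proof (cases "spin7_frame \<Psi> U")
    case True
    note q = frame_quotient[OF True U0]
    show ?thesis
      using W7_D(3)[OF assms(1) True q(1)] W7_D(3)[OF assms(2) True q(1)] assms(3) by (simp add: q(2))
  qed (simp add: W7_D(1)[OF assms(1)] W7_D(1)[OF assms(2)])
qed

lemma W7_sum:
  assumes "\<And>i. i \<in> I \<Longrightarrow> a i \<in> W7 \<Psi>" shows "(\<lambda>U. \<Sum>i\<in>I. c i *\<^sub>R a i U) \<in> W7 \<Psi>"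
proof (rule W7_I)
  fix U assume "\<not> spin7_frame \<Psi> U"
  then show "(\<Sum>i\<in>I. c i *\<^sub>R a i U) = 0" using W7_D(1)[OF assms] by (simp add: sum.neutral)
next
  fix U assume "spin7_frame \<Psi> U"
  then show "(\<Sum>i\<in>I. c i *\<^sub>R a i U) \<in> V7" using W7_D(2)[OF assms] by (intro V7_sum V7_scale)
next
  fix U G assume UG: "spin7_frame \<Psi> U" "G \<in> spin7_group"
  show "(\<Sum>i\<in>I. c i *\<^sub>R a i U) = rot7 G (\<Sum>i\<in>I. c i *\<^sub>R a i (U ** G))"
    using W7_D(3)[OF assms UG]
    by (simp add: linear_sum[OF rot7_linear] linear_cmul[OF rot7_linear])
qed

lemma W7_0: "(\<lambda>U. 0) \<in> W7 \<Psi>"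
  using W7_sum[of "{}" undefined undefined] by simp

text \<open>The element represented by \<open>b\<close> in the frame \<open>U0\<close>, carried to
  the other frames by equivariance.\<close>

definition W7_of :: "real^8 \<Rightarrow> w7" where
  "W7_of b U = (if spin7_frame \<Psi> U then rot7 (matrix_inv U ** U0) b else 0)"

lemma W7_of: "W7_of b \<in> W7 \<Psi>"
proof (rule W7_I)
  fix U G assume U: "spin7_frame \<Psi> U" and G: "G \<in> spin7_group"
  note UG = frame_mult_group[OF U G]
  have "G ** (matrix_inv (U ** G) ** U0) = matrix_inv U ** U0"
    using matrix_inv_mult[OF spin7_frame_det(2)[OF U] group_D(2)[OF G]] frame_inverse(1)[OF group_D(2)[OF G]]
    by (simp add: matrix_mul_assoc)
  then show "W7_of b U = rot7 G (W7_of b (U ** G))"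
    using U UG group_rot7(3)[OF G G, of "matrix_inv (U ** G) ** U0" b] by (simp add: W7_of_def)
qed (simp_all add: W7_of_def rot7_V7)

lemma W7_of_U0: "b \<in> V7 \<Longrightarrow> W7_of b U0 = b"
  by (simp add: W7_of_def U0 frame_inverse(2)[OF spin7_frame_det(2)[OF U0]] rot7_id)

section \<open>Bundle-valued covectors as linear maps into \<open>V7\<close>\<close>

abbreviation (input) rep :: "(real^8 \<Rightarrow> w7) \<Rightarrow> real^8 \<Rightarrow> real^8" where
  "rep \<tau> \<equiv> \<lambda>y. \<tau> (U0 *v y) U0"

lemma rep_V7: "\<tau> \<in> cotW7 \<Psi> \<Longrightarrow> rep \<tau> y \<in> V7"
  using W7_D(2)[OF _ U0] by (auto simp: cotW7_def)

lemma rep_linear: "\<tau> \<in> cotW7 \<Psi> \<Longrightarrow> linear (rep \<tau>)"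
proof -
  assume "\<tau> \<in> cotW7 \<Psi>"
  then have "linear (\<lambda>v. \<tau> v U0)" by (simp add: cotW7_def)
  from linear_compose[OF matrix_vector_linear this] show ?thesis by (simp add: o_def)
qed

lemma cotW7_eqI:
  assumes "\<sigma> \<in> cotW7 \<Psi>" "\<tau> \<in> cotW7 \<Psi>" "\<And>y. rep \<sigma> y = rep \<tau> y" shows "\<sigma> = \<tau>"
proof
  fix v
  show "\<sigma> v = \<tau> v"
    using assms(1,2) assms(3)[of "matrix_inv U0 *v v"] by (intro W7_eqI) (auto simp: cotW7_def U0_inverse)
qed

lemma cotW7_diff:
  assumes "\<sigma> \<in> cotW7 \<Psi>" "\<tau> \<in> cotW7 \<Psi>" shows "\<sigma> - \<tau> \<in> cotW7 \<Psi>"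
proof -
  have "(\<sigma> - \<tau>) v \<in> W7 \<Psi>" for v
  proof -
    have "(\<lambda>U. \<Sum>i\<in>{True, False}. (if i then 1 else -1) *\<^sub>R (if i then \<sigma> v else \<tau> v) U) \<in> W7 \<Psi>"
      by (rule W7_sum) (use assms in \<open>auto simp: cotW7_def\<close>)
    then show ?thesis by (simp add: fun_diff_def)
  qed
  moreover have "linear (\<lambda>v. (\<sigma> - \<tau>) v U)" for U
    using linear_compose_sub[of "\<lambda>v. \<sigma> v U" "\<lambda>v. \<tau> v U"] assms by (simp add: cotW7_def)
  ultimately show ?thesis by (simp add: cotW7_def)
qed

lemma cotW7_0: "(\<lambda>_ _. 0) \<in> cotW7 \<Psi>"
  using W7_0 linear_zero by (simp add: cotW7_def)

lemma cotW7_of: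
  assumes "linear t" "\<And>y. t y \<in> V7"
  obtains \<tau> where "\<tau> \<in> cotW7 \<Psi>" "\<And>y. rep \<tau> y = t y"
proof
  let ?\<tau> = "\<lambda>v. W7_of (t (matrix_inv U0 *v v))"
  have "linear (\<lambda>v. ?\<tau> v U)" for U
  proof (cases "spin7_frame \<Psi> U")
    case True
    then show ?thesis
      using linear_compose[OF linear_compose[OF matrix_vector_linear assms(1)] rot7_linear] by (simp add: W7_of_def o_def)
  qed (simp add: W7_of_def linear_zero)
  then show "?\<tau> \<in> cotW7 \<Psi>" by (simp add: cotW7_def W7_of)
  show "rep ?\<tau> y = t y" for y by (simp add: U0_inverse W7_of_U0 assms(2))
qed

section \<open>The two summands and their projections\<close>

lemma W8_sum_eq_cross2:
  "(\<Sum>i\<in>UNIV - {0}. interior 2 a (in_frame U (lam2_0 (axis i 1))) (\<lambda>_. v) *\<^sub>R axis i 1) =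
     cross2 (matrix_inv U *v a) (matrix_inv U *v v)"
proof -
  have "interior 2 a (in_frame U (lam2_0 (axis i 1))) (\<lambda>_. v) =
      lam2_0 (axis i 1) (seq2 (matrix_inv U *v a) (matrix_inv U *v v))" for i
    unfolding interior_def in_frame_def
    by (simp, rule is_form_cong[OF is_form_lam2_0]) (auto simp: seq2_def split: nat.split)
  then have "(\<Sum>i\<in>UNIV - {0}. interior 2 a (in_frame U (lam2_0 (axis i 1))) (\<lambda>_. v) *\<^sub>R axis i 1) =
      (\<Sum>i\<in>UNIV - {0}. cross2 (matrix_inv U *v a) (matrix_inv U *v v) $ i *\<^sub>R axis i 1)"
    by (intro sum.cong) (auto simp: cross2_def)
  also have "\<dots> = (\<Sum>i\<in>UNIV. cross2 (matrix_inv U *v a) (matrix_inv U *v v) $ i *\<^sub>R axis i 1)"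
    by (rule sum.mono_neutral_left) (auto simp: cross2_def)
  also have "\<dots> = cross2 (matrix_inv U *v a) (matrix_inv U *v v)" by (rule vec_eq_sum_axis[symmetric])
  finally show ?thesis .
qed

text \<open>The condition in \<open>W8\<close> concerns all frames with a common tangent vector
  \<open>a\<close>. Equivariance of \<open>cross2\<close> makes \<open>?\<sigma>\<close> an element
  of \<open>W7\<close>, and such an element is determined in the frame \<open>U0\<close>.\<close>

lemma W8_iff:
  assumes \<tau>: "\<tau> \<in> cotW7 \<Psi>" shows "\<tau> \<in> W8 \<Psi> \<longleftrightarrow> (\<exists>a. \<forall>y. rep \<tau> y = cross2 a y)"
proof
  assume "\<tau> \<in> W8 \<Psi>"
  then obtain a where "\<forall>U. spin7_frame \<Psi> U \<longrightarrow> (\<forall>v. \<tau> v U = cross2 (matrix_inv U *v a) (matrix_inv U *v v))"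
    unfolding W8_def W8_sum_eq_cross2 by auto
  then have "\<forall>y. rep \<tau> y = cross2 (matrix_inv U0 *v a) y" using U0 by (simp add: U0_inverse)
  then show "\<exists>a. \<forall>y. rep \<tau> y = cross2 a y" by blast
next
  assume "\<exists>a. \<forall>y. rep \<tau> y = cross2 a y"
  then obtain a where a: "\<And>y. rep \<tau> y = cross2 a y" by blast
  let ?\<sigma> = "\<lambda>v U. if spin7_frame \<Psi> U then cross2 (matrix_inv U *v (U0 *v a)) (matrix_inv U *v v) else 0"
  have sv: "?\<sigma> v = \<tau> v" for v
  proof (rule W7_eqI)
    show "?\<sigma> v \<in> W7 \<Psi>"
    proof (rule W7_I)
      fix U G assume U: "spin7_frame \<Psi> U" and G: "G \<in> spin7_group"
      have "G *v (matrix_inv (U ** G) *v x) = matrix_inv U *v x" for x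
        using matrix_inv_mult[OF spin7_frame_det(2)[OF U] group_D(2)[OF G]] frame_inverse(1)[OF group_D(2)[OF G]]
        by (simp add: matrix_vector_mul_assoc matrix_mul_assoc)
      then show "?\<sigma> v U = rot7 G (?\<sigma> v (U ** G))"
        using U frame_mult_group[OF U G] by (simp flip: group_rot7(1)[OF G G])
    qed (simp_all add: cross2_V7)
    show "\<tau> v \<in> W7 \<Psi>" using \<tau> by (simp add: cotW7_def)
    show "?\<sigma> v U0 = \<tau> v U0" using a[of "matrix_inv U0 *v v"] by (simp add: U0 U0_inverse)
  qed
  have "\<tau> v U = cross2 (matrix_inv U *v (U0 *v a)) (matrix_inv U *v v)" if "spin7_frame \<Psi> U" for U v
    using fun_cong[OF sv[of v], of U] that by simp
  then have "\<forall>U. spin7_frame \<Psi> U \<longrightarrow> (\<forall>v. \<tau> v U = cross2 (matrix_inv U *v (U0 *v a)) (matrix_inv U *v v))"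
    by blast
  then show "\<tau> \<in> W8 \<Psi>" unfolding W8_def W8_sum_eq_cross2 using \<tau> by auto
qed

lemma cotW7_inner_eq: "cotW7_inner \<Psi> \<sigma> \<tau> = (\<Sum>\<mu>\<in>UNIV. rep \<sigma> (axis \<mu> 1) \<bullet> rep \<tau> (axis \<mu> 1))"
  by (simp add: cotW7_inner_def Let_def matrix_vector_mult_basis)

lemma W8_of_cross2:
  obtains \<sigma> where "\<sigma> \<in> W8 \<Psi>" "\<sigma> \<in> cotW7 \<Psi>" "\<And>y. rep \<sigma> y = cross2 a y"
proof -
  obtain \<sigma> where "\<sigma> \<in> cotW7 \<Psi>" "\<And>y. rep \<sigma> y = cross2 a y"
    using cotW7_of[OF cross2_linear(2) cross2_V7] by metis
  then show thesis using that W8_iff by metis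
qed

text \<open>By adjointness the orthogonal complement of the image of J is the kernel of its
  transpose.\<close>

lemma W48_iff:
  assumes \<tau>: "\<tau> \<in> cotW7 \<Psi>" shows "\<tau> \<in> W48 \<Psi> \<longleftrightarrow> contr (rep \<tau>) = 0"
proof
  assume L: "\<tau> \<in> W48 \<Psi>"
  have "contr (rep \<tau>) \<bullet> a = 0" for a
  proof -
    obtain \<sigma> where s: "\<sigma> \<in> W8 \<Psi>" "\<And>y. rep \<sigma> y = cross2 a y" using W8_of_cross2[where a = a] by blast
    then have "cotW7_inner \<Psi> \<sigma> \<tau> = 0" using L by (simp add: W48_def)
    then show ?thesis by (simp add: cotW7_inner_eq contr_inner s(2))
  qed
  then show "contr (rep \<tau>) = 0" by (metis inner_eq_zero_iff)
next
  assume R: "contr (rep \<tau>) = 0"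
  have "cotW7_inner \<Psi> \<sigma> \<tau> = 0" if s: "\<sigma> \<in> W8 \<Psi>" for \<sigma>
  proof -
    have "\<sigma> \<in> cotW7 \<Psi>" using s by (simp add: W8_def)
    then obtain a where "\<And>y. rep \<sigma> y = cross2 a y" using s W8_iff by blast
    then show ?thesis using contr_inner[of "rep \<tau>" a] R by (simp add: cotW7_inner_eq)
  qed
  then show "\<tau> \<in> W48 \<Psi>" using \<tau> by (simp add: W48_def)
qed

lemma rep_diff: "rep (\<sigma> - \<tau>) = (\<lambda>y. rep \<sigma> y - rep \<tau> y)"
  by simp

text \<open>As J^T J = 7, the orthogonal projection onto the image of J is J J^T divided by
  7.\<close>

lemma decomposition:
  assumes \<tau>: "\<tau> \<in> cotW7 \<Psi>"
  obtains \<sigma> where "\<sigma> \<in> W8 \<Psi>" "\<tau> - \<sigma> \<in> W48 \<Psi>" "\<And>y. rep \<sigma> y = cross2 ((1/7) *\<^sub>R contr (rep \<tau>)) y"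
proof -
  obtain \<sigma> where s: "\<sigma> \<in> W8 \<Psi>" "\<sigma> \<in> cotW7 \<Psi>" "\<And>y. rep \<sigma> y = cross2 ((1/7) *\<^sub>R contr (rep \<tau>)) y"
    using W8_of_cross2[where a = "(1/7) *\<^sub>R contr (rep \<tau>)"] by blast
  have "contr (rep (\<tau> - \<sigma>)) = contr (rep \<tau>) - contr (cross2 ((1/7) *\<^sub>R contr (rep \<tau>)))"
    unfolding rep_diff contr_diff s(3) ..
  also have "\<dots> = 0" by (simp add: contr_cross2)
  finally have "\<tau> - \<sigma> \<in> W48 \<Psi>" by (simp add: W48_iff[OF cotW7_diff[OF \<tau> s(2)]])
  then show thesis using that s by blast
qed

lemma W8_W48_unique:
  assumes \<tau>: "\<tau> \<in> cotW7 \<Psi>" and s: "\<sigma> \<in> W8 \<Psi>" "\<tau> - \<sigma> \<in> W48 \<Psi>"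
  shows "rep \<sigma> y = cross2 ((1/7) *\<^sub>R contr (rep \<tau>)) y"
proof -
  have sc: "\<sigma> \<in> cotW7 \<Psi>" using s by (simp add: W8_def)
  then obtain a where a: "\<And>y. rep \<sigma> y = cross2 a y" using s(1) W8_iff by blast
  have "0 = contr (rep (\<tau> - \<sigma>))" using s(2) W48_iff[OF cotW7_diff[OF \<tau> sc]] by simp
  also have "\<dots> = contr (rep \<tau>) - 7 *\<^sub>R a" unfolding rep_diff contr_diff a contr_cross2 ..
  finally have "contr (rep \<tau>) = 7 *\<^sub>R a" by simp
  then show ?thesis by (simp add: a)
qed

text \<open>Existence and uniqueness of the decomposition give the definite description in
  \<open>proj_along\<close> its value; that value is 0 exactly when \<tau> lies in the complementary
  summand.\<close>

lemma pr8_eq_0_iff: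
  assumes \<tau>: "\<tau> \<in> cotW7 \<Psi>" shows "pr8 \<Psi> \<tau> = (\<lambda>_ _. 0) \<longleftrightarrow> \<tau> \<in> W48 \<Psi>"
proof -
  have uniq: "\<sigma> = \<sigma>'" if "\<sigma> \<in> W8 \<Psi>" "\<tau> - \<sigma> \<in> W48 \<Psi>" "\<sigma>' \<in> W8 \<Psi>" "\<tau> - \<sigma>' \<in> W48 \<Psi>" for \<sigma> \<sigma>'
    using W8_W48_unique[OF \<tau> that(1,2)] W8_W48_unique[OF \<tau> that(3,4)] that(1,3)
    by (intro cotW7_eqI) (auto simp: W8_def)
  obtain \<sigma> where s: "\<sigma> \<in> W8 \<Psi>" "\<tau> - \<sigma> \<in> W48 \<Psi>" using decomposition[OF \<tau>] by blast
  then have pr: "pr8 \<Psi> \<tau> = \<sigma>"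
    unfolding pr8_def proj_along_def using uniq by (intro the_equality) auto
  have 0: "\<tau> - (\<lambda>_ _. 0) = \<tau>" by (simp add: fun_eq_iff)
  have "(\<lambda>_ _. 0) \<in> W8 \<Psi>"
    unfolding W8_iff[OF cotW7_0] using linear_0[OF cross2_linear(1)] by (intro exI[of _ 0]) simp
  then show ?thesis using pr s uniq[of \<sigma> "\<lambda>_ _. 0"] 0 by metis
qed

lemma pr48_eq_0_iff:
  assumes \<tau>: "\<tau> \<in> cotW7 \<Psi>" shows "pr48 \<Psi> \<tau> = (\<lambda>_ _. 0) \<longleftrightarrow> \<tau> \<in> W8 \<Psi>"
proof -
  have inv: "\<tau> - (\<tau> - \<sigma>) = \<sigma>" for \<sigma> :: "real^8 \<Rightarrow> w7" by (simp add: fun_eq_iff)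
  have uniq: "\<sigma> = \<sigma>'" if "\<sigma> \<in> W48 \<Psi>" "\<tau> - \<sigma> \<in> W8 \<Psi>" "\<sigma>' \<in> W48 \<Psi>" "\<tau> - \<sigma>' \<in> W8 \<Psi>" for \<sigma> \<sigma>'
  proof (rule cotW7_eqI)
    show "\<sigma> \<in> cotW7 \<Psi>" "\<sigma>' \<in> cotW7 \<Psi>" using that(1,3) by (simp_all add: W48_def)
    fix y
    have "rep \<tau> y - rep \<sigma> y = rep \<tau> y - rep \<sigma>' y"
      using W8_W48_unique[OF \<tau> that(2), unfolded inv, OF that(1), of y]
        W8_W48_unique[OF \<tau> that(4), unfolded inv, OF that(3), of y] by simp
    then show "rep \<sigma> y = rep \<sigma>' y" by simp
  qed
  obtain \<sigma> where s: "\<tau> - \<sigma> \<in> W48 \<Psi>" "\<sigma> \<in> W8 \<Psi>" using decomposition[OF \<tau>] by blast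
  then have pr: "pr48 \<Psi> \<tau> = \<tau> - \<sigma>"
    unfolding pr48_def proj_along_def using uniq by (intro the_equality) (auto simp: inv)
  have 0: "\<tau> - (\<lambda>_ _. 0) = \<tau>" by (simp add: fun_eq_iff)
  have "(\<lambda>_ _. 0) \<in> W48 \<Psi>"
    unfolding W48_iff[OF cotW7_0] by (simp add: contr_def vec_eq_iff)
  then show ?thesis using pr s uniq[of "\<tau> - \<sigma>" "\<lambda>_ _. 0"] 0 inv[of \<sigma>] by metis
qed

lemma mem_W8_plus_W48:
  assumes \<tau>: "\<tau> \<in> cotW7 \<Psi>" shows "\<tau> \<in> W8_plus_W48 \<Psi>"
proof -
  obtain \<sigma> where s: "\<sigma> \<in> W8 \<Psi>" "\<tau> - \<sigma> \<in> W48 \<Psi>" using decomposition[OF \<tau>] by blast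
  have "\<tau> = (\<lambda>v U. \<sigma> v U + (\<tau> - \<sigma>) v U)" by (simp add: fun_eq_iff)
  then show ?thesis unfolding W8_plus_W48_def using s by blast
qed

section \<open>The isomorphism \<open>H\<close>\<close>

text \<open>The single number that determines \<alpha> \<and> \<lambda>^2(b): its value on the frame
  \<open>U0\<close>.\<close>

abbreviation (input) pairing :: "8 form \<Rightarrow> real^8 \<Rightarrow> real" where
  "pairing \<alpha> b \<equiv> wedge 6 2 (\<lambda>v. \<alpha> (\<lambda>i. U0 *v v i)) (lam2_0 b) (bas idxs)"

abbreviation (input) form7 :: "real^8 \<Rightarrow> 8 form" where
  "form7 b \<equiv> wedge 4 2 \<Psi> (in_frame U0 (lam2_0 b))"

lemma form7_eq: "form7 b = in_frame U0 (wedge 4 2 Phi0 (lam2_0 b))"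
  using U0 wedge_in_frame[of 4 2 U0 Phi0 "lam2_0 b"] by (simp add: spin7_frame_def)

lemma is_form_form7: "is_form 6 (form7 b)"
  unfolding form7_eq using is_form_wedge[OF is_form_Phi0 is_form_lam2_0, of b] by (simp add: is_form_in_frame)

lemma form7_linear: "linear (\<lambda>b. form7 b v)"
  by (rule wedge_linear_right) (simp add: in_frame_def lam2_0_linear)

lemma pairing_form7: "a \<in> V7 \<Longrightarrow> b \<in> V7 \<Longrightarrow> pairing (form7 a) b = 12 * (a \<bullet> b)"
  unfolding form7_eq using spin7_frame_det(2)[OF U0]
  by (simp add: in_frame_apply wedge_wedge_lam2_0)

lemma Lambda6_7_eq: "Lambda6_7 \<Psi> = form7 ` V7"
proof -
  have "b \<in> V7 \<Longrightarrow> \<exists>a. form7 b = wedge 4 2 \<Psi> (lam2 \<Psi> a) \<and> a \<in> W7 \<Psi>" for b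
    using W7_of[of b] W7_of_U0[of b] by (intro exI[of _ "W7_of b"]) (simp add: lam2_def)
  then show ?thesis
    unfolding Lambda6_7_def by (auto simp: lam2_def W7_D(2)[OF _ U0])
qed

text \<open>A top-degree form vanishes as soon as it vanishes on one basis, so the defining
  condition becomes that of the kernel of the pairing.\<close>

lemma Lambda6_21_iff:
  "\<alpha> \<in> Lambda6_21 \<Psi> \<longleftrightarrow> is_form 6 \<alpha> \<and> (\<forall>b\<in>V7. pairing \<alpha> b = 0)"
proof (cases "is_form 6 \<alpha>")
  case f: True
  let ?\<alpha> = "\<lambda>v. \<alpha> (\<lambda>i. U0 *v v i)"
  have f': "is_form 6 ?\<alpha>" by (rule is_form_linear_image[OF f matrix_vector_linear])
  have "in_frame U0 ?\<alpha> = \<alpha>" by (rule ext) (simp add: in_frame_def U0_inverse)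
  then have w: "wedge 6 2 \<alpha> (in_frame U0 (lam2_0 b)) = in_frame U0 (wedge 6 2 ?\<alpha> (lam2_0 b))" for b
    using wedge_in_frame[of 6 2 U0 ?\<alpha> "lam2_0 b"] by simp
  have eq: "(\<forall>v. wedge 6 2 \<alpha> (in_frame U0 (lam2_0 b)) v = 0) \<longleftrightarrow> pairing \<alpha> b = 0" for b
  proof
    assume "\<forall>v. wedge 6 2 \<alpha> (in_frame U0 (lam2_0 b)) v = 0"
    then have "in_frame U0 (wedge 6 2 ?\<alpha> (lam2_0 b)) (\<lambda>i. U0 *v bas idxs i) = 0" by (simp add: w)
    then show "pairing \<alpha> b = 0" by (simp add: in_frame_apply[OF spin7_frame_det(2)[OF U0]])
  next
    assume p: "pairing \<alpha> b = 0"
    have "is_form 8 (wedge 6 2 ?\<alpha> (lam2_0 b))" using is_form_wedge[OF f' is_form_lam2_0] by simp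
    from top_form_eq_0[OF this p] show "\<forall>v. wedge 6 2 \<alpha> (in_frame U0 (lam2_0 b)) v = 0"
      unfolding w by (simp add: in_frame_def)
  qed
  have "(\<forall>a\<in>W7 \<Psi>. \<forall>v. wedge 6 2 \<alpha> (lam2 \<Psi> a) v = 0) \<longleftrightarrow> (\<forall>b\<in>V7. pairing \<alpha> b = 0)"
    unfolding lam2_def eq
  proof safe
    fix b assume *: "\<forall>a\<in>W7 \<Psi>. pairing \<alpha> (a U0) = 0" and b: "b \<in> V7"
    show "pairing \<alpha> b = 0" using bspec[OF * W7_of[of b]] by (simp add: W7_of_U0[OF b])
  next
    fix a assume *: "\<forall>b\<in>V7. pairing \<alpha> b = 0" and a: "a \<in> W7 \<Psi>"
    show "pairing \<alpha> (a U0) = 0" using bspec[OF * W7_D(2)[OF a U0]] .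
  qed
  then show ?thesis using f by (simp add: Lambda6_21_def)
qed (simp add: Lambda6_21_def)

lemma pairing_diff: "pairing (\<lambda>v. \<alpha> v - \<beta> v) b = pairing \<alpha> b - pairing \<beta> b"
  by (rule wedge_diff_left)

lemma form7_inject: "a \<in> V7 \<Longrightarrow> b \<in> V7 \<Longrightarrow> form7 a = form7 b \<Longrightarrow> a = b"
  using pairing_form7[of a] pairing_form7[of b] by (intro V7_eqI) fastforce+

text \<open>The form built from \<open>c\<close> has the same pairings as \<open>K\<close>, so the
  difference lies in the kernel. Uniqueness holds because the pairing separates the elements of
  \<open>Lambda6_7\<close>.\<close>

lemma pi7_eq:
  assumes K: "\<And>\<mu>. is_form 6 (\<lambda>v. K v $ \<mu>)" and c: "\<And>\<mu>. c \<mu> \<in> V7"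
    and p: "\<And>\<mu> b. b \<in> V7 \<Longrightarrow> pairing (\<lambda>v. K v $ \<mu>) b = 12 * (c \<mu> \<bullet> b)"
  shows "pi7 \<Psi> K = (\<lambda>v. \<chi> \<mu>. form7 (c \<mu>) v)"
  unfolding pi7_def proj_along_def
proof (rule the_equality)
  let ?z = "\<lambda>v. \<chi> \<mu>. form7 (c \<mu>) v"
  have "?z \<in> tensor_TM (Lambda6_7 \<Psi>)" using c by (auto simp: tensor_TM_def Lambda6_7_eq)
  moreover have "(\<lambda>v. (K - ?z) v $ \<mu>) \<in> Lambda6_21 \<Psi>" for \<mu>
  proof -
    have "pairing (\<lambda>v. K v $ \<mu> - form7 (c \<mu>) v) b = 0" if "b \<in> V7" for b
      using pairing_form7[OF c that] p[OF that] by (simp add: pairing_diff[of "\<lambda>v. K v $ \<mu>"])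
    then show ?thesis unfolding Lambda6_21_iff using is_form_diff[OF K is_form_form7] by simp
  qed
  ultimately show "?z \<in> tensor_TM (Lambda6_7 \<Psi>) \<and> K - ?z \<in> tensor_TM (Lambda6_21 \<Psi>)"
    by (simp add: tensor_TM_def)
next
  fix z assume z: "z \<in> tensor_TM (Lambda6_7 \<Psi>) \<and> K - z \<in> tensor_TM (Lambda6_21 \<Psi>)"
  have "z v $ \<mu> = form7 (c \<mu>) v" for v \<mu>
  proof -
    from z obtain d where d: "d \<in> V7" "(\<lambda>v. z v $ \<mu>) = form7 d" by (auto simp: tensor_TM_def Lambda6_7_eq)
    have zd: "z v $ \<mu> = form7 d v" for v by (rule fun_cong[OF d(2)])
    have "(\<lambda>v. (K - z) v $ \<mu>) \<in> Lambda6_21 \<Psi>" using z by (simp add: tensor_TM_def)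
    then have "pairing (\<lambda>v. K v $ \<mu> - form7 d v) b = 0" if "b \<in> V7" for b
      using that by (simp add: Lambda6_21_iff zd)
    then have "12 * (c \<mu> \<bullet> b) = 12 * (d \<bullet> b)" if "b \<in> V7" for b
      using that pairing_form7[OF d(1) that] p[OF that, of \<mu>] by (simp add: pairing_diff[of "\<lambda>v. K v $ \<mu>"])
    then have "c \<mu> = d" by (intro V7_eqI[OF c d(1)]) simp
    then show ?thesis by (simp add: zd)
  qed
  then show "z = (\<lambda>v. \<chi> \<mu>. form7 (c \<mu>) v)" by (simp add: fun_eq_iff vec_eq_iff)
qed

text \<open>The definite description in \<open>H_iso\<close> ranges over all presentations as sums
  of decomposable tensors, so it must be shown that every presentation of \<open>z\<close> gives the
  same value.\<close>

lemma H_iso_eq: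
  assumes c: "\<And>\<mu>. c \<mu> \<in> V7"
  defines "z \<equiv> \<lambda>v. \<chi> \<mu>. form7 (c \<mu>) v"
  shows "H_iso \<Psi> h z \<in> cotW7 \<Psi>" "H_iso \<Psi> h z y U0 = (\<Sum>\<mu>\<in>UNIV. h (axis \<mu> 1) y *\<^sub>R c \<mu>)"
proof -
  let ?Q = "\<lambda>\<tau> (n::nat) a v. (\<forall>i<n. a i \<in> W7 \<Psi>) \<and>
        z = (\<lambda>w. \<Sum>i<n. wedge 4 2 \<Psi> (lam2 \<Psi> (a i)) w *\<^sub>R v i) \<and>
        \<tau> = (\<lambda>y U. \<Sum>i<n. h (v i) y *\<^sub>R a i U)"
  have val: "\<tau> y U0 = (\<Sum>\<mu>\<in>UNIV. h (axis \<mu> 1) y *\<^sub>R c \<mu>) \<and> \<tau> y \<in> W7 \<Psi>" if Q: "?Q \<tau> n a v" for \<tau> n a v y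
  proof
    have a: "a i U0 \<in> V7" if "i < n" for i using Q that W7_D(2)[OF _ U0] by blast
    \<comment> \<open>Independence of the presentation: component \<mu> of \<open>z\<close>
      determines the combination of the \<open>a i\<close> by injectivity of
      \<open>form7\<close>.\<close>
    have cs: "(\<Sum>i<n. v i $ \<mu> *\<^sub>R a i U0) = c \<mu>" for \<mu>
    proof (rule form7_inject[OF _ c])
      show "(\<Sum>i<n. v i $ \<mu> *\<^sub>R a i U0) \<in> V7" using a by (intro V7_sum V7_scale) auto
      show "form7 (\<Sum>i<n. v i $ \<mu> *\<^sub>R a i U0) = form7 (c \<mu>)"
      proof
        fix w
        have "form7 (c \<mu>) w = z w $ \<mu>" by (simp add: z_def)
        also have "\<dots> = (\<Sum>i<n. form7 (a i U0) w * v i $ \<mu>)" using Q by (simp add: lam2_def)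
        also have "\<dots> = form7 (\<Sum>i<n. v i $ \<mu> *\<^sub>R a i U0) w"
          unfolding linear_sum[OF form7_linear] linear_cmul[OF form7_linear] by (simp add: mult.commute)
        finally show "form7 (\<Sum>i<n. v i $ \<mu> *\<^sub>R a i U0) w = form7 (c \<mu>) w" by simp
      qed
    qed
    have "(\<Sum>\<mu>\<in>UNIV. h (axis \<mu> 1) y *\<^sub>R c \<mu>) =
        (\<Sum>\<mu>\<in>UNIV. \<Sum>i<n. h (axis \<mu> 1) y *\<^sub>R (v i $ \<mu> *\<^sub>R a i U0))"
      unfolding cs[symmetric] scaleR_sum_right ..
    also have "\<dots> = (\<Sum>i<n. \<Sum>\<mu>\<in>UNIV. (v i $ \<mu> *\<^sub>R h (axis \<mu> 1) y) *\<^sub>R a i U0)"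
      by (subst sum.swap) (simp add: mult.commute)
    also have "\<dots> = (\<Sum>i<n. h (v i) y *\<^sub>R a i U0)"
      unfolding linear_axis_expansion[OF h_linear(2), of "v _" y] scaleR_sum_left ..
    finally show "\<tau> y U0 = (\<Sum>\<mu>\<in>UNIV. h (axis \<mu> 1) y *\<^sub>R c \<mu>)" using Q by simp
    show "\<tau> y \<in> W7 \<Psi>" using Q W7_sum[of "{..<n}" a "\<lambda>i. h (v i) y"] by simp
  qed
  \<comment> \<open>A presentation by the coordinate vectors, numbered through \<open>idxs\<close>
    because \<open>H_iso\<close> sums over natural numbers.\<close>
  define a where "a i = W7_of (c (ix (idxs ! i)))" for i
  define \<tau> where "\<tau> = (\<lambda>y U. \<Sum>i<8. h (ax (idxs ! i)) y *\<^sub>R a i U)"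
  have "z = (\<lambda>w. \<Sum>i<8. wedge 4 2 \<Psi> (lam2 \<Psi> (a i)) w *\<^sub>R ax (idxs ! i))"
  proof
    fix w
    have "(\<Sum>i<8. wedge 4 2 \<Psi> (lam2 \<Psi> (a i)) w *\<^sub>R ax (idxs ! i)) =
        (\<Sum>k\<in>UNIV. form7 (c (ix k)) w *\<^sub>R ax k)"
      unfolding a_def lam2_def W7_of_U0[OF c] by (rule sum_less_8_idxs)
    also have "\<dots> = (\<Sum>\<mu>\<in>UNIV. z w $ \<mu> *\<^sub>R axis \<mu> 1)" by (simp add: sum_ix z_def)
    also have "\<dots> = z w" by (rule vec_eq_sum_axis[symmetric])
    finally show "z w = (\<Sum>i<8. wedge 4 2 \<Psi> (lam2 \<Psi> (a i)) w *\<^sub>R ax (idxs ! i))" by simp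
  qed
  then have Q: "?Q \<tau> 8 a (\<lambda>i. ax (idxs ! i))" by (simp add: \<tau>_def a_def W7_of)
  have H: "H_iso \<Psi> h z = \<tau>"
    unfolding H_iso_def
  proof (rule the_equality)
    show "\<exists>n a v. ?Q \<tau> n a v" by (intro exI) (rule Q)
    fix \<tau>' assume "\<exists>n a v. ?Q \<tau>' n a v"
    then obtain n a' v where Q': "?Q \<tau>' n a' v" by (elim exE)
    show "\<tau>' = \<tau>"
    proof
      fix y show "\<tau>' y = \<tau> y"
        using val[OF Q, of y] val[OF Q', of y] by (intro W7_eqI) auto
    qed
  qed
  have "linear (\<lambda>y. \<tau> y U)" for U
    unfolding \<tau>_def using h_linear(1)
    by (intro linear_compose_sum ballI linearI) (simp_all add: linear_add linear_cmul scaleR_left_distrib)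
  then show "H_iso \<Psi> h z \<in> cotW7 \<Psi>" using val[OF Q] by (simp add: H cotW7_def)
  show "H_iso \<Psi> h z y U0 = (\<Sum>\<mu>\<in>UNIV. h (axis \<mu> 1) y *\<^sub>R c \<mu>)" using val[OF Q] by (simp add: H)
qed

text \<open>The components of \<open>K\<close> refer to the coordinate basis, \<open>t\<close> to
  the frame. The frame matrix enters once through the components and once through the metric, and
  the isometry property cancels the two.\<close>

lemma H_iso_pi7:
  assumes K: "\<And>\<mu>. is_form 6 (\<lambda>v. K0 v $ \<mu>)"
    and KU: "\<And>v. K (\<lambda>i. U0 *v v i) = U0 *v K0 v"
    and t: "linear t" "\<And>y. t y \<in> V7"
    and p: "\<And>\<nu> b. b \<in> V7 \<Longrightarrow> wedge 6 2 (\<lambda>v. K0 v $ \<nu>) (lam2_0 b) (bas idxs) = 12 * (t (axis \<nu> 1) \<bullet> b)"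
  shows "H_iso \<Psi> h (pi7 \<Psi> K) \<in> cotW7 \<Psi>" "rep (H_iso \<Psi> h (pi7 \<Psi> K)) y = t y"
proof -
  \<comment> \<open>Coefficients with respect to the coordinate basis, from those with respect to
    the frame.\<close>
  define c where "c \<mu> = (\<Sum>\<kappa>\<in>UNIV. U0 $ \<mu> $ \<kappa> *\<^sub>R t (axis \<kappa> 1))" for \<mu>
  have c: "c \<mu> \<in> V7" for \<mu> unfolding c_def using t(2) by (intro V7_sum V7_scale)
  have comp: "K (\<lambda>i. U0 *v v i) $ \<mu> = (\<Sum>\<kappa>\<in>UNIV. U0 $ \<mu> $ \<kappa> * K0 v $ \<kappa>)" for v \<mu>
    unfolding KU by (simp add: matrix_vector_mult_def)
  have Kf: "is_form 6 (\<lambda>v. K v $ \<mu>)" for \<mu>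
  proof -
    have "is_form 6 (\<lambda>v. \<Sum>\<kappa>\<in>UNIV. U0 $ \<mu> $ \<kappa> * K0 v $ \<kappa>)"
      by (intro is_form_sum is_form_scale K)
    from is_form_in_frame[OF this, of U0] show ?thesis
      unfolding in_frame_def comp[symmetric] U0_inverse by simp
  qed
  have pc: "pairing (\<lambda>v. K v $ \<mu>) b = 12 * (c \<mu> \<bullet> b)" if "b \<in> V7" for \<mu> b
    unfolding comp wedge_sum_left wedge_scale_left p[OF that] c_def
    by (simp add: inner_sum_left sum_distrib_left mult.left_commute)
  have P: "pi7 \<Psi> K = (\<lambda>v. \<chi> \<mu>. form7 (c \<mu>) v)" by (rule pi7_eq[OF Kf c pc])
  show "H_iso \<Psi> h (pi7 \<Psi> K) \<in> cotW7 \<Psi>" unfolding P by (rule H_iso_eq(1)[OF c])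
  have "rep (H_iso \<Psi> h (pi7 \<Psi> K)) y = (\<Sum>\<mu>\<in>UNIV. \<Sum>\<kappa>\<in>UNIV. (U0 $ \<mu> $ \<kappa> *\<^sub>R h (axis \<mu> 1) (U0 *v y)) *\<^sub>R t (axis \<kappa> 1))"
    unfolding P H_iso_eq(2)[OF c] by (simp add: c_def scaleR_sum_right mult.commute)
  also have "\<dots> = (\<Sum>\<kappa>\<in>UNIV. (\<Sum>\<mu>\<in>UNIV. column \<kappa> U0 $ \<mu> *\<^sub>R h (axis \<mu> 1) (U0 *v y)) *\<^sub>R t (axis \<kappa> 1))"
    by (subst sum.swap) (simp add: scaleR_sum_left column_def)
  also have "\<dots> = (\<Sum>\<kappa>\<in>UNIV. h (U0 *v axis \<kappa> 1) (U0 *v y) *\<^sub>R t (axis \<kappa> 1))"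
    unfolding linear_axis_expansion[OF h_linear(2), of "column _ U0", symmetric] matrix_vector_mult_basis ..
  also have "\<dots> = (\<Sum>\<kappa>\<in>UNIV. y $ \<kappa> *\<^sub>R t (axis \<kappa> 1))"
    unfolding frame_isometry[OF U0] by (simp add: inner_axis')
  also have "\<dots> = t y" by (rule linear_axis_expansion[OF t(1), symmetric])
  finally show "rep (H_iso \<Psi> h (pi7 \<Psi> K)) y = t y" .
qed

end

section \<open>Calculus in a chart\<close>

lemma differentiable_transform_open:
  assumes "f differentiable (at x)" "open S" "x \<in> S" "\<And>y. y \<in> S \<Longrightarrow> f y = g y"
  shows "g differentiable (at x)"
  using assms has_derivative_transform_within_open unfolding differentiable_def by blast

lemma differentiable_prod:
  fixes f :: "'i \<Rightarrow> 'v::real_normed_vector \<Rightarrow> real"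
  shows "(\<And>i. i \<in> I \<Longrightarrow> f i differentiable (at x)) \<Longrightarrow> (\<lambda>y. \<Prod>i\<in>I. f i y) differentiable (at x)"
  by (induction I rule: infinite_finite_induct) (auto intro!: differentiable_mult)

lemma differentiable_sum':
  fixes f :: "'i \<Rightarrow> 'v::real_normed_vector \<Rightarrow> 'b::real_normed_vector"
  shows "(\<And>i. i \<in> I \<Longrightarrow> f i differentiable (at x)) \<Longrightarrow> (\<lambda>y. \<Sum>i\<in>I. f i y) differentiable (at x)"
  by (induction I rule: infinite_finite_induct) (auto intro!: differentiable_add)

lemma differentiable_det:
  fixes B :: "'v::real_normed_vector \<Rightarrow> real^'n^'n"
  assumes "\<And>i j. (\<lambda>y. B y $ i $ j) differentiable (at x)"
  shows "(\<lambda>y. det (B y)) differentiable (at x)"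
  unfolding det_def by (intro differentiable_sum' differentiable_mult differentiable_prod assms differentiable_const)

lemma differentiable_vec:
  fixes f :: "'n::finite \<Rightarrow> 'v::real_normed_vector \<Rightarrow> real"
  assumes "\<And>k. f k differentiable (at x)"
  shows "(\<lambda>y. \<chi> k. f k y) differentiable (at x)"
proof -
  have "(\<lambda>y. \<Sum>k\<in>UNIV. f k y *\<^sub>R axis k (1::real)) differentiable (at x)"
    by (intro differentiable_sum' differentiable_scaleR assms differentiable_const)
  moreover have "(\<Sum>k\<in>UNIV. f k y *\<^sub>R axis k (1::real)) = (\<chi> k. f k y)" for y
    by (subst (2) vec_eq_sum_axis) simp
  ultimately show ?thesis by simp
qed

lemma smooth_on_differentiable: "smooth_on S f \<Longrightarrow> x \<in> S \<Longrightarrow> f differentiable (at x)"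
  unfolding smooth_on_def using Ck_on.simps(2)[of 0 S f] by blast

text \<open>The formula is Cramer's rule. It replaces the definite description in
  \<open>sharp\<close> by a quotient of determinants, from which differentiability in the base point
  can be read off.\<close>

lemma sharp_cramer:
  fixes b :: "real^'n \<Rightarrow> real^'n \<Rightarrow> real"
  assumes bil: "bilinear b" and pos: "\<And>v. v \<noteq> 0 \<Longrightarrow> b v v > 0" and \<theta>: "linear \<theta>"
  shows "b (sharp b \<theta>) w = \<theta> w"
    and "sharp b \<theta> = (\<chi> k. det (\<chi> i j. if j = k then \<theta> (axis i 1) else b (axis j 1) (axis i 1)) /
           det (\<chi> i j. b (axis j 1) (axis i 1)))"
    and "det (\<chi> i j. b (axis j 1) (axis i 1)) \<noteq> 0"
proof -
  let ?A = "\<chi> i j. b (axis j 1) (axis i 1) :: real^'n^'n" and ?t = "\<chi> i. \<theta> (axis i 1)"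
  have l1: "linear (b x)" and l2: "linear (\<lambda>x. b x y)" for x y using bil by (auto simp: bilinear_def)
  have A: "(?A *v z) $ i = b z (axis i 1)" for z i
    unfolding linear_axis_expansion[OF l2, of z "axis i 1"] by (simp add: matrix_vector_mult_def mult.commute)
  have iff: "(\<forall>w. b z w = \<theta>' w) \<longleftrightarrow> ?A *v z = (\<chi> i. \<theta>' (axis i 1))" if "linear \<theta>'" for z \<theta>'
  proof
    assume "?A *v z = (\<chi> i. \<theta>' (axis i 1))"
    then have "b z (axis i 1) = \<theta>' (axis i 1)" for i using A[of z i] by simp
    then show "\<forall>w. b z w = \<theta>' w" using linear_fun_eq_on_axes[OF l1 that] by blast
  qed (simp add: vec_eq_iff A)
  show d: "det ?A \<noteq> 0"
  proof
    assume "det ?A = 0"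
    then have "\<not> invertible ?A" by (simp add: invertible_det_nz)
    then obtain z where z: "?A *v z = 0" "z \<noteq> 0"
      using matrix_left_invertible_ker[of ?A] by (auto simp: invertible_left_inverse)
    have "\<forall>w. b z w = (\<lambda>_. 0) w" using iff[of "\<lambda>_. 0" z] z(1) by (simp add: linear_zero vec_eq_iff)
    then show False using pos[OF z(2)] by simp
  qed
  have ex1: "(\<forall>w. b z w = \<theta> w) \<longleftrightarrow> z = (\<chi> k. det (\<chi> i j. if j = k then ?t $ i else ?A $ i $ j) / det ?A)" for z
    unfolding iff[OF \<theta>] by (rule cramer[OF d])
  then have s: "sharp b \<theta> = (\<chi> k. det (\<chi> i j. if j = k then ?t $ i else ?A $ i $ j) / det ?A)"
    unfolding sharp_def by simp
  then show "b (sharp b \<theta>) w = \<theta> w" using ex1 by blast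
  show "sharp b \<theta> = (\<chi> k. det (\<chi> i j. if j = k then \<theta> (axis i 1) else b (axis j 1) (axis i 1)) / det ?A)"
    unfolding s by (simp cong: if_cong)
qed

lemma linear_vec_component: "linear (\<lambda>w::real^'n. w $ \<mu>)"
  by (simp add: linearI)

section \<open>Metric, cross product and connection in a chart\<close>

context
  fixes S :: "(real^8) set" and x :: "real^8" and g :: "real^8 \<Rightarrow> real^8 \<Rightarrow> real^8 \<Rightarrow> real" and F :: "real^8 \<Rightarrow> 8 form"
  assumes S: "open S" "x \<in> S"
    and bil: "\<And>y. y \<in> S \<Longrightarrow> bilinear (g y)"
    and symm: "\<And>y v w. y \<in> S \<Longrightarrow> g y v w = g y w v"
    and pos: "\<And>y v. y \<in> S \<Longrightarrow> v \<noteq> 0 \<Longrightarrow> g y v v > 0"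
    and gdiff: "\<And>v w. (\<lambda>y. g y v w) differentiable (at x)"
    and form: "\<And>y. y \<in> S \<Longrightarrow> is_form 4 (F y)"
    and Fdiff: "\<And>v. (\<lambda>y. F y v) differentiable (at x)"
begin

abbreviation (input) P :: "real^8 \<Rightarrow> 8 vform" where
  "P y v \<equiv> - delta_op (g y) (F y) v"

abbreviation (input) dg :: "real^8 \<Rightarrow> real^8 \<Rightarrow> real^8 \<Rightarrow> real" where
  "dg a u w \<equiv> frechet_derivative (\<lambda>y. g y u w) (at x) a"

abbreviation (input) \<Gamma> :: "real^8 \<Rightarrow> real^8 \<Rightarrow> real^8" where
  "\<Gamma> \<equiv> christoffel g x"

abbreviation (input) p :: "real^8 \<Rightarrow> real^8 \<Rightarrow> real^8 \<Rightarrow> real^8" where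
  "p b c d \<equiv> P x (seq3 b c d)"

abbreviation (input) D :: "real^8 \<Rightarrow> real^8 \<Rightarrow> real^8 \<Rightarrow> real^8 \<Rightarrow> real^8" where
  "D a b c d \<equiv> frechet_derivative (\<lambda>y. P y (seq3 b c d)) (at x) a"

lemma sharp_differentiable: "(\<lambda>y. sharp (g y) (\<lambda>w. w $ \<mu>)) differentiable (at x)"
proof (rule differentiable_transform_open[OF _ S])
  let ?s = "\<lambda>y. \<chi> k. det (\<chi> i j. if j = k then axis i 1 $ \<mu> else g y (axis j 1) (axis i 1)) /
           det (\<chi> i j. g y (axis j 1) (axis i 1)) :: real^8"
  have "(\<lambda>y. if j = k then axis i 1 $ \<mu> else g y (axis j 1) (axis i 1)) differentiable (at x)" for i j k :: 8
    using gdiff by (cases "j = k") simp_all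
  then show "?s differentiable (at x)"
    using sharp_cramer(3)[OF bil pos linear_vec_component] S(2) gdiff
    by (intro differentiable_vec differentiable_divide differentiable_det) simp_all
  show "?s y = sharp (g y) (\<lambda>w. w $ \<mu>)" if "y \<in> S" for y
    using sharp_cramer(2)[OF bil[OF that] pos[OF that] linear_vec_component] by simp
qed

lemma P_differentiable: "(\<lambda>y. P y v) differentiable (at x)"
  unfolding delta_op_def
  by (intro differentiable_minus differentiable_sum' differentiable_scaleR Fdiff sharp_differentiable)

lemma g_linear: "y \<in> S \<Longrightarrow> linear (g y u)" "y \<in> S \<Longrightarrow> linear (\<lambda>u. g y u w)"
  using bil by (auto simp: bilinear_def)

lemma g_eqI: "(\<And>w. g x u w = g x u' w) \<Longrightarrow> u = u'"
proof -
  assume "\<And>w. g x u w = g x u' w"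
  then have "g x (u - u') (u - u') = 0" using linear_diff[OF g_linear(2)[OF S(2)]] by simp
  then show "u = u'" using pos[OF S(2), of "u - u'"] by fastforce
qed

text \<open>\<open>delta_op\<close> fills the first slot; moving that vector past the other three
  costs the sign that the minus in \<open>P\<close> cancels.\<close>

lemma g_P:
  assumes y: "y \<in> S" shows "g y (P y v) w = F y (seq4 (v 0) (v 1) (v 2) w)"
proof -
  have lin: "linear (\<lambda>w. F y (case_nat w v))"
    using interior_linear[of 3 "F y" v] form[OF y] by (simp add: interior_def)
  have "g y (P y v) w = - (\<Sum>\<mu>\<in>UNIV. F y (case_nat (axis \<mu> 1) v) * g y (sharp (g y) (\<lambda>w. w $ \<mu>)) w)"
    unfolding delta_op_def
    by (simp add: linear_neg[OF g_linear(2)[OF y]] linear_sum[OF g_linear(2)[OF y]] linear_cmul[OF g_linear(2)[OF y]])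
  also have "\<dots> = - (\<Sum>\<mu>\<in>UNIV. w $ \<mu> * F y (case_nat (axis \<mu> 1) v))"
    by (simp add: sharp_cramer(1)[OF bil[OF y] pos[OF y] linear_vec_component] mult.commute)
  also have "\<dots> = - F y (case_nat w v)"
    using linear_axis_expansion[OF lin, of w] by simp
  also have "F y (case_nat w v) = F y (seq4 w (v 0) (v 1) (v 2))"
    by (subst form4_seq4[OF form[OF y]]) (simp add: eval_nat_numeral)
  also have "- \<dots> = F y (seq4 (v 0) (v 1) (v 2) w)"
    using form4_swap(1)[OF form[OF y], of w "v 0" "v 1" "v 2"] form4_swap(2)[OF form[OF y], of "v 0" w "v 1" "v 2"]
      form4_swap(3)[OF form[OF y], of "v 0" "v 1" w "v 2"] by simp
  finally show ?thesis .
qed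

lemma is_form_P:
  assumes y: "y \<in> S" shows "is_form 3 (\<lambda>v. P y v $ \<mu>)"
proof -
  have "is_form 3 (\<lambda>v. \<Sum>\<kappa>\<in>UNIV. (- sharp (g y) (\<lambda>w. w $ \<kappa>) $ \<mu>) * interior 4 (axis \<kappa> 1) (F y) v)"
    using is_form_interior[of 3 "F y"] form[OF y] by (intro is_form_sum is_form_scale) simp
  then show ?thesis by (simp add: delta_op_def interior_def sum_negf mult.commute)
qed

lemma g_p: "g x (p b c d) w = F x (seq4 b c d w)"
  unfolding g_P[OF S(2)] by (simp add: seq3_def)

lemma p_linear: "linear (\<lambda>b. p b c d)"
proof (rule linearI)
  note l = form4_linear(1)[OF form[OF S(2)]] and gl = g_linear(2)[OF S(2)]
  show "p (b + b') c d = p b c d + p b' c d" for b b'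
    by (rule g_eqI) (simp only: linear_add[OF gl] g_p linear_add[OF l])
  show "p (r *\<^sub>R b) c d = r *\<^sub>R p b c d" for r b
    by (rule g_eqI) (simp only: linear_cmul[OF gl] g_p linear_cmul[OF l])
qed

lemma p_swap: "p c b d = - p b c d" "p b d c = - p b c d"
proof -
  show "p c b d = - p b c d"
    by (rule g_eqI, unfold linear_neg[OF g_linear(2)[OF S(2)], of "p b c d"] g_p) (rule form4_swap(1)[OF form[OF S(2)]])
  show "p b d c = - p b c d"
    by (rule g_eqI, unfold linear_neg[OF g_linear(2)[OF S(2)], of "p b c d"] g_p) (rule form4_swap(2)[OF form[OF S(2)]])
qed

lemma dg_linear1: "linear (\<lambda>a. dg a u w)"
  by (rule linear_frechet_derivative[OF gdiff])

lemma dg_symm: "dg a u w = dg a w u"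
  by (rule fun_cong[OF frechet_derivative_transform_within_open[OF gdiff S]]) (rule symm)

lemma has_derivative_g: "((\<lambda>y. g y u w) has_derivative (\<lambda>a. dg a u w)) (at x)"
  using gdiff by (simp add: frechet_derivative_works)

text \<open>The Leibniz rule for \<open>g y (Q y) w\<close>; taking \<open>Q\<close> constant, it also gives the linearity of \<open>dg a\<close>.\<close>

lemma has_derivative_g_apply:
  assumes Q: "Q differentiable (at x)"
  shows "((\<lambda>y. g y (Q y) w) has_derivative
     (\<lambda>a. g x (frechet_derivative Q (at x) a) w + (\<Sum>k\<in>UNIV. Q x $ k * dg a (axis k 1) w))) (at x)"
proof -
  have dQ: "((\<lambda>y. Q y $ k) has_derivative (\<lambda>a. frechet_derivative Q (at x) a $ k)) (at x)" for k
    using Q by (intro bounded_linear.has_derivative[OF bounded_linear_vec_nth]) (simp add: frechet_derivative_works)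
  have "((\<lambda>y. \<Sum>k\<in>UNIV. Q y $ k * g y (axis k 1) w) has_derivative
     (\<lambda>a. \<Sum>k\<in>UNIV. Q x $ k * dg a (axis k 1) w + frechet_derivative Q (at x) a $ k * g x (axis k 1) w)) (at x)"
    by (intro has_derivative_sum has_derivative_mult dQ has_derivative_g)
  then have "((\<lambda>y. g y (Q y) w) has_derivative
     (\<lambda>a. \<Sum>k\<in>UNIV. Q x $ k * dg a (axis k 1) w + frechet_derivative Q (at x) a $ k * g x (axis k 1) w)) (at x)"
    by (rule has_derivative_transform_within_open[OF _ S])
      (use linear_axis_expansion[OF g_linear(2)] in \<open>simp add: mult.commute\<close>)
  moreover have "(\<Sum>k\<in>UNIV. Q x $ k * dg a (axis k 1) w + frechet_derivative Q (at x) a $ k * g x (axis k 1) w) =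
     g x (frechet_derivative Q (at x) a) w + (\<Sum>k\<in>UNIV. Q x $ k * dg a (axis k 1) w)" for a
    unfolding linear_axis_expansion[OF g_linear(2)[OF S(2)], of "frechet_derivative Q (at x) a" w]
    by (simp add: sum.distrib)
  ultimately show ?thesis by simp
qed

lemma dg_expansion: "dg a u w = (\<Sum>k\<in>UNIV. u $ k * dg a (axis k 1) w)"
proof -
  have "((\<lambda>y. g y u w) has_derivative
     (\<lambda>a. g x 0 w + (\<Sum>k\<in>UNIV. u $ k * dg a (axis k 1) w))) (at x)"
    using has_derivative_g_apply[of "\<lambda>_. u" w] by simp
  from frechet_derivative_at[OF this] have "g x 0 w + (\<Sum>k\<in>UNIV. u $ k * dg a (axis k 1) w) = dg a u w"
    by (rule fun_cong)
  then show ?thesis unfolding linear_0[OF g_linear(2)[OF S(2)]] by (simp only: add_0_left)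
qed

lemma dg_linear3: "linear (\<lambda>w. dg a u w)"
proof -
  have l: "linear (\<lambda>u. dg a u w)" for w
  proof (rule linearI)
    show "dg a (b + c) w = dg a b w + dg a c w" for b c
      unfolding dg_expansion[where a = a and u = "b + c" and w = w] dg_expansion[where a = a and u = b and w = w]
        dg_expansion[where a = a and u = c and w = w]
      by (simp add: distrib_right sum.distrib)
    show "dg a (r *\<^sub>R b) w = r *\<^sub>R dg a b w" for r b
      unfolding dg_expansion[where a = a and u = "r *\<^sub>R b" and w = w] dg_expansion[where a = a and u = b and w = w]
      by (simp add: sum_distrib_left mult.assoc)
  qed
  have "(\<lambda>w. dg a u w) = (\<lambda>w. dg a w u)" by (rule ext) (rule dg_symm)
  from ssubst[of _ _ linear, OF this l] show ?thesis .
qed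

lemma frechet_derivative_g_apply:
  assumes "Q differentiable (at x)"
  shows "frechet_derivative (\<lambda>y. g y (Q y) w) (at x) a = g x (frechet_derivative Q (at x) a) w + dg a (Q x) w"
  unfolding dg_expansion[where a = a and u = "Q x" and w = w]
  by (rule fun_cong[OF frechet_derivative_at[OF has_derivative_g_apply[OF assms, of w]], of a, symmetric])

lemma g_christoffel: "g x (\<Gamma> a b) w = (dg a b w + dg b a w - dg w a b) / 2"
proof -
  have "linear (\<lambda>w. dg a b w + dg b a w - dg w a b)"
    by (intro linear_compose_sub linear_compose_add dg_linear3 dg_linear1)
  from linear_scale_right[OF this, of "1/2"] have "linear (\<lambda>w. (dg a b w + dg b a w - dg w a b) / 2)" by simp
  from sharp_cramer(1)[OF bil[OF S(2)] pos[OF S(2)] this] show ?thesis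
    unfolding christoffel_def .
qed

lemma christoffel_symm: "\<Gamma> a b = \<Gamma> b a"
  by (rule g_eqI) (simp add: g_christoffel dg_symm[where u = a and w = b])

text \<open>The metric is parallel for the connection given by the Koszul formula.\<close>

lemma dg_eq_christoffel: "dg a u w = g x (\<Gamma> a u) w + g x (\<Gamma> a w) u"
  unfolding g_christoffel
  by (simp add: dg_symm[where a = a and u = w and w = u] dg_symm[where a = w and u = u and w = a]
      dg_symm[where a = u and u = w and w = a] field_simps)

definition nabla_P :: "real^8 \<Rightarrow> real^8 \<Rightarrow> real^8 \<Rightarrow> real^8 \<Rightarrow> real^8" where
  "nabla_P a b c d = D a b c d + (\<Gamma> a (p b c d) - p (\<Gamma> a b) c d - p b (\<Gamma> a c) d - p b c (\<Gamma> a d))"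

text \<open>Lowering an index commutes with covariant differentiation, because the metric is
  parallel.\<close>

lemma g_nabla_P: "g x (nabla_P a b c d) w = cov_deriv g 4 F x a (seq4 b c d w)"
proof -
  note gl = g_linear(2)[OF S(2)]
  have "frechet_derivative (\<lambda>y. F y (seq4 b c d w)) (at x) a = frechet_derivative (\<lambda>y. g y (P y (seq3 b c d)) w) (at x) a"
    by (rule fun_cong[OF frechet_derivative_transform_within_open[OF Fdiff S]]) (simp add: g_P seq3_def)
  also have "\<dots> = g x (D a b c d) w + dg a (p b c d) w"
    by (rule frechet_derivative_g_apply[OF P_differentiable])
  \<comment> \<open>Parallelism of the metric splits this into the connection term on the value of
    \<open>P\<close> and the one for the last slot of \<open>F\<close>.\<close>
  also have "dg a (p b c d) w = g x (\<Gamma> a (p b c d)) w + F x (seq4 b c d (\<Gamma> a w))"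
    unfolding dg_eq_christoffel symm[OF S(2), of "\<Gamma> a w"] g_p ..
  finally have F': "frechet_derivative (\<lambda>y. F y (seq4 b c d w)) (at x) a =
     g x (D a b c d) w + (g x (\<Gamma> a (p b c d)) w + F x (seq4 b c d (\<Gamma> a w)))" .
  have upd: "F x ((seq4 b c d w)(0 := z)) = F x (seq4 z c d w)" "F x ((seq4 b c d w)(1 := z)) = F x (seq4 b z d w)"
    "F x ((seq4 b c d w)(2 := z)) = F x (seq4 b c z w)" "F x ((seq4 b c d w)(3 := z)) = F x (seq4 b c d z)" for z
    by (rule is_form_cong[OF form[OF S(2)]]; simp add: seq4_def)+
  have s4: "(\<Sum>i<4. f i) = f 0 + f 1 + f 2 + f 3" for f :: "nat \<Rightarrow> real"
    by (simp add: eval_nat_numeral)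
  have sq: "seq4 b c d w 0 = b" "seq4 b c d w 1 = c" "seq4 b c d w 2 = d" "seq4 b c d w 3 = w"
    by (simp_all add: seq4_def)
  show ?thesis
    unfolding cov_deriv_def F' s4 upd sq nabla_P_def linear_add[OF gl] linear_diff[OF gl] g_p by simp
qed

lemma fn_bracket_P: "fn_bracket 3 3 P P x v = 2 *\<^sub>R brk p nabla_P v"
proof -
  let ?E = "\<lambda>a b c d. \<Gamma> a (p b c d) - p (\<Gamma> a b) c d - p b (\<Gamma> a c) d - p b c (\<Gamma> a d)"
  have "brk p D v = brk p (\<lambda>a b c d. nabla_P a b c d - ?E a b c d) v"
    by (simp add: nabla_P_def)
  also have "\<dots> = brk p nabla_P v - brk p ?E v"
    by (rule brk_diff[OF p_linear])
  also have "brk p ?E v = 0"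
    by (rule brk_connection_eq_0[OF p_linear p_swap christoffel_symm])
  finally show ?thesis
    using fn_bracket_eq_brk[OF S is_form_P P_differentiable] by simp
qed

lemma fn_bracket_in_frame:
  assumes U: "spin7_frame (F x) U" and iso: "\<And>y z. g x (U *v y) (U *v z) = y \<bullet> z"
    and \<tau>: "\<And>a v. cov_deriv g 4 F x (U *v a) v = in_frame U (lam4_0 (t a)) v"
  shows "fn_bracket 3 3 P P x (\<lambda>i. U *v v i) = U *v (2 *\<^sub>R brk p0 (q0 t) v)"
proof -
  have d: "det U \<noteq> 0" using U by (auto simp: spin7_frame_def)
  have eqI: "z = U *v z0" if "\<And>w. g x z (U *v w) = z0 \<bullet> w" for z z0
    by (rule g_eqI) (metis that iso frame_inverse(3)[OF d])
  have sq: "seq4 (U *v a) (U *v b) (U *v c) (U *v w) = (\<lambda>i. U *v seq4 a b c w i)" for a b c w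
    by (auto simp: seq4_def)
  have in4: "(\<chi> \<mu>. \<alpha> (seq4 a b c (axis \<mu> 1))) \<bullet> w = \<alpha> (seq4 a b c w)" if "is_form 4 \<alpha>" for \<alpha> :: "8 form" and a b c w
    unfolding linear_axis_expansion[OF form4_linear(4)[OF that], of _ _ _ w] by (simp add: inner_vec_def mult.commute)
  have p': "p (U *v a) (U *v b) (U *v c) = U *v p0 a b c" for a b c
  proof (rule eqI)
    show "g x (p (U *v a) (U *v b) (U *v c)) (U *v w) = p0 a b c \<bullet> w" for w
      using U in_frame_apply[OF d, of Phi0] unfolding g_p sq p0_def in4[OF is_form_Phi0] by (simp add: spin7_frame_def)
  qed
  have N': "nabla_P (U *v e) (U *v a) (U *v b) (U *v c) = U *v q0 t e a b c" for e a b c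
  proof (rule eqI)
    show "g x (nabla_P (U *v e) (U *v a) (U *v b) (U *v c)) (U *v w) = q0 t e a b c \<bullet> w" for w
      unfolding g_nabla_P \<tau> sq q0_def in4[OF is_form_lam4_0] by (rule in_frame_apply[OF d])
  qed
  show ?thesis
    unfolding fn_bracket_P
      brk_image[where L = "\<lambda>x. U *v x" and p = "\<lambda>a b c. p a b c" and ?p0.0 = p0 and D = nabla_P and ?D0.0 = "q0 t",
        OF matrix_vector_linear p' N'] by (simp add: linear_cmul[OF matrix_vector_linear])
qed

end

section \<open>The torsion and the bracket at a point\<close>

text \<open>Every component with nonzero index appears, up to sign, as the value of the 4-form on
  suitable basis vectors. This makes the torsion unique.\<close>

lemma lam4_0_inject:
  assumes "a \<in> V7" "b \<in> V7" "lam4_0 a = lam4_0 b" shows "a = b"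
proof -
  have ex: "\<exists>k l m n. distinct4 k l m n \<and> xr k (xr l (xr m n)) = j" if "j \<noteq> I0" for j
  proof -
    have "\<exists>l m n. distinct4 I0 l m n \<and> xr I0 (xr l (xr m n)) = j" if "distinct4 I0 l m n" "xr I0 (xr l (xr m n)) = j" for l m n
      using that by blast
    \<comment> \<open>Together with index 0 these triples have exclusive or 1, 2, 3, 4, 5, 6 and 7,
      in this order.\<close>
    note this[of I2 I4 I7] this[of I1 I4 I7] this[of I1 I4 I6] this[of I1 I2 I7] this[of I1 I2 I6] this[of I1 I2 I5] this[of I1 I2 I4]
    with \<open>j \<noteq> I0\<close> show ?thesis by (cases j) (auto simp: distinct4_def)
  qed
  have "a $ ix j = b $ ix j" for j
  proof (cases "j = I0")
    case True
    then show ?thesis using V7_component[OF assms(1)] V7_component[OF assms(2)] by simp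
  next
    case False
    then obtain k l m n where k: "distinct4 k l m n" "xr k (xr l (xr m n)) = j" using ex by blast
    have "lam4_0 a (bas [k, l, m, n]) = lam4_0 b (bas [k, l, m, n])" by (simp add: assms(3))
    then show ?thesis
      using k by (simp add: lam4_0_bas[OF assms(1)] lam4_0_bas[OF assms(2)] sg_def split: if_splits)
  qed
  then show ?thesis using forall_8_ix[of "\<lambda>\<mu>. a $ \<mu> = b $ \<mu>"] by (simp add: vec_eq_iff)
qed

lemma contr_eq_0:
  assumes "\<And>y. \<tau> y = 0" shows "contr \<tau> = 0"
proof -
  have "contr \<tau> $ \<kappa> = 0" for \<kappa> by (simp add: contr_def assms)
  then show ?thesis by (simp add: vec_eq_iff)
qed

context
  fixes M :: "'a topology" and A :: "('a, 8) chart set"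
    and \<Phi> :: "('a, 8) chart \<Rightarrow> real^8 \<Rightarrow> 8 form"
    and g :: "('a, 8) chart \<Rightarrow> real^8 \<Rightarrow> real^8 \<Rightarrow> real^8 \<Rightarrow> real"
  assumes M: "oriented_manifold M A" and \<Phi>: "spin7_structure A \<Phi>" and g: "spin7_metric A \<Phi> g"
begin

context
  fixes c :: "('a, 8) chart" and x :: "real^8"
  assumes c: "c \<in> A" and x: "x \<in> chart_image c"
begin

section \<open>The section H in terms of the torsion\<close>

lemma chart_open: "open (chart_image c)"
  using M c by (auto simp: oriented_manifold_def)

lemma chart_metric:
  "y \<in> chart_image c \<Longrightarrow> bilinear (g c y)" "y \<in> chart_image c \<Longrightarrow> g c y v w = g c y w v"
  "y \<in> chart_image c \<Longrightarrow> v \<noteq> 0 \<Longrightarrow> g c y v v > 0" "(\<lambda>y. g c y v w) differentiable (at x)"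
proof -
  have *: "(\<forall>x\<in>chart_image c. bilinear (g c x) \<and> (\<forall>v w. g c x v w = g c x w v) \<and> (\<forall>v. v \<noteq> 0 \<longrightarrow> g c x v v > 0)) \<and>
        (\<forall>v w. smooth_on (chart_image c) (\<lambda>x. g c x v w))"
    using g c unfolding spin7_metric_def riemannian_metric_def by blast
  then show "y \<in> chart_image c \<Longrightarrow> bilinear (g c y)" "y \<in> chart_image c \<Longrightarrow> g c y v w = g c y w v"
    "y \<in> chart_image c \<Longrightarrow> v \<noteq> 0 \<Longrightarrow> g c y v v > 0"
    by blast+
  show "(\<lambda>y. g c y v w) differentiable (at x)"
    using * smooth_on_differentiable[OF _ x] by blast
qed

lemma chart_form:
  "y \<in> chart_image c \<Longrightarrow> is_form 4 (\<Phi> c y)" "(\<lambda>y. \<Phi> c y v) differentiable (at x)"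
proof -
  have *: "(\<forall>x\<in>chart_image c. is_form 4 (\<Phi> c x)) \<and> (\<forall>v. smooth_on (chart_image c) (\<lambda>x. \<Phi> c x v))"
    using \<Phi> c unfolding spin7_structure_def form_field_def by blast
  then show "y \<in> chart_image c \<Longrightarrow> is_form 4 (\<Phi> c y)" by blast
  show "(\<lambda>y. \<Phi> c y v) differentiable (at x)"
    using * smooth_on_differentiable[OF _ x] by blast
qed

lemma chart_frames:
  "y \<in> chart_image c \<Longrightarrow> \<exists>U. spin7_frame (\<Phi> c y) U"
  "y \<in> chart_image c \<Longrightarrow> \<forall>U. spin7_frame (\<Phi> c y) U \<longrightarrow>
     (\<forall>\<mu> \<nu>. g c y (column \<mu> U) (column \<nu> U) = (if \<mu> = \<nu> then 1 else 0))"
  using \<Phi> g c unfolding spin7_structure_def spin7_metric_def by blast+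

lemmas point = chart_frames(1)[OF x] chart_metric(1)[OF x] chart_frames(2)[OF x]

lemmas calc = chart_open x chart_metric chart_form

lemma H_PP_at_point:
  fixes T :: "'a cotW7_field"
  assumes T: "torsion_endomorphism A \<Phi> g T"
  defines "U \<equiv> some_frame (\<Phi> c x)"
  shows "T c x \<in> cotW7 (\<Phi> c x)" "H_PP \<Phi> g c x \<in> cotW7 (\<Phi> c x)"
    "H_PP \<Phi> g c x (U *v y) U =
       -2 *\<^sub>R T c x (U *v y) U - (2/3) *\<^sub>R cross2 (contr (\<lambda>y. T c x (U *v y) U)) y"
proof -
  show Tc: "T c x \<in> cotW7 (\<Phi> c x)"
    using T c x unfolding torsion_endomorphism_def cotW7_section_def by blast
  define t where "t y = T c x (U *v y) U" for y
  \<comment> \<open>The pairing of the full bracket is -24 and -8 times the two terms; division by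
    12 gives these coefficients.\<close>
  define t' where "t' y = -2 *\<^sub>R t y - (2/3) *\<^sub>R cross2 (contr t) y" for y
  have U: "spin7_frame (\<Phi> c x) U" unfolding U_def by (rule U0[OF point])
  have t: "linear t" "t y \<in> V7" for y
    using rep_linear[OF point Tc] rep_V7[OF point Tc] by (simp_all add: t_def[abs_def] U_def)
  have t': "linear t'" "t' y \<in> V7" for y
    unfolding t'_def[abs_def]
    by (intro linear_compose_sub linear_compose_scale_right t cross2_linear V7_diff V7_scale cross2_V7)+
  have cov: "cov_deriv (g c) 4 (\<Phi> c) x (U *v a) v = in_frame U (lam4_0 (t a)) v" for a v
  proof -
    have "cov_deriv (g c) 4 (\<Phi> c) x (U *v a) = lam4 (\<Phi> c x) (T c x (U *v a))"
      using T c x unfolding torsion_endomorphism_def by blast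
    then show ?thesis by (simp add: lam4_def t_def U_def)
  qed
  let ?K = "fn_bracket 3 3 (cross_product \<Phi> g c) (cross_product \<Phi> g c) x"
  let ?B = "\<lambda>v. 2 *\<^sub>R brk p0 (q0 t) v"
  have cp: "cross_product \<Phi> g c = (\<lambda>y v. - delta_op (g c y) (\<Phi> c y) v)"
    by (intro ext) (simp add: cross_product_def)
  have KU: "?K (\<lambda>i. U *v v i) = U *v ?B v" for v
    unfolding cp by (rule fn_bracket_in_frame[OF calc U frame_isometry[OF point U] cov])
  have form: "is_form 6 (\<lambda>v. ?B v $ \<mu>)" for \<mu>
    using is_form_scale[OF is_form_brk[OF t], of 2] by simp
  have pair: "wedge 6 2 (\<lambda>v. ?B v $ \<nu>) (lam2_0 b) (bas idxs) = 12 * (t' (axis \<nu> 1) \<bullet> b)" if b: "b \<in> V7" for \<nu> b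
    using wedge_scale_left[of 6 2 2 "\<lambda>v. brk p0 (q0 t) v $ \<nu>"] wedge_brk_lam2_0[OF t b]
    by (simp add: t'_def inner_diff_left)
  note H = H_iso_pi7[OF point form KU[unfolded U_def] t' pair]
  show "H_PP \<Phi> g c x \<in> cotW7 (\<Phi> c x)" unfolding H_PP_def by (rule H(1))
  have "H_PP \<Phi> g c x (U *v y) U = t' y" unfolding H_PP_def U_def by (rule H(2))
  then show "H_PP \<Phi> g c x (U *v y) U =
       -2 *\<^sub>R T c x (U *v y) U - (2/3) *\<^sub>R cross2 (contr (\<lambda>y. T c x (U *v y) U)) y"
    by (simp add: t'_def t_def[abs_def])
qed

text \<open>
  In the frame, \<open>H = -2 T - (2/3) J J\<^sup>T T\<close> with \<open>J J\<^sup>T\<close> equal to \<open>7\<close> on \<open>W8\<close> and to \<open>0\<close> on \<open>W48\<close>.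
\<close>

lemma H_PP_components:
  fixes T :: "'a cotW7_field"
  assumes T: "torsion_endomorphism A \<Phi> g T"
  shows "H_PP \<Phi> g c x \<in> W48 (\<Phi> c x) \<longleftrightarrow> T c x \<in> W48 (\<Phi> c x)"
    "H_PP \<Phi> g c x \<in> W8 (\<Phi> c x) \<longleftrightarrow> T c x \<in> W8 (\<Phi> c x)"
    "H_PP \<Phi> g c x = (\<lambda>_ _. 0) \<longleftrightarrow> T c x = (\<lambda>_ _. 0)"
proof -
  define U where "U = some_frame (\<Phi> c x)"
  define t where "t y = T c x (U *v y) U" for y
  define t' where "t' y = H_PP \<Phi> g c x (U *v y) U" for y
  note H = H_PP_at_point[OF T]
  have t': "t' = (\<lambda>y. -2 *\<^sub>R t y - (2/3) *\<^sub>R cross2 (contr t) y)"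
    using H(3) by (simp add: t'_def t_def[abs_def] U_def fun_eq_iff)
  \<comment> \<open>The factor is -2 - (2/3) 7, since J^T J = 7.\<close>
  have ct': "contr t' = (-20/3) *\<^sub>R contr t"
    unfolding t' contr_diff contr_scale contr_cross2 by (simp add: vec_eq_iff)
  have cl: "cross2 (r *\<^sub>R a) y = r *\<^sub>R cross2 a y" "cross2 (a + b) y = cross2 a y + cross2 b y" for r a b y
    by (rule linear_cmul[OF cross2_linear(1)], rule linear_add[OF cross2_linear(1)])
  show "H_PP \<Phi> g c x \<in> W48 (\<Phi> c x) \<longleftrightarrow> T c x \<in> W48 (\<Phi> c x)"
    unfolding W48_iff[OF point H(1)] W48_iff[OF point H(2)]
    using ct' by (simp add: t'_def[abs_def] t_def[abs_def] U_def)
  have "(\<exists>a. \<forall>y. t' y = cross2 a y) \<longleftrightarrow> (\<exists>a. \<forall>y. t y = cross2 a y)"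
  proof
    assume "\<exists>a. \<forall>y. t' y = cross2 a y"
    then obtain a where a: "\<And>y. t' y = cross2 a y" by blast
    \<comment> \<open>The witness solves the formula for \<open>t'\<close> for
      \<open>t\<close>.\<close>
    have "t y = cross2 ((-1/2) *\<^sub>R a + (-1/3) *\<^sub>R contr t) y" for y
      unfolding cl a[symmetric] t' by (simp add: vec_eq_iff algebra_simps)
    then show "\<exists>a. \<forall>y. t y = cross2 a y" by blast
  next
    assume "\<exists>a. \<forall>y. t y = cross2 a y"
    then obtain a where a: "t = cross2 a" by blast
    have "t' y = cross2 ((-20/3) *\<^sub>R a) y" for y
      unfolding t' a contr_cross2 cl by (simp add: vec_eq_iff)
    then show "\<exists>a. \<forall>y. t' y = cross2 a y" by blast
  qed
  then show "H_PP \<Phi> g c x \<in> W8 (\<Phi> c x) \<longleftrightarrow> T c x \<in> W8 (\<Phi> c x)"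
    unfolding W8_iff[OF point H(1)] W8_iff[OF point H(2)] by (simp add: t'_def t_def U_def)
  have zero: "\<tau> = (\<lambda>_ _. 0) \<longleftrightarrow> (\<forall>y. \<tau> (U *v y) U = 0)" if "\<tau> \<in> cotW7 (\<Phi> c x)" for \<tau>
    using cotW7_eqI[OF point that cotW7_0[OF point]] by (auto simp: U_def)
  have "(\<forall>y. t' y = 0) \<longleftrightarrow> (\<forall>y. t y = 0)"
  proof
    assume z: "\<forall>y. t' y = 0"
    then have "contr t' = 0" by (intro contr_eq_0) simp
    \<comment> \<open>The factor -20/3 is nonzero; with \<open>contr t = 0\<close> the formula
      leaves \<open>t' = -2 t\<close>.\<close>
    then have "contr t = 0" using ct' by simp
    then show "\<forall>y. t y = 0" using z linear_0[OF cross2_linear(1)] by (simp add: t')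
  next
    assume z: "\<forall>y. t y = 0"
    then have "contr t = 0" by (intro contr_eq_0) simp
    then show "\<forall>y. t' y = 0" using z linear_0[OF cross2_linear(1)] by (simp add: t')
  qed
  then show "H_PP \<Phi> g c x = (\<lambda>_ _. 0) \<longleftrightarrow> T c x = (\<lambda>_ _. 0)"
    unfolding zero[OF H(1)] zero[OF H(2)] by (simp add: t'_def t_def)
qed

end

section \<open>Uniqueness of the metric and the torsion\<close>

lemma metric_unique:
  assumes g': "spin7_metric A \<Phi> g'" and c: "c \<in> A" and y: "y \<in> chart_image c"
  shows "g' c y = g c y"
proof (intro ext)
  fix v w
  obtain U where U: "spin7_frame (\<Phi> c y) U" using chart_frames(1)[OF c y y] by blast
  have "g' c y (U *v a) (U *v b) = a \<bullet> b" for a b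
  proof (rule frame_isometry[OF chart_frames(1)[OF c y y] _ _ U])
    show "bilinear (g' c y)"
      using g' c y unfolding spin7_metric_def riemannian_metric_def by blast
    show "\<forall>U. spin7_frame (\<Phi> c y) U \<longrightarrow>
        (\<forall>\<mu> \<nu>. g' c y (column \<mu> U) (column \<nu> U) = (if \<mu> = \<nu> then 1 else 0))"
      using g' c y unfolding spin7_metric_def by blast
  qed
  moreover have "g c y (U *v a) (U *v b) = a \<bullet> b" for a b
    by (rule frame_isometry[OF point[OF c y] U])
  ultimately have "g' c y (U *v a) (U *v b) = g c y (U *v a) (U *v b)" for a b by simp
  from this[of "matrix_inv U *v v" "matrix_inv U *v w"] show "g' c y v w = g c y v w"
    by (simp add: frame_inverse(3)[OF spin7_frame_det(2)[OF U]])
qed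

text \<open>Christoffel symbols contain derivatives of the metric, so the metrics are compared on
  the whole open chart and not only at \<open>x\<close>. Then both torsions describe the same
  covariant derivative, and \<lambda>^4 is injective.\<close>

lemma torsion_unique:
  assumes T: "torsion_endomorphism A \<Phi> g T"
    and g': "spin7_metric A \<Phi> g'" and T': "torsion_endomorphism A \<Phi> g' T'"
    and c: "c \<in> A" and x: "x \<in> chart_image c"
  shows "T' c x = T c x"
proof -
  have "frechet_derivative (\<lambda>y. g c y v w) (at x) = frechet_derivative (\<lambda>y. g' c y v w) (at x)" for v w
    by (rule frechet_derivative_transform_within_open[OF chart_metric(4)[OF c x] chart_open[OF c x] x])
      (simp add: metric_unique[OF g' c])
  then have "christoffel (g' c) x = christoffel (g c) x"
    by (intro ext) (simp add: christoffel_def metric_unique[OF g' c x])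
  then have cov: "cov_deriv (g' c) 4 (\<Phi> c) x = cov_deriv (g c) 4 (\<Phi> c) x"
    by (intro ext) (simp add: cov_deriv_def)
  let ?U = "some_frame (\<Phi> c x)"
  note point = point[OF c x]
  have Tc: "T c x \<in> cotW7 (\<Phi> c x)" "T' c x \<in> cotW7 (\<Phi> c x)"
    using T T' c x unfolding torsion_endomorphism_def cotW7_section_def by blast+
  show ?thesis
  proof (rule cotW7_eqI[OF point Tc(2) Tc(1)])
    fix y
    have "cov_deriv (g c) 4 (\<Phi> c) x (?U *v y) = lam4 (\<Phi> c x) (T c x (?U *v y))"
      "cov_deriv (g' c) 4 (\<Phi> c) x (?U *v y) = lam4 (\<Phi> c x) (T' c x (?U *v y))"
      using T T' c x unfolding torsion_endomorphism_def by blast+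
    then have "in_frame ?U (lam4_0 (T' c x (?U *v y) ?U)) = in_frame ?U (lam4_0 (T c x (?U *v y) ?U))"
      by (simp add: cov lam4_def)
    then have "lam4_0 (T' c x (?U *v y) ?U) = lam4_0 (T c x (?U *v y) ?U)"
      by (rule in_frame_inject[OF spin7_frame_det(2)[OF U0[OF point]]])
    then show "T' c x (?U *v y) ?U = T c x (?U *v y) ?U"
      by (rule lam4_0_inject[OF rep_V7[OF point Tc(2)] rep_V7[OF point Tc(1)]])
  qed
qed

text \<open>The class asks for some metric and some torsion; by uniqueness these have the values of
  the given ones in every chart.\<close>

lemma fernandez_class_iff:
  assumes T: "torsion_endomorphism A \<Phi> g T"
  shows "\<Phi> \<in> fernandez_class A S \<longleftrightarrow> (\<forall>c\<in>A. \<forall>x\<in>chart_image c. T c x \<in> S (\<Phi> c x))"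
proof
  assume "\<Phi> \<in> fernandez_class A S"
  then obtain g' T' where "spin7_metric A \<Phi> g'" "torsion_endomorphism A \<Phi> g' T'"
      "\<forall>c\<in>A. \<forall>x\<in>chart_image c. T' c x \<in> S (\<Phi> c x)"
    unfolding fernandez_class_def by blast
  then show "\<forall>c\<in>A. \<forall>x\<in>chart_image c. T c x \<in> S (\<Phi> c x)"
    using torsion_unique[OF T, of g' T'] by auto
next
  assume "\<forall>c\<in>A. \<forall>x\<in>chart_image c. T c x \<in> S (\<Phi> c x)"
  then show "\<Phi> \<in> fernandez_class A S"
    unfolding fernandez_class_def using \<Phi> g T by blast
qed

end

section \<open>Vanishing of the components and the four classes\<close>

theorem mainTheorem4:
  fixes M :: "'a topology" and A :: "('a, 8) chart set"
    and \<Phi> :: "('a, 8) chart \<Rightarrow> real^8 \<Rightarrow> 8 form"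
    and g :: "('a, 8) chart \<Rightarrow> real^8 \<Rightarrow> real^8 \<Rightarrow> real^8 \<Rightarrow> real"
    and T :: "'a cotW7_field"
  assumes "oriented_manifold M A"
    and "spin7_structure A \<Phi>"
    and "spin7_metric A \<Phi> g"
    and "torsion_endomorphism A \<Phi> g T"
  shows
    "(vanishes A (\<lambda>c x. pr8 (\<Phi> c x) (T c x)) \<longleftrightarrow>
        vanishes A (\<lambda>c x. pr8 (\<Phi> c x) (H_PP \<Phi> g c x))) \<and>
     (vanishes A (\<lambda>c x. pr48 (\<Phi> c x) (T c x)) \<longleftrightarrow>
        vanishes A (\<lambda>c x. pr48 (\<Phi> c x) (H_PP \<Phi> g c x))) \<and>
     (\<forall>B\<in>{T, H_PP \<Phi> g}.
        \<Phi> \<in> fernandez_class A W8_plus_W48 \<and>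
        (\<Phi> \<in> fernandez_class A W48 \<longleftrightarrow> vanishes A (\<lambda>c x. pr8 (\<Phi> c x) (B c x))) \<and>
        (\<Phi> \<in> fernandez_class A W8 \<longleftrightarrow> vanishes A (\<lambda>c x. pr48 (\<Phi> c x) (B c x))) \<and>
        (\<Phi> \<in> fernandez_class A W_zero \<longleftrightarrow> vanishes A B))"
proof -
  note struct = assms(1-3) and T = assms(4)
  note point = point[OF struct] and H = H_PP_at_point[OF struct _ _ T]
    and comp = H_PP_components[OF struct _ _ T]
  \<comment> \<open>A projection vanishes exactly on the complementary summand, so all relations on
    either section become memberships of \<open>T\<close>.\<close>
  have 8: "vanishes A (\<lambda>c x. pr8 (\<Phi> c x) (T c x)) \<longleftrightarrow> (\<forall>c\<in>A. \<forall>x\<in>chart_image c. T c x \<in> W48 (\<Phi> c x))"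
    "vanishes A (\<lambda>c x. pr8 (\<Phi> c x) (H_PP \<Phi> g c x)) \<longleftrightarrow> (\<forall>c\<in>A. \<forall>x\<in>chart_image c. T c x \<in> W48 (\<Phi> c x))"
    using pr8_eq_0_iff[OF point H(1)] pr8_eq_0_iff[OF point H(2)] comp(1) by (auto simp: vanishes_def)
  have 48: "vanishes A (\<lambda>c x. pr48 (\<Phi> c x) (T c x)) \<longleftrightarrow> (\<forall>c\<in>A. \<forall>x\<in>chart_image c. T c x \<in> W8 (\<Phi> c x))"
    "vanishes A (\<lambda>c x. pr48 (\<Phi> c x) (H_PP \<Phi> g c x)) \<longleftrightarrow> (\<forall>c\<in>A. \<forall>x\<in>chart_image c. T c x \<in> W8 (\<Phi> c x))"
    using pr48_eq_0_iff[OF point H(1)] pr48_eq_0_iff[OF point H(2)] comp(2) by (auto simp: vanishes_def)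
  have 0: "vanishes A (H_PP \<Phi> g) \<longleftrightarrow> vanishes A T"
    using comp(3) by (auto simp: vanishes_def)
  note fc = fernandez_class_iff[OF struct T]
  have "\<Phi> \<in> fernandez_class A W8_plus_W48"
    unfolding fc using mem_W8_plus_W48[OF point H(1)] by blast
  moreover have "\<Phi> \<in> fernandez_class A W_zero \<longleftrightarrow> vanishes A T"
    unfolding fc by (auto simp: vanishes_def W_zero_def)
  ultimately show ?thesis
    unfolding 8 48 fc[of W48] fc[of W8] by (auto simp: 0 8 48)
qed

end
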